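(* Let $0<|q|<1$ with a fixed choice of $q^{1/2}$. For all partitions $\lambda,\mu$, the inner product of the standard and the S-dual bases is given by the Hopf-link invariant: $$W_{\lambda\mu}=q^{\frac{\kappa_\lambda}2+\frac{\kappa_\mu}2}(-q^{-\frac12})^{|\lambda|+|\mu|}\,\mathcal N_\varnothing^{-1}\;{}_{\mathcal S}\langle\lambda|\mu\rangle=q^{\frac{\kappa_\lambda}2+\frac{\kappa_\mu}2}q^{\frac12|\lambda|+\frac12|\mu|}\,\mathcal N_\varnothing^{-1}\,\langle\mu'|\lambda'\rangle_{\mathcal S}.$$
   Context: For a partition $\lambda$: $\lambda'$ is the conjugate, $|\lambda|$ the size, $\kappa_\lambda=\sum_i\lambda_i(\lambda_i-2i+1)$, $\rho=(-\tfrac12,-\tfrac32,\dots)$, $p_n(x)=\sum_ix_i^n$, $q^{-\lambda-\rho}=(q^{-\lambda_i+i-1/2})_{i\ge1}$; $s_{\lambda/\eta}$ are skew Schur functions. Topological vertex: $C_{\lambda\mu\nu}=q^{\kappa_\mu/2}s_{\nu'}(q^{-\rho})\sum_\eta s_{\lambda'/\eta}(q^{-\nu-\rho})s_{\mu/\eta}(q^{-\nu'-\rho})$. Hopf-link invariant: $W_{\lambda\mu}=q^{\kappa_\mu/2}C_{\varnothing\lambda\mu'}$ (which equals $q^{\kappa_\lambda/2}C_{\varnothing\mu\lambda'}$). Standard basis: free fermion modes $\psi_r,\psi_r^\dagger$ ($r\in\mathbb Z+\frac12$) with $\{\psi_r,\psi^\dagger_s\}=\delta_{r+s,0}$, other anticommutators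 zero, vacuum $\psi_r|0\rangle=\psi^\dagger_r|0\rangle=0$ for $r>0$. Bosons $a_n=-\sum_r:\psi_r\psi^\dagger_{n-r}:$ satisfy $[a_m,a_n]=m\delta_{m+n,0}$. With $\mathrm{diag}(\lambda)=\#\{i:i\le\lambda_i\}$, $$|\lambda\rangle=\prod_{i=1}^{\mathrm{diag}(\lambda)}\big[(-1)^{-\lambda_i+i}\psi_{-\lambda'_i+i-1/2}\psi^\dagger_{-\lambda_i+i-1/2}\big]|0\rangle ,$$ a basis of the charge-zero sector; $\langle\lambda|$ is the dual basis, $\langle\lambda|\mu\rangle=\delta_{\lambda\mu}$, $\langle0|=\langle\varnothing|$. S-dual basis (kets and bras in the graded completions): $$|\lambda\rangle_{\mathcal S}=\mathcal N_\lambda\exp\Big[-\sum_{n>0}\tfrac{a_{-n}}{n}\sum_{l>0}q^{(-\lambda'_l+l-1)n}\Big]|0\rangle,\quad {}_{\mathcal S}\langle\lambda|=\mathcal N'_\lambda\langle0|\exp\Big[\sum_{n>0}\tfrac{a_n}{n}\sum_{l>0}q^{(-\lambda_l+l)n}\Big],$$ $$\mathcal N_\lambda=\Big[(-1)^{|\lambda|}q^{\frac12\kappa_\lambda-|\lambda|}\prod_{i,j>0}(1-q^{-\lambda_i-\lambda'_j+i+j-1})^{-1}\Big]^{1/2},$$ $$\mathcal N'_\lambda=(-1)^{|\lambda|}\Big[(-1)^{|\lambda|}q^{-\frac12\kappa_\lambda+|\lambda|}\prod_{i,j>0}(1-q^{-\lambda_i-\lambda'_j+i+j-1})^{-1}\Big]^{1/2}.$$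 The square roots are the holomorphic ones in $|q|<1$ that are positive for $0<q<1$; in particular $\mathcal N_\varnothing=\prod_{n\ge1}(1-q^n)^{-n/2}$. Here ${}_{\mathcal S}\langle\lambda|\mu\rangle$ pairs the S-dual bra of $\lambda$ with the standard ket of $\mu$, and $\langle\lambda|\mu\rangle_{\mathcal S}$ pairs the standard bra of $\lambda$ with the S-dual ket of $\mu$. *)

theory Defs
  imports "HOL-Analysis.Analysis"
begin

section \<open>Partitions\<close>

text \<open>A partition is the sequence of its parts, indexed from 1; the entry at index 0 is a dummy
  fixed to 0, so that equal partitions are equal as functions.\<close>

typedef partition = "{l :: nat \<Rightarrow> nat. l 0 = 0 \<and> antimono_on {1..} l \<and> finite {i. l i \<noteq> 0}}"
  morphisms part Abs_partition
  by (rule exI[of _ "\<lambda>_. 0"]) (auto simp: monotone_on_def)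

setup_lifting type_definition_partition

lift_definition empty_part :: partition is "\<lambda>_. 0"
  by (auto simp: monotone_on_def)

lift_definition conj_part :: "partition \<Rightarrow> partition"
  is "\<lambda>l j. if j = 0 then 0 else card {i. 1 \<le> i \<and> j \<le> l i}"
proof -
  fix l :: "nat \<Rightarrow> nat"
  assume l: "l 0 = 0 \<and> antimono_on {1..} l \<and> finite {i. l i \<noteq> 0}"
  have fin: "finite {i. 1 \<le> i \<and> j \<le> l i}" if "1 \<le> j" for j
    by (rule finite_subset[of _ "{i. l i \<noteq> 0}"]) (use l that in auto)
  have le: "l i \<le> l 1" if "1 \<le> i" for i
    using l that by (auto simp: monotone_on_def)
  have "{j. (if j = 0 then 0 else card {i. 1 \<le> i \<and> j \<le> l i}) \<noteq> 0} \<subseteq> {..l 1}"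
  proof
    fix j assume "j \<in> {j. (if j = 0 then 0 else card {i. 1 \<le> i \<and> j \<le> l i}) \<noteq> 0}"
    then have "card {i. 1 \<le> i \<and> j \<le> l i} \<noteq> 0" by (simp split: if_splits)
    then have "{i. 1 \<le> i \<and> j \<le> l i} \<noteq> {}" by (metis card.empty)
    then show "j \<in> {..l 1}" using le order_trans by fastforce
  qed
  then have "finite {j. (if j = 0 then 0 else card {i. 1 \<le> i \<and> j \<le> l i}) \<noteq> 0}"
    by (rule finite_subset) simp
  moreover have "antimono_on {1..} (\<lambda>j. if j = 0 then 0 else card {i. 1 \<le> i \<and> j \<le> l i})"
    using fin unfolding monotone_on_def by (auto intro!: card_mono)
  ultimately show "(if (0::nat) = 0 then 0 else card {i. 1 \<le> i \<and> 0 \<le> l i}) = 0 \<and>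
      antimono_on {1..} (\<lambda>j. if j = 0 then 0 else card {i. 1 \<le> i \<and> j \<le> l i}) \<and>
      finite {j. (if j = 0 then 0 else card {i. 1 \<le> i \<and> j \<le> l i}) \<noteq> 0}"
    by simp
qed

definition psize :: "partition \<Rightarrow> nat" where
  "psize la = (\<Sum>i | part la i \<noteq> 0. part la i)"

definition kappa :: "partition \<Rightarrow> int" where
  "kappa la = (\<Sum>i | part la i \<noteq> 0. int (part la i) * (int (part la i) - 2 * int i + 1))"

definition diag_len :: "partition \<Rightarrow> nat" where
  "diag_len la = card {i. 1 \<le> i \<and> i \<le> part la i}"


section \<open>Skew Schur functions at infinitely many variables\<close>

text \<open>The variables are \<open>x 1, x 2, \<dots>\<close>; the value \<open>x 0\<close> is not used.\<close>

definition skew_cells :: "partition \<Rightarrow> partition \<Rightarrow> (nat \<times> nat) set" where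
  "skew_cells la \<eta> = {(i, j). 1 \<le> i \<and> part \<eta> i < j \<and> j \<le> part la i}"

definition skew_ssyt :: "partition \<Rightarrow> partition \<Rightarrow> (nat \<times> nat \<Rightarrow> nat) set" where
  "skew_ssyt la \<eta> = {T \<in> skew_cells la \<eta> \<rightarrow>\<^sub>E {1..}.
     (\<forall>i j k. (i, j) \<in> skew_cells la \<eta> \<longrightarrow> (i, k) \<in> skew_cells la \<eta> \<longrightarrow> j < k \<longrightarrow> T (i, j) \<le> T (i, k)) \<and>
     (\<forall>i j k. (i, j) \<in> skew_cells la \<eta> \<longrightarrow> (k, j) \<in> skew_cells la \<eta> \<longrightarrow> i < k \<longrightarrow> T (i, j) < T (k, j))}"

definition skew_schur :: "partition \<Rightarrow> partition \<Rightarrow> (nat \<Rightarrow> complex) \<Rightarrow> complex" where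
  "skew_schur la \<eta> x =
     (if \<forall>i. part \<eta> i \<le> part la i
      then \<Sum>\<^sub>\<infinity>T\<in>skew_ssyt la \<eta>. \<Prod>c\<in>skew_cells la \<eta>. x (T c) else 0)"

definition schur :: "partition \<Rightarrow> (nat \<Rightarrow> complex) \<Rightarrow> complex" where
  "schur la x = skew_schur la empty_part x"


section \<open>Topological vertex and Hopf-link invariant\<close>

text \<open>The argument \<open>t\<close> is the chosen square root \<open>q\<^sup>1\<^sup>/\<^sup>2\<close>, so that \<open>q\<close> to the power \<open>k/2\<close>
  is \<open>t powi k\<close>.\<close>

text \<open>The variables \<open>q\<close> to the power \<open>- \<nu> - \<rho>\<close>: the \<open>i\<close>-th one has exponent
  \<open>- \<nu>\<^sub>i + i - 1/2\<close>.\<close>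

definition q_vars :: "complex \<Rightarrow> partition \<Rightarrow> nat \<Rightarrow> complex" where
  "q_vars t \<nu> i = t powi (2 * (int i - int (part \<nu> i)) - 1)"

definition top_vertex :: "complex \<Rightarrow> partition \<Rightarrow> partition \<Rightarrow> partition \<Rightarrow> complex" where
  "top_vertex t la \<mu> \<nu> =
     t powi kappa \<mu> * schur (conj_part \<nu>) (q_vars t empty_part) *
     (\<Sum>\<^sub>\<infinity>\<eta>. skew_schur (conj_part la) \<eta> (q_vars t \<nu>) * skew_schur \<mu> \<eta> (q_vars t (conj_part \<nu>)))"

definition hopf_link :: "complex \<Rightarrow> partition \<Rightarrow> partition \<Rightarrow> complex" where
  "hopf_link t la \<mu> = t powi kappa \<mu> * top_vertex t empty_part la (conj_part \<mu>)"


section \<open>Normalization factors\<close>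

definition norm_prod :: "partition \<Rightarrow> complex \<Rightarrow> complex" where
  "norm_prod la q = (\<Prod>i. \<Prod>j. inverse (1 - q powi
     (- int (part la (Suc i)) - int (part (conj_part la) (Suc j)) + int (Suc i) + int (Suc j) - 1)))"

text \<open>The holomorphic square root of \<open>F\<close> on the unit disc that is positive on \<open>]0, 1[\<close>. The origin is
  excluded from the equation because \<open>0\<close> has no negative powers; the value there is determined by
  continuity.\<close>

definition disc_sqrt :: "(complex \<Rightarrow> complex) \<Rightarrow> complex \<Rightarrow> complex" where
  "disc_sqrt F = (SOME f. f holomorphic_on ball 0 1 \<and>
     (\<forall>z\<in>ball 0 1 - {0}. (f z)\<^sup>2 = F z) \<and>
     (\<forall>x::real. 0 < x \<and> x < 1 \<longrightarrow> (\<exists>y::real. 0 < y \<and> f (of_real x) = of_real y)))"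

text \<open>\<open>kappa\<close> takes only even values, so \<open>kappa la div 2\<close> is an exact half.\<close>

definition norm_ket :: "partition \<Rightarrow> complex \<Rightarrow> complex" where
  "norm_ket la = disc_sqrt (\<lambda>q.
     (-1) ^ psize la * q powi (kappa la div 2 - int (psize la)) * norm_prod la q)"

definition norm_bra :: "partition \<Rightarrow> complex \<Rightarrow> complex" where
  "norm_bra la q = (-1) ^ psize la * disc_sqrt (\<lambda>q.
     (-1) ^ psize la * q powi (- (kappa la div 2) + int (psize la)) * norm_prod la q) q"


section \<open>Free fermions\<close>

definition half_ints :: "rat set" where
  "half_ints = range (\<lambda>k::int. of_int k + 1/2)"

text \<open>The last assumption says that the Fock space is generated by the modes from the vacuum.\<close>

locale fermion_fock = vector_space scale
  for scale :: "complex \<Rightarrow> 'v::ab_group_add \<Rightarrow> 'v" +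
  fixes psi psid :: "rat \<Rightarrow> 'v \<Rightarrow> 'v"
    and vac :: 'v
  assumes psi_linear: "r \<in> half_ints \<Longrightarrow> Vector_Spaces.linear scale scale (psi r)"
    and psid_linear: "r \<in> half_ints \<Longrightarrow> Vector_Spaces.linear scale scale (psid r)"
    and anticomm_psi_psid: "\<lbrakk>r \<in> half_ints; s \<in> half_ints\<rbrakk> \<Longrightarrow>
          psi r (psid s v) + psid s (psi r v) = (if r + s = 0 then v else 0)"
    and anticomm_psi_psi: "\<lbrakk>r \<in> half_ints; s \<in> half_ints\<rbrakk> \<Longrightarrow>
          psi r (psi s v) + psi s (psi r v) = 0"
    and anticomm_psid_psid: "\<lbrakk>r \<in> half_ints; s \<in> half_ints\<rbrakk> \<Longrightarrow>
          psid r (psid s v) + psid s (psid r v) = 0"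
    and psi_vac: "\<lbrakk>r \<in> half_ints; r > 0\<rbrakk> \<Longrightarrow> psi r vac = 0"
    and psid_vac: "\<lbrakk>r \<in> half_ints; r > 0\<rbrakk> \<Longrightarrow> psid r vac = 0"
    and vac_nonzero: "vac \<noteq> 0"
    and vac_cyclic: "\<lbrakk>subspace S; vac \<in> S;
          \<And>r v. r \<in> half_ints \<Longrightarrow> v \<in> S \<Longrightarrow> psi r v \<in> S \<and> psid r v \<in> S\<rbrakk> \<Longrightarrow> S = UNIV"
begin

definition normal_ordered :: "rat \<Rightarrow> rat \<Rightarrow> 'v \<Rightarrow> 'v" where
  "normal_ordered r s v = (if r > 0 then - psid s (psi r v) else psi r (psid s v))"

text \<open>On each vector only finitely many terms of the mode sum are nonzero; the sum ranges over
  those.\<close>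

definition boson :: "int \<Rightarrow> 'v \<Rightarrow> 'v" where
  "boson n v = - (\<Sum>r | r \<in> half_ints \<and> normal_ordered r (of_int n - r) v \<noteq> 0.
     normal_ordered r (of_int n - r) v)"

definition ket :: "partition \<Rightarrow> 'v" where
  "ket la = foldr (\<lambda>i v. scale ((-1) powi (- int (part la i) + int i))
       (psi (- of_nat (part (conj_part la) i) + of_nat i - 1/2)
         (psid (- of_nat (part la i) + of_nat i - 1/2) v)))
     [1..<Suc (diag_len la)] vac"

text \<open>The basis dual to the kets of the charge-zero sector.\<close>

definition bra :: "partition \<Rightarrow> 'v \<Rightarrow> complex" where
  "bra la v = representation (range ket) v (ket la)"

text \<open>An element of the graded completion is the sequence of its homogeneous components, of degree
  \<open>d = 0, 1, \<dots>\<close>; the ket and the bra of a partition have its size as degree. For kets a component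
  is a vector, for bras it is a functional. The operator \<open>\<Sum>n>0. c n a\<^sub>-\<^sub>n\<close> acts on completed kets by
  \<open>raise_ket c\<close>, and \<open>\<Sum>n>0. c n a\<^sub>n\<close> acts on completed bras, from the right, by \<open>raise_bra c\<close>.
  Both raise the degree by at least 1, so that in degree \<open>d\<close> the exponential series applied to the
  vacuum stops at the \<open>d\<close>-th power.\<close>

definition raise_ket :: "(nat \<Rightarrow> complex) \<Rightarrow> (nat \<Rightarrow> 'v) \<Rightarrow> (nat \<Rightarrow> 'v)" where
  "raise_ket c w d = (\<Sum>n=1..d. scale (c n) (boson (- int n) (w (d - n))))"

definition raise_bra :: "(nat \<Rightarrow> complex) \<Rightarrow> (nat \<Rightarrow> 'v \<Rightarrow> complex) \<Rightarrow> (nat \<Rightarrow> 'v \<Rightarrow> complex)" where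
  "raise_bra c b d v = (\<Sum>n=1..d. c n * b (d - n) (boson (int n) v))"

definition exp_ket :: "(nat \<Rightarrow> complex) \<Rightarrow> nat \<Rightarrow> 'v" where
  "exp_ket c d = (\<Sum>k\<le>d. scale (inverse (fact k))
     ((raise_ket c ^^ k) (\<lambda>e. if e = 0 then vac else 0) d))"

definition exp_bra :: "(nat \<Rightarrow> complex) \<Rightarrow> nat \<Rightarrow> 'v \<Rightarrow> complex" where
  "exp_bra c d v = (\<Sum>k\<le>d. inverse (fact k) *
     (raise_bra c ^^ k) (\<lambda>e. if e = 0 then bra empty_part else (\<lambda>_. 0)) d v)"

definition S_ket :: "complex \<Rightarrow> partition \<Rightarrow> nat \<Rightarrow> 'v" where
  "S_ket q la d = scale (norm_ket la q) (exp_ket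
     (\<lambda>n. - (1 / of_nat n) *
        (\<Sum>\<^sub>\<infinity>l\<in>{1..}. q powi ((- int (part (conj_part la) l) + int l - 1) * int n))) d)"

definition S_bra :: "complex \<Rightarrow> partition \<Rightarrow> nat \<Rightarrow> 'v \<Rightarrow> complex" where
  "S_bra q la d v = norm_bra la q * exp_bra
     (\<lambda>n. (1 / of_nat n) *
        (\<Sum>\<^sub>\<infinity>l\<in>{1..}. q powi ((- int (part la l) + int l) * int n))) d v"

text \<open>The two mixed inner products: S-dual bra with standard ket, standard bra with S-dual ket. In
  both sums only one degree contributes.\<close>

definition S_bra_ket :: "complex \<Rightarrow> partition \<Rightarrow> partition \<Rightarrow> complex" where
  "S_bra_ket q la \<mu> = (\<Sum>\<^sub>\<infinity>d. S_bra q la d (ket \<mu>))"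

definition bra_S_ket :: "complex \<Rightarrow> partition \<Rightarrow> partition \<Rightarrow> complex" where
  "bra_S_ket q la \<mu> = (\<Sum>\<^sub>\<infinity>d. bra la (S_ket q \<mu> d))"

end

end

theory Submission
  imports Defs "HOL-Complex_Analysis.Complex_Analysis" "Jordan_Normal_Form.Determinant"
begin

text \<open>Expanding the definitions, \<open>W\<^sub>\<lambda>\<^sub>\<mu>\<close> is a power of \<open>q\<^sup>1\<^sup>/\<^sup>2\<close> times
  \<open>s\<^sub>\<mu>(q\<^sup>-\<^sup>\<rho>) s\<^sub>\<lambda>(q\<^sup>-\<^sup>\<mu>\<^sup>-\<^sup>\<rho>)\<close>. In terms of alternants this is, up to a factor symmetric in
  \<open>\<lambda>\<close> and \<open>\<mu>\<close>, the limit of a ratio of determinants \<open>det(q\<^sup>-\<^sup>l\<^sup>m)\<close> over the shifted parts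
  \<open>l = \<lambda>\<^sub>i - i\<close>, \<open>m = \<mu>\<^sub>j - j\<close>, and so it is symmetric.

  A standard ket is, up to sign, a semi-infinite wedge, on which \<open>a\<^sub>n\<close> acts by lowering one of the
  shifted parts by \<open>n\<close>. The Jacobi--Trudi determinant satisfies the same recursion, obtained by
  applying \<open>k h\<^sub>k = \<Sum>n. p\<^sub>n h\<^sub>k\<^sub>-\<^sub>n\<close> row by row, so that \<open>\<langle>0| exp(\<Sum>n. p\<^sub>n a\<^sub>n / n) |\<mu>\<rangle>\<close> is
  \<open>(-1)\<^bsup>|\<mu>|\<^esup> s\<^sub>\<mu>\<close>; the completed kets follow from the transposition symmetry of the bosons and
  the dual Jacobi--Trudi formula.

  Finally, the norm product of \<open>\<lambda>\<close> is that of the empty partition times a monomial and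
  \<open>s\<^sub>\<lambda>(q\<^sup>-\<^sup>\<rho>)\<^sup>2\<close>, because a truncated double product is a Vandermonde product up to q-factorials.
  The holomorphic square roots are then read off.\<close>

section \<open>Determinants\<close>

text \<open>Symmetric functions are parametrized by their power sums: \<open>newton p\<close> solves
  Newton's recursion for an arbitrary sequence \<open>p\<close>. One determinant \<open>jt\<close>
  then serves four purposes: power sums of finitely many variables give Schur polynomials, their
  limits give Schur functions, negated power sums give the dual Jacobi-Trudi formula, and the
  coefficients of a vertex operator, \<open>p n = n * c n\<close>, give its matrix elements. Rows of
  \<open>jt\<close> carry arbitrary integers, because a boson may destroy the order of the shifted
  parts; repeated and too low entries then give 0 for wedges and determinants alike.

  The half-integral powers of q have one source. The bra involves the variables q^(l - la_l), the
  ket of the conjugate those with exponent l - 1 - la_l; they are q^(1/2) and q^(-1/2) times the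
  variables of q^(-la-rho), and homogeneity turns this into powers of \<open>t\<close>. The same
  shifts produce q, q^2, ... and 1, q, ..., whose Schur functions are holomorphic on the disc and
  enter the square roots, while q^(-rho) itself would require a branch of q^(1/2).\<close>

definition fdet :: "nat \<Rightarrow> (nat \<Rightarrow> nat \<Rightarrow> 'a::comm_ring_1) \<Rightarrow> 'a" where
  "fdet K A = Determinant.det (Matrix.mat K K (\<lambda>(i, j). A i j))"

lemma fdet_leibniz:
  "fdet K A = (\<Sum>p | p permutes {0..<K}. of_int (sign p) * (\<Prod>i=0..<K. A i (p i)))"
proof -
  have "p i < K" if "p permutes {0..<K}" "i < K" for p i
    using permutes_in_image[OF that(1), of i] that(2) by auto
  then show ?thesis unfolding fdet_def Determinant.det_def by (auto intro!: sum.cong)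
qed

lemma fdet_cong: "(\<And>i j. i < K \<Longrightarrow> j < K \<Longrightarrow> A i j = B i j) \<Longrightarrow> fdet K A = fdet K B"
  unfolding fdet_def by (rule arg_cong[of _ _ Determinant.det]) auto

lemma fdet_transpose: "fdet K (\<lambda>i j. A j i) = fdet K A"
proof -
  have "Matrix.mat K K (\<lambda>(i, j). A j i) = (Matrix.mat K K (\<lambda>(i, j). A i j))\<^sup>T"
    by auto
  then show ?thesis
    unfolding fdet_def using Determinant.det_transpose[of "Matrix.mat K K (\<lambda>(i, j). A i j)" K] by auto
qed

lemma fdet_mult: "fdet K (\<lambda>i j. \<Sum>k<K. A i k * B k j) = fdet K A * fdet K B"
proof -
  have "Matrix.mat K K (\<lambda>(i, j). \<Sum>k<K. A i k * B k j)
      = Matrix.mat K K (\<lambda>(i, j). A i j) * Matrix.mat K K (\<lambda>(i, j). B i j)"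
    by (rule eq_matI) (auto simp: scalar_prod_def atLeast0LessThan)
  then show ?thesis
    unfolding fdet_def using Determinant.det_mult[of "Matrix.mat K K (\<lambda>(i, j). A i j)" K] by auto
qed

lemma fdet_upper_triangular:
  assumes "\<And>i j. j < i \<Longrightarrow> i < K \<Longrightarrow> A i j = 0"
  shows "fdet K A = (\<Prod>i<K. A i i)"
proof -
  let ?M = "Matrix.mat K K (\<lambda>(i, j). A i j)"
  have "Determinant.det ?M = prod_list (diag_mat ?M)"
    by (rule Determinant.det_upper_triangular[where n=K]) (use assms in auto)
  also have "\<dots> = (\<Prod>i<K. A i i)"
    by (simp add: prod_list_diag_prod atLeast0LessThan)
  finally show ?thesis by (simp add: fdet_def)
qed

lemma fdet_identical_rows:
  assumes "i < K" "j < K" "i \<noteq> j" "\<And>k. k < K \<Longrightarrow> A i k = A j k"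
  shows "fdet K A = 0"
  unfolding fdet_def
  by (rule Determinant.det_identical_rows[of _ K i j]) (use assms in auto)

lemma fdet_zero_row:
  assumes "i < K" "\<And>k. k < K \<Longrightarrow> A i k = 0"
  shows "fdet K A = 0"
  unfolding fdet_leibniz
proof (rule sum.neutral, rule ballI, clarify)
  fix p assume p: "p permutes {0..<K}"
  then have "p i < K" using permutes_in_image[OF p, of i] assms by auto
  then have "(\<Prod>i=0..<K. A i (p i)) = 0"
    using assms \<open>p i < K\<close> by (intro prod_zero) (auto intro!: bexI[of _ i])
  then show "of_int (sign p) * (\<Prod>i=0..<K. A i (p i)) = 0" by simp
qed

text \<open>Multilinearity in all rows at once: \<open>\<beta>\<close> picks one summand from each
  row. The branching rules below are read off from the set of these choices.\<close>

lemma fdet_row_expand: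
  assumes "\<And>i. i < K \<Longrightarrow> finite (B i)"
  shows "fdet K (\<lambda>i j. \<Sum>b\<in>B i. f i b j) = (\<Sum>\<beta>\<in>PiE {0..<K} B. fdet K (\<lambda>i j. f i (\<beta> i) j))"
proof -
  have "(\<Prod>i=0..<K. \<Sum>b\<in>B i. f i b (p i)) = (\<Sum>\<beta>\<in>PiE {0..<K} B. \<Prod>i=0..<K. f i (\<beta> i) (p i))" for p
    using assms by (intro prod_sum_PiE) auto
  then show ?thesis
    unfolding fdet_leibniz by (simp add: sum_distrib_left sum.swap[of _ "PiE {0..<K} B"])
qed

lemma fdet_scale_rows: "fdet K (\<lambda>i j. c i * A i j) = (\<Prod>i<K. c i) * fdet K A"
  unfolding fdet_leibniz
  by (simp add: prod.distrib sum_distrib_left atLeast0LessThan mult_ac)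

lemma fdet_scale_cols: "fdet K (\<lambda>i j. c j * A i j) = (\<Prod>i<K. c i) * fdet K A"
proof -
  have "fdet K (\<lambda>i j. c j * A i j) = fdet K (\<lambda>i j. c i * A j i)"
    using fdet_transpose[of K "\<lambda>i j. c i * A j i"] by simp
  also have "\<dots> = (\<Prod>i<K. c i) * fdet K (\<lambda>i j. A j i)" by (rule fdet_scale_rows)
  finally show ?thesis by (simp only: fdet_transpose[of K A])
qed

lemma fdet_swap_rows:
  assumes "i < K" "j < K" "i \<noteq> j"
  shows "fdet K (\<lambda>k. A (Transposition.transpose i j k)) = - fdet K A"
proof -
  have "swaprows i j (Matrix.mat K K (\<lambda>(i, j). A i j))
      = Matrix.mat K K (\<lambda>(k, l). A (Transposition.transpose i j k) l)"
    by (rule eq_matI) (use assms in \<open>auto simp: Transposition.transpose_def\<close>)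
  then show ?thesis
    unfolding fdet_def using Determinant.det_swaprows[of i K j "Matrix.mat K K (\<lambda>(i, j). A i j)"] assms by auto
qed

lemma fdet_tendsto:
  fixes A :: "nat \<Rightarrow> nat \<Rightarrow> nat \<Rightarrow> 'a::{real_normed_algebra,comm_ring_1}"
  assumes "\<And>i j. i < K \<Longrightarrow> j < K \<Longrightarrow> ((\<lambda>N. A N i j) \<longlongrightarrow> L i j) F"
  shows "((\<lambda>N. fdet K (A N)) \<longlongrightarrow> fdet K L) F"
  unfolding fdet_leibniz
proof (intro tendsto_intros, clarify)
  fix p i assume "p permutes {0..<K}" "i \<in> {0..<K}"
  then show "((\<lambda>N. A N i (p i)) \<longlongrightarrow> L i (p i)) F"
    using assms permutes_in_image[of p "{0..<K}" i] by auto
qed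

lemma fdet_holomorphic:
  assumes "\<And>i j. i < K \<Longrightarrow> j < K \<Longrightarrow> (\<lambda>z. A z i j) holomorphic_on S"
  shows "(\<lambda>z. fdet K (A z)) holomorphic_on S"
  unfolding fdet_leibniz
proof (intro holomorphic_intros, clarify)
  fix p i assume "p permutes {0..<K}" "i \<in> {0..<K}"
  then show "(\<lambda>z. A z i (p i)) holomorphic_on S"
    using assms permutes_in_image[of p "{0..<K}" i] by auto
qed

lemma fdet_Suc_first_col:
  assumes "\<And>i. 0 < i \<Longrightarrow> i < Suc K \<Longrightarrow> A i 0 = 0"
  shows "fdet (Suc K) A = A 0 0 * fdet K (\<lambda>i j. A (Suc i) (Suc j))"
proof -
  let ?M = "Matrix.mat (Suc K) (Suc K) (\<lambda>(i, j). A i j)"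
  have "Determinant.det ?M = (\<Sum>i<Suc K. ?M $$ (i, 0) * cofactor ?M i 0)"
    by (rule laplace_expansion_column) auto
  also have "\<dots> = (\<Sum>i\<in>{0}. ?M $$ (i, 0) * cofactor ?M i 0)"
    by (rule sum.mono_neutral_right) (use assms in auto)
  also have "\<dots> = A 0 0 * Determinant.det (mat_delete ?M 0 0)"
    by (simp add: cofactor_def)
  also have "mat_delete ?M 0 0 = Matrix.mat K K (\<lambda>(i, j). A (Suc i) (Suc j))"
    by (rule eq_matI) (auto simp: mat_delete_def)
  finally show ?thesis by (simp add: fdet_def)
qed

lemma vandermonde_fdet:
  fixes y :: "nat \<Rightarrow> 'a::comm_ring_1"
  shows "fdet K (\<lambda>i j. y i ^ j) = (\<Prod>j<K. \<Prod>i<j. (y j - y i))"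
proof (induction K arbitrary: y)
  case 0
  then show ?case by (simp add: fdet_leibniz)
next
  case (Suc K)
  text \<open>\<open>?U\<close> subtracts \<open>y 0\<close> times the previous column from each column.\<close>
  let ?U = "\<lambda>k j. if k = j then 1 else if Suc k = j then - y 0 else (0::'a)"
  have U: "fdet (Suc K) ?U = 1"
    by (subst fdet_upper_triangular) auto
  have eq: "(\<Sum>k<Suc K. y i ^ k * ?U k j) = (if j = 0 then 1 else y i ^ (j - 1) * (y i - y 0))"
    if "j < Suc K" for i j
  proof -
    have "(\<Sum>k<Suc K. y i ^ k * ?U k j) = (\<Sum>k\<in>(if j = 0 then {j} else {j, j - 1}). y i ^ k * ?U k j)"
      using that by (intro sum.mono_neutral_right) (auto split: if_splits)
    also have "\<dots> = (if j = 0 then 1 else y i ^ (j - 1) * (y i - y 0))"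
      by (cases j) (auto simp: algebra_simps)
    finally show ?thesis .
  qed
  have "fdet (Suc K) (\<lambda>i j. y i ^ j) = fdet (Suc K) (\<lambda>i j. \<Sum>k<Suc K. y i ^ k * ?U k j)"
    using fdet_mult[of "Suc K" "\<lambda>i j. y i ^ j" ?U] U by simp
  also have "\<dots> = fdet (Suc K) (\<lambda>i j. if j = 0 then 1 else y i ^ (j - 1) * (y i - y 0))"
    by (rule fdet_cong) (use eq in auto)
  \<comment> \<open>The column operations clear the first row except its corner; transposing makes
    this the first column, along which \<open>fdet_Suc_first_col\<close> expands.\<close>
  also have "\<dots> = fdet (Suc K) (\<lambda>i j. if i = 0 then 1 else y j ^ (i - 1) * (y j - y 0))"
    by (rule fdet_transpose[symmetric])
  also have "\<dots> = fdet K (\<lambda>i j. (y (Suc j) - y 0) * y (Suc j) ^ i)"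
    by (subst fdet_Suc_first_col) (auto simp: mult.commute)
  also have "\<dots> = (\<Prod>j<K. y (Suc j) - y 0) * fdet K (\<lambda>i j. y (Suc i) ^ j)"
    by (simp add: fdet_scale_cols fdet_transpose[of K "\<lambda>i j. y (Suc i) ^ j"])
  also have "fdet K (\<lambda>i j. y (Suc i) ^ j) = (\<Prod>j<K. \<Prod>i<j. y (Suc j) - y (Suc i))"
    by (rule Suc.IH)
  finally show ?case
    by (simp add: prod.lessThan_Suc_shift prod.distrib del: prod.lessThan_Suc)
qed

section \<open>Partitions\<close>

lemma part_0 [simp]: "part la 0 = 0"
  using part[of la] by auto

lemma part_antimono: "1 \<le> i \<Longrightarrow> i \<le> j \<Longrightarrow> part la j \<le> part la i"
  using part[of la] by (auto simp: monotone_on_def)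

lemma finite_part_support: "finite {i. part la i \<noteq> 0}"
  using part[of la] by auto

lemma partition_eqI:
  assumes "\<And>i. 1 \<le> i \<Longrightarrow> part la i = part \<mu> i"
  shows "la = \<mu>"
proof -
  have "part la i = part \<mu> i" for i
    using assms[of i] by (cases i) auto
  then show ?thesis by (metis ext part_inject)
qed

lemma part_empty [simp]: "part empty_part i = 0"
  by (simp add: empty_part.rep_eq)

lemma ex_partition:
  fixes f :: "nat \<Rightarrow> nat"
  assumes "\<And>i. 1 \<le> i \<Longrightarrow> f (Suc i) \<le> f i" and "\<And>i. n < i \<Longrightarrow> f i = 0"
  obtains \<nu> where "\<And>i. 1 \<le> i \<Longrightarrow> part \<nu> i = f i"
proof
  let ?g = "\<lambda>i. if i = 0 then 0 else f i"
  have anti: "f j \<le> f i" if "1 \<le> i" "i \<le> j" for i j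
    using that(2) that(1) by (induction j rule: dec_induct) (use assms(1) in \<open>auto intro: le_trans\<close>)
  have "{i. ?g i \<noteq> 0} \<subseteq> {..n}"
    using assms(2) by (auto simp: not_less[symmetric] split: if_splits)
  then have "finite {i. ?g i \<noteq> 0}" by (rule finite_subset) simp
  then have "?g \<in> {l. l 0 = 0 \<and> antimono_on {1..} l \<and> finite {i. l i \<noteq> 0}}"
    using anti by (auto simp: monotone_on_def)
  then have "part (Abs_partition ?g) = ?g" by (rule Abs_partition_inverse)
  then show "part (Abs_partition ?g) i = f i" if "1 \<le> i" for i
    using that by simp
qed

text \<open>The rows that reach column \<open>j\<close> form an initial segment, so their number is
  at least \<open>i\<close> exactly if row \<open>i\<close> is among them. Both sides thus say that
  the cell (i, j) lies in the diagram.\<close>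

lemma le_part_conj_iff:
  assumes "1 \<le> i" "1 \<le> j"
  shows "i \<le> part (conj_part la) j \<longleftrightarrow> j \<le> part la i"
proof -
  let ?S = "{i. 1 \<le> i \<and> j \<le> part la i}"
  have fin: "finite ?S"
    by (rule finite_subset[OF _ finite_part_support[of la]]) (use assms in auto)
  have card: "part (conj_part la) j = card ?S"
    using assms by (simp add: conj_part.rep_eq)
  show ?thesis
  proof
    assume "j \<le> part la i"
    then have "{1..i} \<subseteq> ?S" using part_antimono[of _ i la] by fastforce
    then have "card {1..i} \<le> card ?S" by (intro card_mono fin)
    then show "i \<le> part (conj_part la) j" using card by simp
  next
    assume le: "i \<le> part (conj_part la) j"
    show "j \<le> part la i"
    proof (rule ccontr)
      assume "\<not> j \<le> part la i"
      then have "?S \<subseteq> {1..<i}"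
        using part_antimono[of i _ la] assms by (force simp: not_le)
      then have "card ?S \<le> card {1..<i}" by (intro card_mono) auto
      then show False using le card assms by simp
    qed
  qed
qed

text \<open>Parts of a conjugate are accessible through such comparisons
  (\<open>le_part_conj_iff\<close>), so equalities of partitions are reduced to them.\<close>

lemma part_eqI_le:
  assumes "\<And>k. 1 \<le> k \<Longrightarrow> k \<le> (a::nat) \<longleftrightarrow> k \<le> b"
  shows "a = b"
  using assms[of a] assms[of b] by (metis One_nat_def Suc_leI antisym le_refl not_gr_zero zero_le)

lemma conj_conj [simp]: "conj_part (conj_part la) = la"
  by (rule partition_eqI, rule part_eqI_le) (simp add: le_part_conj_iff)

lemma conj_empty [simp]: "conj_part empty_part = empty_part"
  by (rule partition_eqI, rule part_eqI_le) (simp add: le_part_conj_iff)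

section \<open>Length, size and contents of a partition\<close>

definition plen :: "partition \<Rightarrow> nat" where
  "plen la = part (conj_part la) 1"

lemma part_eq_0_iff: "1 \<le> i \<Longrightarrow> part la i = 0 \<longleftrightarrow> plen la < i"
  using le_part_conj_iff[of i 1 la] by (auto simp: plen_def)

lemma part_eq_0: "plen la < i \<Longrightarrow> part la i = 0"
  using part_eq_0_iff[of i la] by simp

lemma plen_conj: "plen (conj_part la) = part la 1"
  by (simp add: plen_def)

lemma plen_empty [simp]: "plen empty_part = 0"
  by (simp add: plen_def)

lemma plen_eq_0_iff: "plen la = 0 \<longleftrightarrow> la = empty_part"
proof
  assume "plen la = 0"
  then show "la = empty_part" by (intro partition_eqI) (simp add: part_eq_0)
qed simp

definition cells :: "partition \<Rightarrow> (nat \<times> nat) set" where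
  "cells la = {(i, j). 1 \<le> i \<and> 1 \<le> j \<and> j \<le> part la i}"

lemma skew_cells_empty: "skew_cells la empty_part = cells la"
  by (auto simp: skew_cells_def cells_def)

lemma cells_eq_Sigma:
  assumes "plen la \<le> K"
  shows "cells la = (SIGMA i:{1..K}. {1..part la i})"
proof -
  have "i \<le> K" if "1 \<le> i" "1 \<le> j" "j \<le> part la i" for i j
    using that assms part_eq_0[of la i] by (metis le_trans not_less not_one_le_zero)
  then show ?thesis by (auto simp: cells_def)
qed

lemma finite_cells [simp]: "finite (cells la)"
  by (subst cells_eq_Sigma[OF order_refl]) auto

lemma psize_eq:
  assumes "plen la \<le> K"
  shows "psize la = (\<Sum>i=1..K. part la i)"
  unfolding psize_def
proof (rule sum.mono_neutral_left)
  show "{i. part la i \<noteq> 0} \<subseteq> {1..K}"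
  proof
    fix i assume "i \<in> {i. part la i \<noteq> 0}"
    then have "i \<noteq> 0" "i \<le> plen la"
      using part_eq_0[of la i] by (cases i, auto simp: not_less[symmetric])
    then show "i \<in> {1..K}" using assms by simp
  qed
qed auto

lemma card_cells: "card (cells la) = psize la"
  unfolding cells_eq_Sigma[OF order_refl] psize_eq[OF order_refl] by (subst card_SigmaI) auto

lemma psize_empty [simp]: "psize empty_part = 0"
  by (simp add: psize_def)

lemma bij_betw_cells_conj: "bij_betw prod.swap (cells la) (cells (conj_part la))"
  by (rule bij_betwI[where g = prod.swap]) (auto simp: cells_def le_part_conj_iff)

lemma psize_conj [simp]: "psize (conj_part la) = psize la"
  using bij_betw_same_card[OF bij_betw_cells_conj, of la] by (simp add: card_cells)

lemma sum_content: "(\<Sum>j=1..n. 2 * (int j - int i)) = int n * (int n - 2 * int i + 1)"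
  by (induction n) (auto simp: algebra_simps)

lemma kappa_eq:
  assumes "plen la \<le> K"
  shows "kappa la = (\<Sum>i=1..K. int (part la i) * (int (part la i) - 2 * int i + 1))"
  unfolding kappa_def
proof (rule sum.mono_neutral_left)
  show "{i. part la i \<noteq> 0} \<subseteq> {1..K}"
  proof
    fix i assume "i \<in> {i. part la i \<noteq> 0}"
    then have "i \<noteq> 0" "i \<le> plen la"
      using part_eq_0[of la i] by (cases i, auto simp: not_less[symmetric])
    then show "i \<in> {1..K}" using assms by simp
  qed
qed auto

text \<open>As twice the sum of the contents, \<open>kappa\<close> is visibly even and changes sign
  when rows and columns are exchanged.\<close>

lemma kappa_cells: "kappa la = (\<Sum>(i, j)\<in>cells la. 2 * (int j - int i))"
  unfolding kappa_eq[OF order_refl] cells_eq_Sigma[OF order_refl]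
  by (subst sum.Sigma[symmetric]) (simp_all only: sum_content finite_atLeastAtMost ball_triv simp_thms)

lemma even_kappa: "even (kappa la)"
  unfolding kappa_cells by (intro dvd_sum) auto

lemma kappa_conj [simp]: "kappa (conj_part la) = - kappa la"
proof -
  have "kappa (conj_part la) = (\<Sum>c\<in>cells la. case prod.swap c of (i, j) \<Rightarrow> 2 * (int j - int i))"
    unfolding kappa_cells by (rule sum.reindex_bij_betw[OF bij_betw_cells_conj, symmetric])
  also have "\<dots> = - kappa la"
    unfolding kappa_cells by (subst sum_negf[symmetric]) (auto intro!: sum.cong)
  finally show ?thesis .
qed

text \<open>Interlacing of the parts: the skew shape has at most one cell in each column.\<close>

definition horiz_strip :: "partition \<Rightarrow> partition \<Rightarrow> bool" where
  "horiz_strip la \<mu> \<longleftrightarrow> (\<forall>i\<ge>1. part la (Suc i) \<le> part \<mu> i \<and> part \<mu> i \<le> part la i)"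

lemma part_le_conj:
  assumes "\<And>i. 1 \<le> i \<Longrightarrow> part \<mu> i \<le> part la i" "1 \<le> j"
  shows "part (conj_part \<mu>) j \<le> part (conj_part la) j"
proof (cases "part (conj_part \<mu>) j")
  case (Suc m)
  then have "j \<le> part \<mu> (Suc m)"
    using le_part_conj_iff[of "Suc m" j \<mu>] assms(2) by simp
  then show ?thesis
    using le_part_conj_iff[of "Suc m" j la] assms Suc by (metis le_add1 le_trans plus_1_eq_Suc)
qed simp

text \<open>Seen from the columns, a horizontal strip takes at most one cell from each of them. This
  form matches the dual determinant, whose rows belong to the conjugate partition.\<close>

lemma horiz_strip_conj:
  "horiz_strip la \<mu> \<longleftrightarrow> (\<forall>j\<ge>1. part (conj_part la) j \<le> Suc (part (conj_part \<mu>) j)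
      \<and> part (conj_part \<mu>) j \<le> part (conj_part la) j)"
proof (intro iffI allI impI conjI)
  fix j :: nat assume hs: "horiz_strip la \<mu>" and j: "1 \<le> j"
  show "part (conj_part \<mu>) j \<le> part (conj_part la) j"
    using part_le_conj[of \<mu> la j] hs j by (auto simp: horiz_strip_def)
  show "part (conj_part la) j \<le> Suc (part (conj_part \<mu>) j)"
  proof (rule ccontr)
    assume c: "\<not> ?thesis"
    let ?i = "Suc (part (conj_part \<mu>) j)"
    have "Suc ?i \<le> part (conj_part la) j" using c by simp
    then have "j \<le> part la (Suc ?i)" using le_part_conj_iff[of "Suc ?i" j la] j by simp
    also have "\<dots> \<le> part \<mu> ?i" using hs by (auto simp: horiz_strip_def)
    finally have "?i \<le> part (conj_part \<mu>) j" using le_part_conj_iff[of ?i j \<mu>] j by simp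
    then show False by simp
  qed
next
  assume *: "\<forall>j\<ge>1. part (conj_part la) j \<le> Suc (part (conj_part \<mu>) j)
      \<and> part (conj_part \<mu>) j \<le> part (conj_part la) j"
  have "part la (Suc i) \<le> part \<mu> i" if "1 \<le> i" for i
  proof (cases "part la (Suc i)")
    case (Suc m)
    then have "Suc i \<le> part (conj_part la) (Suc m)"
      using le_part_conj_iff[of "Suc i" "Suc m" la] by simp
    also have "\<dots> \<le> Suc (part (conj_part \<mu>) (Suc m))" using * by simp
    finally show ?thesis using le_part_conj_iff[of i "Suc m" \<mu>] that Suc by simp
  qed simp
  moreover have "part \<mu> i \<le> part la i" if "1 \<le> i" for i
    using part_le_conj[of "conj_part \<mu>" "conj_part la" i] * that by simp
  ultimately show "horiz_strip la \<mu>" by (simp add: horiz_strip_def)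
qed

lemma plen_mono:
  assumes "\<And>i. 1 \<le> i \<Longrightarrow> part \<mu> i \<le> part la i"
  shows "plen \<mu> \<le> plen la"
  unfolding plen_def by (rule part_le_conj) (use assms in auto)

lemma horiz_strip_plen: "horiz_strip la \<mu> \<Longrightarrow> plen \<mu> \<le> plen la"
  by (rule plen_mono) (auto simp: horiz_strip_def)

lemma horiz_strip_psize: "horiz_strip la \<mu> \<Longrightarrow> psize \<mu> \<le> psize la"
  using psize_eq[OF horiz_strip_plen, of la \<mu>] psize_eq[of la "plen la"]
  by (auto simp: horiz_strip_def intro!: sum_mono)

lemma psize_diff:
  assumes "\<And>i. 1 \<le> i \<Longrightarrow> part \<mu> i \<le> part la i" "plen la \<le> K"
  shows "psize la - psize \<mu> = (\<Sum>i<K. part la (Suc i) - part \<mu> (Suc i))"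
proof -
  have "plen \<mu> \<le> K" using plen_mono[OF assms(1)] assms(2) by simp
  then have "psize la - psize \<mu> = (\<Sum>i=1..K. part la i) - (\<Sum>i=1..K. part \<mu> i)"
    using assms(2) by (simp add: psize_eq)
  also have "\<dots> = (\<Sum>i=1..K. part la i - part \<mu> i)"
    by (rule sum_subtractf_nat[symmetric]) (use assms in auto)
  also have "{1..K} = Suc ` {..<K}"
    by (simp add: image_Suc_lessThan)
  finally show ?thesis by (simp add: sum.reindex)
qed

section \<open>Jacobi--Trudi determinants\<close>

text \<open>The complete symmetric function h_k as a polynomial in the power sums.\<close>

function newton :: "(nat \<Rightarrow> complex) \<Rightarrow> nat \<Rightarrow> complex" where
  "newton p k = (if k = 0 then 1 else (\<Sum>n=1..k. p n * newton p (k - n)) / of_nat k)"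
  by auto
termination by (relation "Wellfounded.measure (\<lambda>(p, k). k)") auto

declare newton.simps [simp del]

lemma newton_0 [simp]: "newton p 0 = 1"
  by (simp add: newton.simps)

lemma newton_rec: "of_nat k * newton p k = (\<Sum>n=1..k. p n * newton p (k - n))"
  by (cases "k = 0") (auto simp: newton.simps[of p k])

lemma newton_unique:
  assumes "f 0 = 1" and "\<And>k. of_nat k * f k = (\<Sum>n=1..k. p n * f (k - n))"
  shows "f k = newton p k"
proof (induction k rule: less_induct)
  case (less k)
  show ?case
  proof (cases "k = 0")
    case False
    have "of_nat k * f k = of_nat k * newton p k"
      unfolding assms(2) newton_rec by (rule sum.cong) (use less False in auto)
    then show ?thesis using False by simp
  qed (use assms in simp)
qed

lemma newton_cong: "(\<And>n. 1 \<le> n \<Longrightarrow> p n = p' n) \<Longrightarrow> newton p k = newton p' k"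
  by (rule newton_unique) (auto simp: newton_rec intro!: sum.cong)

lemma newton_zero: "newton (\<lambda>_. 0) k = (if k = 0 then 1 else 0)"
  by (rule newton_unique[symmetric]) auto

lemma newton_tendsto:
  assumes "\<And>n. 1 \<le> n \<Longrightarrow> ((\<lambda>N. p N n) \<longlongrightarrow> q n) F"
  shows "((\<lambda>N. newton (p N) k) \<longlongrightarrow> newton q k) F"
proof (induction k rule: less_induct)
  case (less k)
  show ?case
  proof (cases "k = 0")
    case False
    have "((\<lambda>N. (\<Sum>n=1..k. p N n * newton (p N) (k - n)) / of_nat k) \<longlongrightarrow>
        (\<Sum>n=1..k. q n * newton q (k - n)) / of_nat k) F"
      using assms less False by (intro tendsto_intros) auto
    then show ?thesis using False by (simp add: newton.simps[of _ k])
  qed simp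
qed

lemma newton_holomorphic:
  assumes "\<And>n. 1 \<le> n \<Longrightarrow> (\<lambda>z. p z n) holomorphic_on S"
  shows "(\<lambda>z. newton (p z) k) holomorphic_on S"
proof (induction k rule: less_induct)
  case (less k)
  show ?case
  proof (cases "k = 0")
    case False
    have "(\<lambda>z. (\<Sum>n=1..k. p z n * newton (p z) (k - n)) / of_nat k) holomorphic_on S"
      using assms less False by (intro holomorphic_intros) auto
    then show ?thesis using False by (simp add: newton.simps[of _ k])
  qed simp
qed

section \<open>Generating functions and adjunction of a variable\<close>

definition newton_fps :: "(nat \<Rightarrow> complex) \<Rightarrow> complex fps" where
  "newton_fps p = Abs_fps (newton p)"

definition psum_fps :: "(nat \<Rightarrow> complex) \<Rightarrow> complex fps" where
  "psum_fps p = Abs_fps (\<lambda>n. if n = 0 then 0 else p n)"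

lemma psum_fps_mult_nth: "fps_nth (F * psum_fps p) k = (\<Sum>n=1..k. p n * fps_nth F (k - n))"
proof -
  have "fps_nth (F * psum_fps p) k = (\<Sum>i=0..k. fps_nth (psum_fps p) i * fps_nth F (k - i))"
    by (subst mult.commute) (simp add: fps_mult_nth)
  also have "\<dots> = (\<Sum>n=1..k. p n * fps_nth F (k - n))"
    by (simp add: sum.atLeast_Suc_atMost psum_fps_def)
  finally show ?thesis .
qed

lemma X_deriv_nth: "fps_nth (fps_X * fps_deriv F) k = of_nat k * (fps_nth F k :: complex)"
  by (cases k) auto

lemma newton_fps_deriv: "fps_X * fps_deriv (newton_fps p) = newton_fps p * psum_fps p"
  by (rule fps_ext) (simp add: X_deriv_nth psum_fps_mult_nth newton_fps_def newton_rec)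

text \<open>Comparing coefficients turns the differential equation into Newton's recursion, which
  determines \<open>F\<close> from its constant term.\<close>

lemma newton_fps_unique:
  fixes F :: "complex fps"
  assumes "fps_nth F 0 = 1" and "fps_X * fps_deriv F = F * psum_fps p"
  shows "F = newton_fps p"
proof (rule fps_ext)
  fix k
  show "fps_nth F k = fps_nth (newton_fps p) k"
    unfolding newton_fps_def fps_nth_Abs_fps
    by (rule newton_unique) (use assms(1) X_deriv_nth[of F] psum_fps_mult_nth[of F p] assms(2) in auto)
qed

text \<open>A new variable \<open>y\<close> multiplies the generating function by 1 / (1 - y X). The
  product on the left satisfies the differential equation for \<open>p\<close>, because the power
  sums of \<open>y\<close> alone form the series y X / (1 - y X).\<close>

lemma newton_fps_add_var:
  "newton_fps (\<lambda>n. p n + y ^ n) * (1 - fps_const y * fps_X) = newton_fps p"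
proof (rule newton_fps_unique)
  let ?p' = "\<lambda>n. p n + y ^ n" and ?Y = "psum_fps (\<lambda>n. y ^ n)" and ?L = "1 - fps_const y * fps_X"
  have P: "psum_fps ?p' = psum_fps p + ?Y"
    by (rule fps_ext) (simp add: psum_fps_def)
  have Y: "?Y * ?L = fps_const y * fps_X"
  proof (rule fps_ext)
    fix k show "fps_nth (?Y * ?L) k = fps_nth (fps_const y * fps_X) k"
      by (cases k; cases "k - 1") (auto simp: psum_fps_def algebra_simps)
  qed
  have "fps_X * fps_deriv (newton_fps ?p' * ?L) =
      (fps_X * fps_deriv (newton_fps ?p')) * ?L - newton_fps ?p' * (fps_const y * fps_X)"
    by (simp add: algebra_simps)
  also have "\<dots> = newton_fps ?p' * (psum_fps p * ?L + (?Y * ?L - fps_const y * fps_X))"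
    by (simp add: newton_fps_deriv P algebra_simps)
  also have "\<dots> = newton_fps ?p' * ?L * psum_fps p"
    unfolding Y by (simp add: algebra_simps)
  finally show "fps_X * fps_deriv (newton_fps ?p' * ?L) = newton_fps ?p' * ?L * psum_fps p" .
qed (simp add: newton_fps_def)

lemma newton_add_var:
  "newton p (Suc k) = newton (\<lambda>n. p n + y ^ n) (Suc k) - y * newton (\<lambda>n. p n + y ^ n) k"
proof -
  have "newton p (Suc k) = fps_nth (newton_fps (\<lambda>n. p n + y ^ n) * (1 - fps_const y * fps_X)) (Suc k)"
    by (simp add: newton_fps_add_var) (simp add: newton_fps_def)
  also have "\<dots> = newton (\<lambda>n. p n + y ^ n) (Suc k) - y * newton (\<lambda>n. p n + y ^ n) k"
    by (simp add: newton_fps_def algebra_simps)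
  finally show ?thesis .
qed

definition hfun :: "(nat \<Rightarrow> complex) \<Rightarrow> int \<Rightarrow> complex" where
  "hfun p k = (if k < 0 then 0 else newton p (nat k))"

lemma hfun_add_var: "hfun (\<lambda>n. p n + y ^ n) k = hfun p k + y * hfun (\<lambda>n. p n + y ^ n) (k - 1)"
proof (cases "k \<le> 0")
  case False
  then obtain m where "k = int (Suc m)" by (metis not_le zero_less_imp_eq_int Suc_pred)
  then show ?thesis using newton_add_var[of p m y] by (simp add: hfun_def nat_add_distrib)
qed (auto simp: hfun_def)

lemma hfun_sub_var: "hfun (\<lambda>n. p n - y ^ n) k = hfun p k - y * hfun p (k - 1)"
  using hfun_add_var[of "\<lambda>n. p n - y ^ n" y k] by simp

text \<open>Telescoping of h_k(x, y) - y h_(k-1)(x, y) = h_k(x). If \<open>m\<close> is the distance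
  of two consecutive shifted parts, then \<open>b\<close> runs over the numbers of cells that may be
  removed from the upper row.\<close>

lemma hfun_add_var_diff:
  "hfun (\<lambda>n. p n + y ^ n) k - y ^ m * hfun (\<lambda>n. p n + y ^ n) (k - int m)
    = (\<Sum>b<m. y ^ b * hfun p (k - int b))"
proof (induction m)
  case (Suc m)
  have "hfun (\<lambda>n. p n + y ^ n) (k - int m)
      = hfun p (k - int m) + y * hfun (\<lambda>n. p n + y ^ n) (k - int (Suc m))"
    by (subst hfun_add_var) (simp add: algebra_simps)
  then show ?case using Suc by (simp add: algebra_simps)
qed simp

lemma hfun_rec:
  assumes "int N \<ge> k"
  shows "of_int k * hfun p k = (\<Sum>n=1..N. p n * hfun p (k - int n))"
proof (cases "k \<le> 0")
  case True
  then show ?thesis by (auto simp: hfun_def)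
next
  case False
  have "of_int k * hfun p k = of_nat (nat k) * newton p (nat k)"
    using False by (simp add: hfun_def)
  also have "\<dots> = (\<Sum>n=1..nat k. p n * newton p (nat k - n))" by (rule newton_rec)
  also have "\<dots> = (\<Sum>n=1..nat k. p n * hfun p (k - int n))"
    by (rule sum.cong) (auto simp: hfun_def nat_diff_distrib)
  also have "\<dots> = (\<Sum>n=1..N. p n * hfun p (k - int n))"
    by (rule sum.mono_neutral_left) (use assms in \<open>auto simp: hfun_def\<close>)
  finally show ?thesis .
qed

text \<open>For \<open>\<alpha> = beta la\<close> the entry in row i and column j, both counted from
  0, has index la_(i+1) - i + j, as in the Jacobi-Trudi matrix.\<close>

definition jt :: "nat \<Rightarrow> (nat \<Rightarrow> complex) \<Rightarrow> (nat \<Rightarrow> int) \<Rightarrow> complex" where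
  "jt K p \<alpha> = fdet K (\<lambda>i j. hfun p (\<alpha> i + int j + 1))"

definition beta :: "partition \<Rightarrow> nat \<Rightarrow> int" where
  "beta la i = int (part la (Suc i)) - int i - 1"

lemma beta_less: "i < j \<Longrightarrow> beta la j < beta la i"
  using part_antimono[of "Suc i" "Suc j" la] by (simp add: beta_def)

lemma inj_beta: "inj (beta la)"
proof (rule injI)
  fix i j assume "beta la i = beta la j"
  then show "i = j" using beta_less[of i j la] beta_less[of j i la] by (cases i j rule: linorder_cases) auto
qed

lemma jt_cong: "(\<And>i. i < K \<Longrightarrow> \<alpha> i = \<alpha>' i) \<Longrightarrow> jt K p \<alpha> = jt K p \<alpha>'"
  unfolding jt_def by (rule fdet_cong) simp

lemma jt_eq_0_row: "i < K \<Longrightarrow> \<alpha> i < - int K \<Longrightarrow> jt K p \<alpha> = 0"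
  unfolding jt_def by (rule fdet_zero_row[of i]) (auto simp: hfun_def)

lemma jt_eq_0_dup: "i < K \<Longrightarrow> j < K \<Longrightarrow> i \<noteq> j \<Longrightarrow> \<alpha> i = \<alpha> j \<Longrightarrow> jt K p \<alpha> = 0"
  unfolding jt_def by (rule fdet_identical_rows[of i _ j]) auto

text \<open>The branching rule for one more variable. Subtracting \<open>y ^ m i\<close> times row i
  + 1 from row i telescopes it into a sum over 0, ..., m i - 1 removed cells, where
  \<open>m i\<close> is the distance of the two shifted parts. These ranges are the interlacing
  conditions, so the multilinear expansion runs exactly over the horizontal strips.\<close>

lemma jt_add_var:
  assumes K: "plen la \<le> K"
  shows "jt K (\<lambda>n. p n + y ^ n) (beta la)
    = (\<Sum>\<mu> | horiz_strip la \<mu>. y ^ (psize la - psize \<mu>) * jt K p (beta \<mu>))"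
proof -
  let ?p' = "\<lambda>n. p n + y ^ n"
  define m where "m i = Suc (part la (Suc i) - part la (Suc (Suc i)))" for i
  have anti: "part la (Suc (Suc i)) \<le> part la (Suc i)" for i
    by (rule part_antimono) auto
  have m: "beta la (Suc i) = beta la i - int (m i)" for i
    using anti[of i] by (simp add: beta_def m_def of_nat_diff)
  \<comment> \<open>\<open>\<beta>\<close> lists the numbers of cells removed from the rows;
    \<open>mk \<beta>\<close> is the partition that remains.\<close>
  define mk where "mk \<beta> = (SOME \<nu>. \<forall>i\<ge>1. part \<nu> i = part la i - (if i \<le> K then \<beta> (i - 1) else 0))"
    for \<beta> :: "nat \<Rightarrow> nat"
  have mk: "part (mk \<beta>) i = part la i - (if i \<le> K then \<beta> (i - 1) else 0)"
    if \<beta>: "\<beta> \<in> PiE {0..<K} (\<lambda>i. {..<m i})" and "1 \<le> i" for \<beta> i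
  proof -
    let ?f = "\<lambda>i. part la i - (if i \<le> K then \<beta> (i - 1) else 0)"
    have "?f (Suc i) \<le> ?f i" if i: "1 \<le> i" for i
    proof -
      have "part la (Suc i) \<le> ?f i"
      proof (cases "i \<le> K")
        case True
        then have "\<beta> (i - 1) < m (i - 1)" using \<beta> i by (auto simp: PiE_def Pi_def)
        then show ?thesis using True i anti[of "i - 1"] by (simp add: m_def)
      next
        case False
        then show ?thesis using part_eq_0[of la "Suc i"] K by simp
      qed
      then show ?thesis by simp
    qed
    then obtain \<nu> where "\<And>i. 1 \<le> i \<Longrightarrow> part \<nu> i = ?f i"
      using ex_partition[of ?f K] part_eq_0[of la] K by (metis diff_0_eq_0 le_less_trans)
    then have "\<exists>\<nu>. \<forall>i\<ge>1. part \<nu> i = ?f i" by blast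
    from someI_ex[OF this] show ?thesis using \<open>1 \<le> i\<close> by (simp add: mk_def)
  qed
  have \<beta>_le: "\<beta> i \<le> part la (Suc i) - part la (Suc (Suc i))"
    if "\<beta> \<in> PiE {0..<K} (\<lambda>i. {..<m i})" "i < K" for \<beta> i
    using that by (auto simp: PiE_def Pi_def m_def less_Suc_eq_le)
  let ?g = "\<lambda>\<mu>. \<lambda>i\<in>{0..<K}. part la (Suc i) - part \<mu> (Suc i)"
  let ?H = "\<lambda>i j. hfun ?p' (beta la i + int j + 1)"
  let ?U = "\<lambda>i k. if k = i then 1 else if k = Suc i then - (y ^ m i) else (0::complex)"
  have "fdet K ?U = 1"
    by (subst fdet_upper_triangular) auto
  then have "jt K ?p' (beta la) = fdet K (\<lambda>i j. \<Sum>k<K. ?U i k * ?H k j)"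
    by (simp only: fdet_mult jt_def mult_1)
  also have "\<dots> = fdet K (\<lambda>i j. \<Sum>b\<in>{..<m i}. y ^ b * hfun p (beta la i - int b + int j + 1))"
  proof (rule fdet_cong)
    fix i j assume ij: "i < K" "j < K"
    have "(\<Sum>k<K. ?U i k * ?H k j) = (\<Sum>k\<in>{i, Suc i} \<inter> {..<K}. ?U i k * ?H k j)"
      by (rule sum.mono_neutral_right) auto
    also have "\<dots> = ?H i j - y ^ m i * ?H (Suc i) j"
    proof (cases "Suc i < K")
      case True
      then have "{i, Suc i} \<inter> {..<K} = {i, Suc i}" by auto
      then show ?thesis by simp
    next
      \<comment> \<open>The last row has no successor to subtract. The formula persists because a
        row with shifted part \<open>- K - 1\<close> would consist of zeros.\<close>
      case False
      then have "Suc i = K" using ij by simp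
      then have "{i, Suc i} \<inter> {..<K} = {i}" "?H (Suc i) j = 0"
        using K ij by (auto simp: beta_def hfun_def part_eq_0)
      then show ?thesis by simp
    qed
    also have "\<dots> = hfun ?p' (beta la i + int j + 1)
        - y ^ m i * hfun ?p' (beta la i + int j + 1 - int (m i))"
      by (simp add: m algebra_simps)
    also have "\<dots> = (\<Sum>b<m i. y ^ b * hfun p (beta la i + int j + 1 - int b))"
      by (rule hfun_add_var_diff)
    also have "\<dots> = (\<Sum>b<m i. y ^ b * hfun p (beta la i - int b + int j + 1))"
      by (simp add: algebra_simps)
    finally show "(\<Sum>k<K. ?U i k * ?H k j) = \<dots>" .
  qed
  also have "\<dots> = (\<Sum>\<beta>\<in>PiE {0..<K} (\<lambda>i. {..<m i}).
      fdet K (\<lambda>i j. y ^ \<beta> i * hfun p (beta la i - int (\<beta> i) + int j + 1)))"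
    by (rule fdet_row_expand) simp
  also have "\<dots> = (\<Sum>\<beta>\<in>PiE {0..<K} (\<lambda>i. {..<m i}).
      y ^ (\<Sum>i<K. \<beta> i) * jt K p (\<lambda>i. beta la i - int (\<beta> i)))"
    by (simp add: fdet_scale_rows jt_def power_sum)
  also have "\<dots> = (\<Sum>\<mu> | horiz_strip la \<mu>. y ^ (psize la - psize \<mu>) * jt K p (beta \<mu>))"
  proof (rule sum.reindex_bij_witness[where i = mk and j = ?g, symmetric])
    fix \<mu> assume \<mu>: "\<mu> \<in> {\<mu>. horiz_strip la \<mu>}"
    then have hs: "part la (Suc i) \<le> part \<mu> i" "part \<mu> i \<le> part la i" if "1 \<le> i" for i
      using that by (auto simp: horiz_strip_def)
    show g: "?g \<mu> \<in> PiE {0..<K} (\<lambda>i. {..<m i})"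
      using hs by (auto simp: m_def less_Suc_eq_le intro!: diff_le_mono2)
    have \<mu>0: "part \<mu> i = 0" if "K < i" for i
      using hs(2)[of i] part_eq_0[of la i] K that by simp
    show "mk (?g \<mu>) = \<mu>"
      by (rule partition_eqI, subst mk[OF g]) (use hs(2) \<mu>0 K part_eq_0[of la] in auto)
    have eq: "beta la i - int (?g \<mu> i) = beta \<mu> i" if "i < K" for i
      using hs(2)[of "Suc i"] that by (simp add: beta_def of_nat_diff)
    show "y ^ (\<Sum>i<K. ?g \<mu> i) * jt K p (\<lambda>i. beta la i - int (?g \<mu> i))
        = y ^ (psize la - psize \<mu>) * jt K p (beta \<mu>)"
      using psize_diff[of \<mu> la K] hs(2) K jt_cong[of K, OF eq] by simp
  next
    fix \<beta> assume \<beta>: "\<beta> \<in> PiE {0..<K} (\<lambda>i. {..<m i})"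
    show "(\<lambda>i\<in>{0..<K}. part la (Suc i) - part (mk \<beta>) (Suc i)) = \<beta>"
    proof (rule ext)
      fix i show "(\<lambda>i\<in>{0..<K}. part la (Suc i) - part (mk \<beta>) (Suc i)) i = \<beta> i"
        using \<beta> mk[OF \<beta>, of "Suc i"] \<beta>_le[OF \<beta>, of i] by (cases "i < K") (auto simp: PiE_def extensional_def)
    qed
    show "mk \<beta> \<in> {\<mu>. horiz_strip la \<mu>}"
    proof -
      have "part la (Suc i) \<le> part (mk \<beta>) i \<and> part (mk \<beta>) i \<le> part la i" if "1 \<le> i" for i
      proof (cases "i \<le> K")
        case True
        then have "i - 1 < K" "Suc (i - 1) = i" using that by auto
        then show ?thesis
          using mk[OF \<beta> that] \<beta>_le[OF \<beta>, of "i - 1"] anti[of "i - 1"] by auto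
      next
        case False
        then show ?thesis using mk[OF \<beta> that] part_eq_0[of la "Suc i"] K by auto
      qed
      then show ?thesis by (simp add: horiz_strip_def)
    qed
  qed
  finally show ?thesis .
qed

text \<open>The branching rule for a subtracted variable, in the conjugate shape. By
  \<open>hfun_sub_var\<close> each row splits into just two terms, so it loses at most one cell.
  Choices that do not leave a partition occur as well, but their determinants have two equal rows or
  a zero row.\<close>

lemma jt_sub_var:
  assumes K: "part la 1 \<le> K"
  shows "jt K (\<lambda>n. p n - y ^ n) (beta (conj_part la))
    = (\<Sum>\<mu> | horiz_strip la \<mu>. (- y) ^ (psize la - psize \<mu>) * jt K p (beta (conj_part \<mu>)))"
proof -
  let ?la = "conj_part la"
  have K': "plen ?la \<le> K" using K by (simp add: plen_conj)
  have anti: "part ?la (Suc (Suc i)) \<le> part ?la (Suc i)" for i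
    by (rule part_antimono) auto
  let ?g = "\<lambda>\<mu>. \<lambda>i\<in>{0..<K}. part ?la (Suc i) - part (conj_part \<mu>) (Suc i)"
  let ?f = "\<lambda>\<beta> i. part ?la i - (if i \<le> K then \<beta> (i - 1) else 0)"
  define mk where "mk \<beta> = (SOME \<nu>. \<forall>i\<ge>1. part \<nu> i = ?f \<beta> i)" for \<beta> :: "nat \<Rightarrow> nat"
  let ?P = "PiE {0..<K} (\<lambda>i. {..<2::nat})"
  \<comment> \<open>The choices that leave a partition: no cell is taken from an empty row, and the
    rows stay weakly decreasing.\<close>
  define G where "G = {\<beta>\<in>?P. \<forall>i<K. \<beta> i \<le> part ?la (Suc i) \<and> ?f \<beta> (Suc (Suc i)) \<le> ?f \<beta> (Suc i)}"
  have P: "\<beta> i = 0 \<or> \<beta> i = 1" if "\<beta> \<in> ?P" "i < K" for \<beta> i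
  proof -
    have "\<beta> i < 2" using that by (auto simp: PiE_def Pi_def)
    then show ?thesis by auto
  qed
  have mk: "part (mk \<beta>) i = ?f \<beta> i" if \<beta>: "\<beta> \<in> G" and i: "1 \<le> i" for \<beta> i
  proof -
    have "?f \<beta> (Suc i) \<le> ?f \<beta> i" if i: "1 \<le> i" for i
    proof (cases "i \<le> K")
      case True
      have "i - 1 < K" "Suc (i - 1) = i" using i True by auto
      have "\<forall>i<K. \<beta> i \<le> part ?la (Suc i) \<and> ?f \<beta> (Suc (Suc i)) \<le> ?f \<beta> (Suc i)"
        using \<beta> unfolding G_def by blast
      then have "?f \<beta> (Suc (Suc (i - 1))) \<le> ?f \<beta> (Suc (i - 1))" using \<open>i - 1 < K\<close> by blast
      then show ?thesis unfolding \<open>Suc (i - 1) = i\<close> .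
    next
      case False
      then show ?thesis using part_eq_0[of ?la "Suc i"] K' by simp
    qed
    then obtain \<nu> where "\<And>i. 1 \<le> i \<Longrightarrow> part \<nu> i = ?f \<beta> i"
      using ex_partition[of "?f \<beta>" K] part_eq_0[of ?la] K' by (metis diff_0_eq_0 le_less_trans)
    then have "\<exists>\<nu>. \<forall>i\<ge>1. part \<nu> i = ?f \<beta> i" by blast
    from someI_ex[OF this] show ?thesis using i by (simp add: mk_def)
  qed
  have "jt K (\<lambda>n. p n - y ^ n) (beta ?la)
      = fdet K (\<lambda>i j. \<Sum>b\<in>{..<2}. (- y) ^ b * hfun p (beta ?la i - int b + int j + 1))"
    unfolding jt_def
    by (rule fdet_cong) (simp add: hfun_sub_var numeral_2_eq_2 algebra_simps)
  also have "\<dots> = (\<Sum>\<beta>\<in>?P. fdet K (\<lambda>i j. (- y) ^ \<beta> i * hfun p (beta ?la i - int (\<beta> i) + int j + 1)))"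
    by (rule fdet_row_expand) simp
  also have "\<dots> = (\<Sum>\<beta>\<in>?P. (- y) ^ (\<Sum>i<K. \<beta> i) * jt K p (\<lambda>i. beta ?la i - int (\<beta> i)))"
    by (simp only: fdet_scale_rows jt_def power_sum)
  also have "\<dots> = (\<Sum>\<beta>\<in>G. (- y) ^ (\<Sum>i<K. \<beta> i) * jt K p (\<lambda>i. beta ?la i - int (\<beta> i)))"
  proof (rule sum.mono_neutral_right)
    show "\<forall>\<beta>\<in>?P - G. (- y) ^ (\<Sum>i<K. \<beta> i) * jt K p (\<lambda>i. beta ?la i - int (\<beta> i)) = 0"
    proof
      fix \<beta> assume "\<beta> \<in> ?P - G"
      then have \<beta>: "\<beta> \<in> ?P" by simp
      obtain i where i: "i < K" and
        n: "\<not> (\<beta> i \<le> part ?la (Suc i) \<and> ?f \<beta> (Suc (Suc i)) \<le> ?f \<beta> (Suc i))"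
        using \<open>\<beta> \<in> ?P - G\<close> unfolding G_def by blast
      have d: "part ?la (Suc i) < \<beta> i \<or> ?f \<beta> (Suc i) < ?f \<beta> (Suc (Suc i)) \<and> \<beta> i \<le> part ?la (Suc i)"
        unfolding not_le[symmetric] using n by blast
      have "jt K p (\<lambda>i. beta ?la i - int (\<beta> i)) = 0"
        using d
      proof
        assume a: "part ?la (Suc i) < \<beta> i"
        then have z: "part ?la (Suc i) = 0" "\<beta> i = 1" using P[OF \<beta> i] by auto
        show ?thesis
        proof (cases "Suc i < K")
          case True
          show ?thesis
          proof (cases "\<beta> (Suc i) = 0")
            case t: True
            show ?thesis
              by (rule jt_eq_0_dup[of i _ "Suc i"])
                (use i True t z anti[of i] in \<open>auto simp: beta_def\<close>)
          next
            case f: False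
            define r where "r = K - 1"
            text \<open>All parts from row \<open>i\<close> on vanish. Either the last row drops below \<open>-K\<close>, or some row
              lowered by 1 is followed by an unchanged one and coincides with it.\<close>
            have zero: "part ?la (Suc j) = 0" if "i \<le> j" for j
              using part_antimono[of "Suc i" "Suc j" ?la] that z by simp
            show ?thesis
            proof (cases "\<beta> r = 1")
              case True
              show ?thesis
                by (rule jt_eq_0_row[of r]) (use True i zero[of r] in \<open>auto simp: beta_def r_def\<close>)
            next
              case False
              then have r0: "\<beta> r = 0" using P[OF \<beta>, of r] i by (auto simp: r_def)
              define j where "j = (LEAST j. i \<le> j \<and> \<beta> j = 0)"
              have ir: "i \<le> r" using i by (auto simp: r_def)
              have j: "i \<le> j \<and> \<beta> j = 0" unfolding j_def by (rule LeastI[of _ r]) (use ir r0 in auto)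
              have jr: "j \<le> r" unfolding j_def by (rule Least_le) (use ir r0 in auto)
              have "j \<noteq> i" using j z by auto
              then have ji: "i \<le> j - 1" "j - 1 < j" using j by auto
              then have "\<beta> (j - 1) \<noteq> 0" using not_less_Least[of "j - 1" "\<lambda>j. i \<le> j \<and> \<beta> j = 0", folded j_def] by auto
              then have "\<beta> (j - 1) = 1" using P[OF \<beta>, of "j - 1"] jr i by (auto simp: r_def)
              then show ?thesis
                by (intro jt_eq_0_dup[of "j - 1" _ j])
                  (use j ji jr i zero[of j] zero[of "j - 1"] in \<open>auto simp: beta_def r_def\<close>)
            qed
          qed
        next
          case False
          then show ?thesis
            by (intro jt_eq_0_row[of i]) (use i z in \<open>auto simp: beta_def\<close>)
        qed
      next
        \<comment> \<open>Two rows of equal length, of which only the upper one loses a cell: their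
          shifted parts become equal.\<close>
        assume a: "?f \<beta> (Suc i) < ?f \<beta> (Suc (Suc i)) \<and> \<beta> i \<le> part ?la (Suc i)"
        then have "Suc i < K"
          using part_eq_0[of ?la "Suc (Suc i)"] K' i by (cases "Suc i < K") auto
        then show ?thesis
          by (intro jt_eq_0_dup[of i _ "Suc i"])
            (use a i P[OF \<beta>, of i] P[OF \<beta>, of "Suc i"] anti[of i] in \<open>auto simp: beta_def\<close>)
      qed
      then show "(- y) ^ (\<Sum>i<K. \<beta> i) * jt K p (\<lambda>i. beta ?la i - int (\<beta> i)) = 0" by simp
    qed
  qed (auto simp: G_def intro!: finite_PiE)
  also have "\<dots> = (\<Sum>\<mu> | horiz_strip la \<mu>. (- y) ^ (psize la - psize \<mu>) * jt K p (beta (conj_part \<mu>)))"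
  proof (rule sum.reindex_bij_witness[where i = "\<lambda>\<beta>. conj_part (mk \<beta>)" and j = ?g, symmetric])
    fix \<mu> assume \<mu>: "\<mu> \<in> {\<mu>. horiz_strip la \<mu>}"
    then have hs: "part ?la i \<le> Suc (part (conj_part \<mu>) i)" "part (conj_part \<mu>) i \<le> part ?la i" if "1 \<le> i" for i
      using that by (auto simp: horiz_strip_conj)
    have \<mu>0: "part (conj_part \<mu>) i = 0" if "K < i" for i
      using hs(2)[of i] part_eq_0[of ?la i] K' that by simp
    have f: "?f (?g \<mu>) i = part (conj_part \<mu>) i" if "1 \<le> i" for i
      using hs(2)[of i] \<mu>0[of i] that part_eq_0[of ?la i] K' by auto
    have "part ?la (Suc i) - part (conj_part \<mu>) (Suc i) < 2" for i
      using hs(1)[of "Suc i"] by simp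
    then have 1: "?g \<mu> \<in> ?P" by auto
    have 2: "?f (?g \<mu>) (Suc (Suc i)) \<le> ?f (?g \<mu>) (Suc i)" for i
      using f[of "Suc i"] f[of "Suc (Suc i)"] part_antimono[of "Suc i" "Suc (Suc i)" "conj_part \<mu>"] by simp
    show g: "?g \<mu> \<in> G"
      unfolding G_def
    proof (intro CollectI conjI allI impI)
      fix i assume "i < K"
      then show "?g \<mu> i \<le> part ?la (Suc i)" by simp
    qed (rule 1 2)+
    have "mk (?g \<mu>) = conj_part \<mu>"
      by (rule partition_eqI, subst mk[OF g]) (use f in auto)
    then show "conj_part (mk (?g \<mu>)) = \<mu>" by simp
    have eq: "beta ?la i - int (?g \<mu> i) = beta (conj_part \<mu>) i" if "i < K" for i
      using hs(2)[of "Suc i"] that by (simp add: beta_def of_nat_diff)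
    show "(- y) ^ (\<Sum>i<K. ?g \<mu> i) * jt K p (\<lambda>i. beta ?la i - int (?g \<mu> i))
        = (- y) ^ (psize la - psize \<mu>) * jt K p (beta (conj_part \<mu>))"
      using psize_diff[of "conj_part \<mu>" ?la K] hs(2) K' jt_cong[of K, OF eq] by simp
  next
    fix \<beta> assume \<beta>: "\<beta> \<in> G"
    then have \<beta>P: "\<beta> \<in> ?P" and le: "\<beta> i \<le> part ?la (Suc i)" if "i < K" for i
      using that by (auto simp: G_def)
    show "?g (conj_part (mk \<beta>)) = \<beta>"
    proof (rule ext)
      fix i show "?g (conj_part (mk \<beta>)) i = \<beta> i"
        using \<beta> mk[OF \<beta>, of "Suc i"] le[of i] by (cases "i < K") (auto simp: G_def PiE_def extensional_def)
    qed
    have "part ?la i \<le> Suc (part (mk \<beta>) i) \<and> part (mk \<beta>) i \<le> part ?la i" if "1 \<le> i" for i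
    proof (cases "i \<le> K")
      case True
      then have "i - 1 < K" using that by auto
      moreover have "\<beta> \<in> ?P" using \<beta> by (simp add: G_def)
      ultimately show ?thesis using mk[OF \<beta> that] P[of \<beta> "i - 1"] by auto
    next
      case False
      then show ?thesis using mk[OF \<beta> that] by simp
    qed
    then show "conj_part (mk \<beta>) \<in> {\<mu>. horiz_strip la \<mu>}" by (simp add: horiz_strip_conj)
  qed
  finally show ?thesis .
qed

section \<open>Schur functions\<close>

text \<open>For vanishing power sums h_k = 0 unless k = 0. A nonempty partition then has a zero
  first row, and the empty one gives the identity matrix.\<close>

lemma jt_zero:
  assumes "plen la \<le> K"
  shows "jt K (\<lambda>_. 0) (beta la) = (if la = empty_part then 1 else 0)"
proof (cases "la = empty_part")
  case True
  have "jt K (\<lambda>_. 0) (beta la) = fdet K (\<lambda>i j. if i = j then 1 else 0)"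
    unfolding jt_def by (rule fdet_cong) (auto simp: True beta_def hfun_def newton_zero)
  also have "\<dots> = 1" by (subst fdet_upper_triangular) auto
  finally show ?thesis using True by simp
next
  case False
  then have "0 < plen la" using plen_eq_0_iff[of la] by auto
  then have "part la 1 \<noteq> 0" using part_eq_0_iff[of 1 la] by simp
  then have "jt K (\<lambda>_. 0) (beta la) = 0"
    unfolding jt_def using assms \<open>0 < plen la\<close>
    by (intro fdet_zero_row[of 0]) (auto simp: beta_def hfun_def newton_zero)
  then show ?thesis using False by simp
qed

section \<open>Schur polynomials as sums over tableaux with bounded entries\<close>

definition ssyt_upto :: "nat \<Rightarrow> partition \<Rightarrow> (nat \<times> nat \<Rightarrow> nat) set" where
  "ssyt_upto N la = {T \<in> skew_ssyt la empty_part. \<forall>c\<in>cells la. T c \<le> N}"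

definition schur_upto :: "nat \<Rightarrow> partition \<Rightarrow> (nat \<Rightarrow> complex) \<Rightarrow> complex" where
  "schur_upto N la x = (\<Sum>T\<in>ssyt_upto N la. \<Prod>c\<in>cells la. x (T c))"

lemma ssyt_upto_iff:
  "T \<in> ssyt_upto N la \<longleftrightarrow> T \<in> cells la \<rightarrow>\<^sub>E {1..N} \<and>
     (\<forall>i j k. (i, j) \<in> cells la \<longrightarrow> (i, k) \<in> cells la \<longrightarrow> j < k \<longrightarrow> T (i, j) \<le> T (i, k)) \<and>
     (\<forall>i j k. (i, j) \<in> cells la \<longrightarrow> (k, j) \<in> cells la \<longrightarrow> i < k \<longrightarrow> T (i, j) < T (k, j))"
proof -
  have "T \<in> cells la \<rightarrow>\<^sub>E {1..N} \<longleftrightarrow> T \<in> cells la \<rightarrow>\<^sub>E {1..} \<and> (\<forall>c\<in>cells la. T c \<le> N)"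
    by (auto simp: PiE_iff)
  then show ?thesis
    unfolding ssyt_upto_def skew_ssyt_def skew_cells_empty by blast
qed

lemma finite_ssyt_upto: "finite (ssyt_upto N la)"
proof (rule finite_subset)
  show "ssyt_upto N la \<subseteq> cells la \<rightarrow>\<^sub>E {1..N}" using ssyt_upto_iff by blast
qed (auto intro!: finite_PiE)

lemma cells_empty_iff: "cells la = {} \<longleftrightarrow> la = empty_part"
proof
  assume *: "cells la = {}"
  show "la = empty_part"
  proof (rule partition_eqI)
    fix i :: nat assume "1 \<le> i"
    then have "(i, 1) \<notin> cells la" using * by auto
    then show "part la i = part empty_part i" using \<open>1 \<le> i\<close> by (simp add: cells_def)
  qed
qed (auto simp: cells_def)

lemma schur_upto_0: "schur_upto 0 la x = (if la = empty_part then 1 else 0)"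
proof (cases "la = empty_part")
  case True
  then have [simp]: "cells empty_part = {}" by (simp add: cells_empty_iff)
  have "ssyt_upto 0 la = {\<lambda>_. undefined}"
    using True by (auto simp: ssyt_upto_iff)
  then show ?thesis using True by (simp add: schur_upto_def)
next
  case False
  then obtain c where "c \<in> cells la" using cells_empty_iff[of la] by blast
  then have "cells la \<rightarrow>\<^sub>E {1..0} = ({} :: (nat \<times> nat \<Rightarrow> nat) set)"
    unfolding PiE_eq_empty_iff by (intro bexI[of _ c]) auto
  then have "ssyt_upto 0 la = {}" using ssyt_upto_iff[of _ 0 la] by blast
  then show ?thesis using False by (simp add: schur_upto_def)
qed

lemma finite_horiz_strip: "finite {\<mu>. horiz_strip la \<mu>}"
proof -
  let ?g = "\<lambda>\<mu>. \<lambda>i\<in>{1..plen la}. part \<mu> i"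
  have "?g ` {\<mu>. horiz_strip la \<mu>} \<subseteq> PiE {1..plen la} (\<lambda>i. {..part la i})"
    by (auto simp: horiz_strip_def)
  then have "finite (?g ` {\<mu>. horiz_strip la \<mu>})"
    by (rule finite_subset) (auto intro!: finite_PiE)
  moreover have "inj_on ?g {\<mu>. horiz_strip la \<mu>}"
  proof (rule inj_onI, rule partition_eqI)
    fix \<mu> \<nu> i assume h: "\<mu> \<in> {\<mu>. horiz_strip la \<mu>}" "\<nu> \<in> {\<mu>. horiz_strip la \<mu>}"
      and eq: "?g \<mu> = ?g \<nu>" and i: "(1::nat) \<le> i"
    show "part \<mu> i = part \<nu> i"
    proof (cases "i \<le> plen la")
      case True
      then show ?thesis using fun_cong[OF eq, of i] i by simp
    next
      case False
      then have "part la i = 0" by (simp add: part_eq_0)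
      moreover have "part \<mu> i \<le> part la i" "part \<nu> i \<le> part la i"
        using h i by (auto simp: horiz_strip_def)
      ultimately show ?thesis by simp
    qed
  qed
  ultimately show ?thesis by (rule finite_imageD)
qed

lemma down_closed_eq_interval:
  fixes X :: "nat set"
  assumes fin: "finite X" and pos: "0 \<notin> X"
    and down: "\<And>j k. j \<in> X \<Longrightarrow> 1 \<le> k \<Longrightarrow> k < j \<Longrightarrow> k \<in> X"
  shows "X = {1..card X}"
proof (cases "X = {}")
  case False
  have "{1..Max X} \<subseteq> X"
  proof
    fix k assume "k \<in> {1..Max X}"
    then show "k \<in> X" using down[of "Max X" k] Max_in[OF fin False] by (cases "k = Max X") auto
  qed
  moreover have "X \<subseteq> {1..Max X}"
  proof
    fix k assume "k \<in> X"
    moreover from this have "k \<noteq> 0" using pos by metis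
    ultimately show "k \<in> {1..Max X}" using fin by simp
  qed
  ultimately have X: "X = {1..Max X}" by (rule antisym[rotated])
  then have "card X = Max X" by (metis card_atLeastAtMost diff_Suc_1 One_nat_def)
  then show ?thesis using X by simp
qed simp

text \<open>The entries at most \<open>N\<close> of a tableau of shape \<open>la\<close> fill a subshape whose complement, filled
  with \<open>N + 1\<close>, is a horizontal strip.\<close>

lemma schur_upto_Suc:
  "schur_upto (Suc N) la x
    = (\<Sum>\<mu> | horiz_strip la \<mu>. x (Suc N) ^ (psize la - psize \<mu>) * schur_upto N \<mu> x)"
proof -
  define sh where "sh T = (SOME \<mu>. \<forall>i\<ge>1. part \<mu> i = card {j. (i, j) \<in> cells la \<and> T (i, j) \<le> N})"
    for T :: "nat \<times> nat \<Rightarrow> nat"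
  let ?X = "\<lambda>i T. {j. (i, j) \<in> cells la \<and> T (i, j) \<le> N}"
  let ?ext = "\<lambda>(\<mu>, U). \<lambda>c\<in>cells la. if c \<in> cells \<mu> then U c else Suc N"
  let ?S = "Sigma {\<mu>. horiz_strip la \<mu>} (ssyt_upto N)"
  have X: "?X i T = {1..card (?X i T)}" if T: "T \<in> ssyt_upto (Suc N) la" for i T
  proof -
    have sub: "?X i T \<subseteq> {1..part la i}" "0 \<notin> ?X i T" by (auto simp: cells_def)
    have fin: "finite (?X i T)" by (rule finite_subset[OF sub(1)]) simp
    have down: "k \<in> ?X i T" if "j \<in> ?X i T" "1 \<le> k" "k < j" for j k
    proof -
      have "(i, k) \<in> cells la" using that by (auto simp: cells_def)
      moreover from this have "T (i, k) \<le> T (i, j)" using T that unfolding ssyt_upto_iff by auto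
      ultimately show ?thesis using that by auto
    qed
    show ?thesis
      by (rule down_closed_eq_interval[OF fin]) (use sub down in blast)+
  qed
  have X': "j \<in> ?X i T \<longleftrightarrow> 1 \<le> j \<and> j \<le> card (?X i T)" if T: "T \<in> ssyt_upto (Suc N) la" for i j T
    using arg_cong[OF X[OF T, of i], of "\<lambda>S. j \<in> S"] by (simp only: atLeastAtMost_iff)
  have sh: "part (sh T) i = card (?X i T)" and hs: "horiz_strip la (sh T)"
    and cells_sh: "cells (sh T) = {c \<in> cells la. T c \<le> N}"
    if T: "T \<in> ssyt_upto (Suc N) la" and i: "1 \<le> i" for T i
  proof -
    have le: "card (?X i T) \<le> part la i" for i
    proof -
      have "card (?X i T) \<le> card {1..part la i}" by (rule card_mono) (auto simp: cells_def)
      then show ?thesis by simp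
    qed
    \<comment> \<open>Entries increase strictly down a column and are at most N + 1, so a cell with
      another one below it carries at most N.\<close>
    have ge: "part la (Suc i) \<le> card (?X i T)" if "1 \<le> i" for i
    proof (cases "part la (Suc i)")
      case (Suc m)
      have 1: "(Suc i, Suc m) \<in> cells la" using Suc by (simp add: cells_def)
      have 2: "(i, Suc m) \<in> cells la" using Suc that part_antimono[of i "Suc i" la] by (simp add: cells_def)
      have "T (i, Suc m) < T (Suc i, Suc m)" "T (Suc i, Suc m) \<le> Suc N"
        using T 1 2 unfolding ssyt_upto_iff by (auto simp: PiE_def Pi_def)
      then have "Suc m \<in> ?X i T" using 2 by simp
      then show ?thesis unfolding Suc X'[OF T] by blast
    qed simp
    have "card (?X (Suc i) T) \<le> card (?X i T)" if "1 \<le> i" for i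
      using le[of "Suc i"] ge[OF that] by simp
    moreover have "card (?X i T) = 0" if "plen la < i" for i
      using le[of i] part_eq_0[OF that] by simp
    ultimately obtain \<nu> where "\<And>i. 1 \<le> i \<Longrightarrow> part \<nu> i = card (?X i T)"
      using ex_partition[of "\<lambda>i. card (?X i T)" "plen la"] by blast
    then have "\<exists>\<mu>. \<forall>i\<ge>1. part \<mu> i = card (?X i T)" by blast
    from someI_ex[OF this] have sh: "part (sh T) i = card (?X i T)" if "1 \<le> i" for i
      using that by (simp add: sh_def)
    show "part (sh T) i = card (?X i T)" using sh i by simp
    show "horiz_strip la (sh T)" using le ge sh by (auto simp: horiz_strip_def)
    show "cells (sh T) = {c \<in> cells la. T c \<le> N}"
    proof (rule Set.set_eqI)
      fix c :: "nat \<times> nat"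
      obtain i j where c: "c = (i, j)" by (cases c)
      show "c \<in> cells (sh T) \<longleftrightarrow> c \<in> {c \<in> cells la. T c \<le> N}"
      proof (cases "1 \<le> i")
        case True
        then have "(i, j) \<in> cells (sh T) \<longleftrightarrow> 1 \<le> j \<and> j \<le> card (?X i T)"
          using sh by (simp add: cells_def)
        also have "\<dots> \<longleftrightarrow> j \<in> ?X i T" by (rule X'[OF T, symmetric])
        finally show ?thesis unfolding c by simp
      qed (auto simp: cells_def c)
    qed
  qed
  have sub: "cells \<mu> \<subseteq> cells la" if "horiz_strip la \<mu>" for \<mu>
    using that le_trans by (fastforce simp: cells_def horiz_strip_def)
  have "schur_upto (Suc N) la x = (\<Sum>(\<mu>, U)\<in>?S. x (Suc N) ^ (psize la - psize \<mu>) * (\<Prod>c\<in>cells \<mu>. x (U c)))"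
    unfolding schur_upto_def
  proof (rule sum.reindex_bij_witness[where j = "\<lambda>T. (sh T, restrict T (cells (sh T)))" and i = ?ext])
    fix T assume T: "T \<in> ssyt_upto (Suc N) la"
    note c = cells_sh[OF T le_refl]
    have T2: "T \<in> cells la \<rightarrow>\<^sub>E {1..Suc N}" using T by (simp add: ssyt_upto_iff)
    have Tb: "1 \<le> T d \<and> T d \<le> Suc N" if "d \<in> cells la" for d
      using PiE_mem[OF T2 that] by simp
    show "?ext (sh T, restrict T (cells (sh T))) = T"
    proof
      fix d show "?ext (sh T, restrict T (cells (sh T))) d = T d"
      proof (cases "d \<in> cells la")
        case True
        then show ?thesis using Tb[OF True] by (cases "T d \<le> N") (simp_all add: c)
      next
        case False
        then show ?thesis using PiE_arb[OF T2 False] by simp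
      qed
    qed
    have "restrict T (cells (sh T)) \<in> ssyt_upto N (sh T)"
      using T T2 unfolding ssyt_upto_iff c by (auto simp: PiE_def Pi_def)
    then show "(sh T, restrict T (cells (sh T))) \<in> ?S" using hs[OF T le_refl] by auto
    have "(\<Prod>c\<in>cells la. x (T c)) = (\<Prod>c\<in>cells la - cells (sh T). x (T c)) * (\<Prod>c\<in>cells (sh T). x (T c))"
      by (rule prod.subset_diff) (use c in auto)
    also have "(\<Prod>c\<in>cells la - cells (sh T). x (T c)) = (\<Prod>c\<in>cells la - cells (sh T). x (Suc N))"
    proof (rule prod.cong)
      fix d assume "d \<in> cells la - cells (sh T)"
      then have "T d = Suc N" using Tb[of d] unfolding c by (auto simp: le_Suc_eq)
      then show "x (T d) = x (Suc N)" by simp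
    qed simp
    also have "\<dots> = x (Suc N) ^ (psize la - psize (sh T))"
    proof -
      have "card (cells la - cells (sh T)) = psize la - psize (sh T)"
        unfolding card_cells[symmetric] by (rule card_Diff_subset) (simp, use c in blast)
      then show ?thesis by simp
    qed
    finally show "(case (sh T, restrict T (cells (sh T))) of (\<mu>, U) \<Rightarrow>
        x (Suc N) ^ (psize la - psize \<mu>) * (\<Prod>c\<in>cells \<mu>. x (U c))) = (\<Prod>c\<in>cells la. x (T c))"
      by simp
  next
    fix u assume "u \<in> ?S"
    then obtain \<mu> U where u: "u = (\<mu>, U)" "horiz_strip la \<mu>" "U \<in> ssyt_upto N \<mu>" by auto
    note s = sub[OF u(2)]
    have U: "U \<in> cells \<mu> \<rightarrow>\<^sub>E {1..N}" using u(3) by (simp add: ssyt_upto_iff)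
    have Ub: "1 \<le> U c \<and> U c \<le> N" if "c \<in> cells \<mu>" for c
      using PiE_mem[OF U that] by simp
    have row: "(i, j) \<in> cells \<mu>" if "(i, k) \<in> cells \<mu>" "(i, j) \<in> cells la" "j < k" for i j k
      using that by (auto simp: cells_def)
    \<comment> \<open>Interlacing: a cell of \<open>la\<close> with another one below it already
      lies in \<open>\<mu>\<close>, so no new entry N + 1 stands above another cell.\<close>
    have col: "(i, j) \<in> cells \<mu>" if "(k, j) \<in> cells la" "(i, j) \<in> cells la" "i < k" for i j k
    proof -
      have "j \<le> part la (Suc i)" using that part_antimono[of "Suc i" k la] by (auto simp: cells_def)
      also have "\<dots> \<le> part \<mu> i" using u(2) that by (auto simp: horiz_strip_def cells_def)
      finally show ?thesis using that by (auto simp: cells_def)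
    qed
    let ?T = "?ext (\<mu>, U)"
    have "?T \<in> cells la \<rightarrow>\<^sub>E {1..Suc N}" using Ub by (auto simp: le_SucI)
    moreover have "?T (i, j) \<le> ?T (i, k)" if "(i, j) \<in> cells la" "(i, k) \<in> cells la" "j < k" for i j k
      using that row[of i k j] Ub[of "(i, j)"] u(3) by (auto simp: ssyt_upto_iff)
    moreover have "?T (i, j) < ?T (k, j)" if "(i, j) \<in> cells la" "(k, j) \<in> cells la" "i < k" for i j k
      using that col[of k j i] Ub[of "(i, j)"] u(3) by (auto simp: ssyt_upto_iff)
    ultimately have T: "?T \<in> ssyt_upto (Suc N) la"
      unfolding ssyt_upto_iff by blast
    then show "?ext u \<in> ssyt_upto (Suc N) la" unfolding u .
    have ce: "cells (sh ?T) = cells \<mu>"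
      unfolding cells_sh[OF T le_refl] using s Ub by (auto split: if_splits)
    have "sh ?T = \<mu>"
    proof (rule partition_eqI, rule part_eqI_le)
      fix i k :: nat assume "1 \<le> i" "1 \<le> k"
      then show "k \<le> part (sh ?T) i \<longleftrightarrow> k \<le> part \<mu> i"
        using ce by (auto simp: cells_def set_eq_iff)
    qed
    moreover have "restrict ?T (cells \<mu>) = U"
    proof
      fix d show "restrict ?T (cells \<mu>) d = U d"
      proof (cases "d \<in> cells \<mu>")
        case True
        then show ?thesis using s by auto
      next
        case False
        then show ?thesis using PiE_arb[OF U False] by simp
      qed
    qed
    ultimately show "(sh (?ext u), restrict (?ext u) (cells (sh (?ext u)))) = u"
      unfolding u by simp
  qed
  also have "\<dots> = (\<Sum>\<mu> | horiz_strip la \<mu>. \<Sum>U\<in>ssyt_upto N \<mu>. x (Suc N) ^ (psize la - psize \<mu>) * (\<Prod>c\<in>cells \<mu>. x (U c)))"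
    by (rule sum.Sigma[symmetric]) (auto simp: finite_horiz_strip finite_ssyt_upto)
  finally show ?thesis by (simp add: schur_upto_def sum_distrib_left)
qed

definition power_sum_upto :: "nat \<Rightarrow> (nat \<Rightarrow> complex) \<Rightarrow> nat \<Rightarrow> complex" where
  "power_sum_upto N x n = (\<Sum>i=1..N. x i ^ n)"

text \<open>Tableaux and determinants obey the same branching rule in the number of variables and
  agree when there are no variables.\<close>

lemma schur_upto_jt:
  "plen la \<le> K \<Longrightarrow> schur_upto N la x = jt K (power_sum_upto N x) (beta la)"
proof (induction N arbitrary: la)
  case 0
  have "power_sum_upto 0 x = (\<lambda>_. 0)" by (auto simp: power_sum_upto_def)
  then show ?case using jt_zero[OF 0] by (simp add: schur_upto_0)
next
  case (Suc N)
  have eq: "power_sum_upto (Suc N) x = (\<lambda>n. power_sum_upto N x n + x (Suc N) ^ n)"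
    by (auto simp: power_sum_upto_def)
  show ?case
    unfolding schur_upto_Suc eq jt_add_var[OF Suc.prems]
    by (rule sum.cong) (use Suc horiz_strip_plen in \<open>force+\<close>)
qed

text \<open>Negating the power sums turns h_k into (-1)^k e_k, so this is the dual Jacobi-Trudi
  formula with the signs collected in front. The dual branching rule \<open>jt_sub_var\<close>
  drives the induction.\<close>

lemma schur_upto_jt_conj:
  "part la 1 \<le> K \<Longrightarrow>
    schur_upto N la x = (-1) ^ psize la * jt K (\<lambda>n. - power_sum_upto N x n) (beta (conj_part la))"
proof (induction N arbitrary: la)
  case 0
  have *: "(\<lambda>n. - power_sum_upto 0 x n) = (\<lambda>_. 0)" by (auto simp: power_sum_upto_def)
  have "conj_part la = empty_part \<longleftrightarrow> la = empty_part" by (metis conj_conj conj_empty)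
  then show ?case using jt_zero[of "conj_part la" K] 0 unfolding * by (simp add: schur_upto_0 plen_conj)
next
  case (Suc N)
  have eq: "(\<lambda>n. - power_sum_upto (Suc N) x n) = (\<lambda>n. - power_sum_upto N x n - x (Suc N) ^ n)"
    by (auto simp: power_sum_upto_def)
  show ?case
    unfolding schur_upto_Suc eq jt_sub_var[OF Suc.prems] sum_distrib_left
  proof (rule sum.cong)
    fix \<mu> assume "\<mu> \<in> {\<mu>. horiz_strip la \<mu>}"
    then have hs: "horiz_strip la \<mu>" by simp
    then have "part \<mu> 1 \<le> K" using Suc.prems le_trans by (auto simp: horiz_strip_def)
    from Suc.IH[OF this] have IH: "schur_upto N \<mu> x
      = (-1) ^ psize \<mu> * jt K (\<lambda>n. - power_sum_upto N x n) (beta (conj_part \<mu>))" .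
    obtain k where k: "psize la = psize \<mu> + k"
      using horiz_strip_psize[OF hs] le_Suc_ex by blast
    show "x (Suc N) ^ (psize la - psize \<mu>) * schur_upto N \<mu> x = (-1) ^ psize la *
      ((- x (Suc N)) ^ (psize la - psize \<mu>) * jt K (\<lambda>n. - power_sum_upto N x n) (beta (conj_part \<mu>)))"
      unfolding IH k by (simp add: power_add power_minus[of "x (Suc N)"])
  qed simp
qed

section \<open>Passage to infinitely many variables\<close>

lemma has_sum_exhaustion:
  assumes "(f has_sum s) A" and "\<And>N. finite (B N)" "\<And>N. B N \<subseteq> A" "mono B" "A \<subseteq> (\<Union>N. B N)"
  shows "(\<lambda>N::nat. sum f (B N)) \<longlonglongrightarrow> s"
proof -
  have "filterlim B (finite_subsets_at_top A) sequentially"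
    unfolding filterlim_finite_subsets_at_top
  proof (intro allI impI)
    fix X assume X: "finite X \<and> X \<subseteq> A"
    then have "finite X" "X \<subseteq> A" by auto
    then have "\<exists>N. X \<subseteq> B N"
    proof (induction X rule: finite_induct)
      case (insert x X)
      then obtain N where N: "X \<subseteq> B N" by auto
      obtain N' where N': "x \<in> B N'" using insert.prems assms(5) by auto
      have "B N \<subseteq> B (max N N')" "B N' \<subseteq> B (max N N')"
        by (rule monoD[OF assms(4)]; simp)+
      then have "insert x X \<subseteq> B (max N N')" using N N' by auto
      then show ?case ..
    qed simp
    then obtain N where "X \<subseteq> B N" ..
    then have "X \<subseteq> B n" if "N \<le> n" for n using monoD[OF assms(4) that] by simp
    then have "\<forall>n\<ge>N. finite (B n) \<and> X \<subseteq> B n \<and> B n \<subseteq> A"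
      using assms(2,3) by simp
    then show "eventually (\<lambda>n. finite (B n) \<and> X \<subseteq> B n \<and> B n \<subseteq> A) sequentially"
      unfolding eventually_at_top_linorder by (rule exI)
  qed
  then show ?thesis
    using assms(1) unfolding has_sum_def by (rule filterlim_compose[rotated])
qed

text \<open>Dropping the order conditions on tableaux bounds every finite subsum of absolute values
  by the power of sum |x_i| with exponent |la|.\<close>

lemma schur_summable:
  fixes x :: "nat \<Rightarrow> complex"
  assumes x: "summable (\<lambda>i. norm (x (Suc i)))"
  shows "(\<lambda>T. \<Prod>c\<in>cells la. x (T c)) summable_on skew_ssyt la empty_part"
proof -
  let ?f = "\<lambda>T. norm (\<Prod>c\<in>cells la. x (T c))"
  let ?S = "\<Sum>i. norm (x (Suc i))"
  have "bdd_above (sum ?f ` {F. F \<subseteq> skew_ssyt la empty_part \<and> finite F})"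
  proof (rule bdd_aboveI2)
    fix F assume "F \<in> {F. F \<subseteq> skew_ssyt la empty_part \<and> finite F}"
    then have F: "F \<subseteq> skew_ssyt la empty_part" "finite F" by auto
    define N where "N = Max (insert 0 (\<Union>T\<in>F. T ` cells la))"
    have fin: "finite (insert 0 (\<Union>T\<in>F. T ` cells la))" using F by auto
    have "T \<in> cells la \<rightarrow>\<^sub>E {1..N}" if "T \<in> F" for T
    proof -
      have "T \<in> cells la \<rightarrow>\<^sub>E {1..}"
        using F(1) that unfolding skew_ssyt_def skew_cells_empty by blast
      moreover have "T c \<le> N" if "c \<in> cells la" for c
        unfolding N_def by (rule Max_ge[OF fin]) (use \<open>T \<in> F\<close> that in auto)
      ultimately show ?thesis by (auto simp: PiE_iff)
    qed
    then have "sum ?f F \<le> sum ?f (cells la \<rightarrow>\<^sub>E {1..N})"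
      by (intro sum_mono2) (auto intro!: finite_PiE)
    also have "\<dots> = (\<Sum>T\<in>cells la \<rightarrow>\<^sub>E {1..N}. \<Prod>c\<in>cells la. norm (x (T c)))"
      by (rule sum.cong[OF refl]) (rule prod_norm[symmetric])
    also have "\<dots> = (\<Prod>c\<in>cells la. \<Sum>i\<in>{1..N}. norm (x i))"
      by (subst prod_sum_PiE) auto
    also have "(\<Sum>i\<in>{1..N}. norm (x i)) = (\<Sum>i<N. norm (x (Suc i)))"
      by (rule sum.reindex_bij_witness[of _ Suc "\<lambda>i. i - 1"]) auto
    also have "(\<Prod>c\<in>cells la. (\<Sum>i<N. norm (x (Suc i)))) \<le> (\<Prod>c\<in>cells la. ?S)"
      by (intro prod_mono conjI sum_nonneg sum_le_suminf x) auto
    finally show "sum ?f F \<le> (\<Prod>c\<in>cells la. ?S)" .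
  qed
  then have "?f summable_on skew_ssyt la empty_part"
    by (intro nonneg_bdd_above_summable_on) auto
  then show ?thesis by (rule Infinite_Sum.abs_summable_summable)
qed

lemma schur_upto_tendsto:
  assumes x: "summable (\<lambda>i. norm (x (Suc i)))"
  shows "(\<lambda>N. schur_upto N la x) \<longlonglongrightarrow> schur la x"
proof -
  have "schur la x = (\<Sum>\<^sub>\<infinity>T\<in>skew_ssyt la empty_part. \<Prod>c\<in>cells la. x (T c))"
    by (simp add: schur_def skew_schur_def skew_cells_empty)
  then have "((\<lambda>T. \<Prod>c\<in>cells la. x (T c)) has_sum schur la x) (skew_ssyt la empty_part)"
    using has_sum_infsum[OF schur_summable[OF x]] by simp
  then show ?thesis
    unfolding schur_upto_def
  proof (rule has_sum_exhaustion)
    show "mono (\<lambda>N. ssyt_upto N la)"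
      by (rule monoI) (force simp: ssyt_upto_def)
    show "skew_ssyt la empty_part \<subseteq> (\<Union>N. ssyt_upto N la)"
    proof
      fix T assume T: "T \<in> skew_ssyt la empty_part"
      have "T c \<le> Max (T ` cells la)" if "c \<in> cells la" for c
        by (rule Max_ge) (use that in auto)
      then have "T \<in> ssyt_upto (Max (T ` cells la)) la" using T by (auto simp: ssyt_upto_def)
      then show "T \<in> (\<Union>N. ssyt_upto N la)" by blast
    qed
  qed (auto simp: finite_ssyt_upto, auto simp: ssyt_upto_def)
qed

definition power_sum :: "(nat \<Rightarrow> complex) \<Rightarrow> nat \<Rightarrow> complex" where
  "power_sum x n = (\<Sum>\<^sub>\<infinity>l\<in>{1..}. x l ^ n)"

lemma power_sum_upto_tendsto:
  assumes x: "summable (\<lambda>i. norm (x (Suc i)))" and n: "1 \<le> n"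
  shows "(\<lambda>N. power_sum_upto N x n) \<longlonglongrightarrow> power_sum x n"
proof -
  have "(\<lambda>i. norm (x (Suc i))) \<longlonglongrightarrow> 0" using x by (rule summable_LIMSEQ_zero)
  then have "eventually (\<lambda>i. norm (x (Suc i)) < 1) sequentially"
    by (rule order_tendstoD) simp
  then have "eventually (\<lambda>i. norm (norm (x (Suc i) ^ n)) \<le> norm (x (Suc i))) sequentially"
  proof eventually_elim
    case (elim i)
    have "norm (x (Suc i)) ^ n \<le> norm (x (Suc i)) ^ 1"
      by (rule power_decreasing) (use elim n in auto)
    then show ?case by (simp add: norm_power)
  qed
  then have "summable (\<lambda>i. norm (x (Suc i) ^ n))"
    by (rule summable_comparison_test_ev) (rule x)
  then have "(\<lambda>i. x (Suc i) ^ n) summable_on UNIV"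
    by (rule norm_summable_imp_summable_on)
  moreover have "bij_betw Suc UNIV {1..}"
    by (rule bij_betwI[of _ _ _ "\<lambda>i. i - 1"]) auto
  ultimately have "(\<lambda>l. x l ^ n) summable_on {1..}"
    using summable_on_reindex_bij_betw[of Suc UNIV "{1..}" "\<lambda>l. x l ^ n"] by simp
  then have "((\<lambda>l. x l ^ n) has_sum power_sum x n) {1..}"
    unfolding power_sum_def by (rule has_sum_infsum)
  then show ?thesis
    unfolding power_sum_upto_def
    by (rule has_sum_exhaustion) (auto simp: mono_def)
qed

lemma jt_tendsto:
  assumes "\<And>n. 1 \<le> n \<Longrightarrow> (\<lambda>N. p N n) \<longlonglongrightarrow> q n"
  shows "(\<lambda>N. jt K (p N) \<alpha>) \<longlonglongrightarrow> jt K q \<alpha>"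
  unfolding jt_def hfun_def by (rule fdet_tendsto) (auto intro!: newton_tendsto assms)

theorem schur_eq_jt:
  assumes x: "summable (\<lambda>i. norm (x (Suc i)))" and K: "plen la \<le> K"
  shows "schur la x = jt K (power_sum x) (beta la)"
proof (rule LIMSEQ_unique)
  show "(\<lambda>N. schur_upto N la x) \<longlonglongrightarrow> schur la x" by (rule schur_upto_tendsto[OF x])
  show "(\<lambda>N. schur_upto N la x) \<longlonglongrightarrow> jt K (power_sum x) (beta la)"
    unfolding schur_upto_jt[OF K] by (rule jt_tendsto) (rule power_sum_upto_tendsto[OF x])
qed

theorem schur_eq_jt_conj:
  assumes x: "summable (\<lambda>i. norm (x (Suc i)))" and K: "part la 1 \<le> K"
  shows "schur la x = (-1) ^ psize la * jt K (\<lambda>n. - power_sum x n) (beta (conj_part la))"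
proof (rule LIMSEQ_unique)
  show "(\<lambda>N. schur_upto N la x) \<longlonglongrightarrow> schur la x" by (rule schur_upto_tendsto[OF x])
  show "(\<lambda>N. schur_upto N la x) \<longlonglongrightarrow> (-1) ^ psize la * jt K (\<lambda>n. - power_sum x n) (beta (conj_part la))"
    unfolding schur_upto_jt_conj[OF K]
    by (intro tendsto_intros jt_tendsto power_sum_upto_tendsto[OF x])
qed

lemma schur_scale: "schur la (\<lambda>i. c * x i) = c ^ psize la * schur la x"
  unfolding schur_def skew_schur_def skew_cells_empty
  by (simp add: prod.distrib card_cells infsum_cmult_right')

lemma q_vars_summable:
  assumes "t \<noteq> 0" "norm t < 1"
  shows "summable (\<lambda>i. norm (q_vars t \<nu> (Suc i)))"
proof (rule summable_comparison_test)
  let ?m = "2 * int (part \<nu> 1)"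
  have "norm (q_vars t \<nu> (Suc i)) \<le> norm t powi (1 - ?m) * (norm t ^ 2) ^ i" for i
  proof -
    have "part \<nu> (Suc i) \<le> part \<nu> 1" by (rule part_antimono) auto
    then have "norm t powi (2 * (int (Suc i) - int (part \<nu> (Suc i))) - 1) \<le> norm t powi (1 - ?m + int (2 * i))"
      using assms by (intro power_int_decreasing) auto
    also have "\<dots> = norm t powi (1 - ?m) * (norm t ^ 2) ^ i"
      using assms by (simp only: power_int_add power_int_of_nat power_mult norm_eq_zero simp_thms)
    finally show ?thesis by (simp add: q_vars_def norm_power_int)
  qed
  then show "\<exists>N. \<forall>n\<ge>N. norm (norm (q_vars t \<nu> (Suc n))) \<le> norm t powi (1 - ?m) * (norm t ^ 2) ^ n"
    by simp
  show "summable (\<lambda>i. norm t powi (1 - ?m) * (norm t ^ 2) ^ i)"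
    using assms by (intro summable_mult summable_geometric) (auto simp: power_less_one_iff)
qed

lemma schur_empty [simp]: "schur empty_part x = 1"
proof -
  have "cells empty_part = {}" by (simp add: cells_empty_iff)
  moreover have "skew_ssyt empty_part empty_part = {\<lambda>_. undefined}"
    unfolding skew_ssyt_def skew_cells_empty \<open>cells empty_part = {}\<close> by auto
  ultimately show ?thesis by (simp add: schur_def skew_schur_def skew_cells_empty)
qed

text \<open>The first argument of the vertex is empty, so only \<open>\<eta> = empty_part\<close>
  contributes to its sum.\<close>

lemma hopf_link_eq:
  "hopf_link t la \<mu> = t powi kappa la * t powi kappa \<mu> *
     (schur \<mu> (q_vars t empty_part) * schur la (q_vars t \<mu>))"
proof -
  have 0: "skew_schur empty_part \<eta> x = 0" if "\<eta> \<noteq> empty_part" for \<eta> x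
  proof -
    have "\<not> (\<forall>i. part \<eta> i \<le> part empty_part i)"
      using that partition_eqI[of \<eta> empty_part] by force
    then show ?thesis unfolding skew_schur_def by (simp only: if_False)
  qed
  have "(\<Sum>\<^sub>\<infinity>\<eta>. skew_schur empty_part \<eta> x * skew_schur la \<eta> y) = schur la y" for x y
  proof -
    have "(\<Sum>\<^sub>\<infinity>\<eta>. skew_schur empty_part \<eta> x * skew_schur la \<eta> y)
        = (\<Sum>\<^sub>\<infinity>\<eta>\<in>{empty_part}. skew_schur empty_part \<eta> x * skew_schur la \<eta> y)"
      by (rule infsum_cong_neutral) (auto simp: 0)
    also have "\<dots> = schur empty_part x * schur la y" by (simp add: schur_def)
    finally show ?thesis by simp
  qed
  then show ?thesis by (simp add: hopf_link_def top_vertex_def)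
qed

section \<open>Alternants and the symmetry of the Hopf link\<close>

lemma newton_fps_prod:
  assumes "finite S"
  shows "newton_fps (\<lambda>n. \<Sum>i\<in>S. x i ^ n) * (\<Prod>i\<in>S. (1 - fps_const (x i) * fps_X)) = 1"
  using assms
proof (induction S rule: finite_induct)
  case empty
  have "newton_fps (\<lambda>_. 0) = 1"
    by (rule fps_ext) (simp add: newton_fps_def newton_zero)
  then show ?case by simp
next
  case (insert y S)
  have eq: "(\<lambda>n. \<Sum>i\<in>insert y S. x i ^ n) = (\<lambda>n. (\<Sum>i\<in>S. x i ^ n) + x y ^ n)"
    using insert.hyps by (simp add: add.commute)
  show ?case
    unfolding eq prod.insert[OF insert.hyps] mult.assoc[symmetric] newton_fps_add_var by (rule insert.IH)
qed

text \<open>The product is a polynomial of degree at most \<open>card S\<close>.\<close>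

lemma fps_prod_linear_nth_eq_0:
  assumes "finite S" "card S < b"
  shows "fps_nth (\<Prod>i\<in>S. (1 - fps_const (x i :: complex) * fps_X)) b = 0"
  using assms
proof (induction S arbitrary: b rule: finite_induct)
  case (insert y S)
  obtain c where b: "b = Suc c" using insert.prems by (cases b) auto
  have "card S < Suc c" "card S < c" using insert.prems insert.hyps b by auto
  then show ?case using insert by (simp add: b algebra_simps)
qed auto

text \<open>The factorization holds because \<open>1 / (1 - x\<^sub>i X)\<close> is the generating function of the
  complete symmetric functions times the polynomial \<open>\<Prod>\<^bsub>l \<noteq> i\<^esub> (1 - x\<^sub>l X)\<close>.\<close>

lemma alternant_eq_jt_mult:
  fixes x :: "nat \<Rightarrow> complex"
  assumes "\<And>j. j < N \<Longrightarrow> - int N \<le> \<alpha> j"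
  shows "fdet N (\<lambda>j i. x i ^ nat (int N + \<alpha> j))
    = jt N (\<lambda>n. \<Sum>i<N. x i ^ n) \<alpha>
      * fdet N (\<lambda>k i. fps_nth (\<Prod>l\<in>{..<N} - {i}. (1 - fps_const (x l) * fps_X)) (N - 1 - k))"
proof -
  let ?p = "\<lambda>n. \<Sum>i<N. x i ^ n"
  let ?Q = "\<lambda>i. \<Prod>l\<in>{..<N} - {i}. (1 - fps_const (x l) * fps_X)"
  have H: "newton_fps ?p * ?Q i = Abs_fps (\<lambda>n. x i ^ n)" if "i < N" for i
  proof -
    let ?L = "1 - fps_const (x i) * fps_X" and ?G = "Abs_fps (\<lambda>n. x i ^ n)"
    have G: "?G * ?L = 1"
    proof (rule fps_ext)
      fix k show "fps_nth (?G * ?L) k = fps_nth 1 k" by (cases k) (auto simp: algebra_simps)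
    qed
    have "newton_fps ?p * (?L * ?Q i) = 1"
      using newton_fps_prod[of "{..<N}" x] prod.remove[of "{..<N}" i "\<lambda>i. 1 - fps_const (x i) * fps_X"] that
      by simp
    then have "newton_fps ?p * ?Q i * (?G * ?L) = ?G"
      by (simp only: mult_ac mult_1_right) (metis mult.left_commute mult.right_neutral)
    then show ?thesis unfolding G by simp
  qed
  have ent: "x i ^ nat (int N + \<alpha> j) = (\<Sum>k<N. hfun ?p (\<alpha> j + int k + 1) * fps_nth (?Q i) (N - 1 - k))"
    if "i < N" "j < N" for i j
  proof -
    define a where "a = nat (int N + \<alpha> j)"
    have a: "\<alpha> j = int a - int N" using assms[OF that(2)] by (simp add: a_def)
    \<comment> \<open>The polynomial for \<open>i\<close> omits one linear factor, so its degree is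
      below N and the convolution shrinks to the N terms of a matrix product.\<close>
    have Q0: "fps_nth (?Q i) b = 0" if "N \<le> b" for b
      by (rule fps_prod_linear_nth_eq_0) (use that \<open>i < N\<close> in auto)
    have "x i ^ a = fps_nth (newton_fps ?p * ?Q i) a" unfolding H[OF that(1)] by simp
    also have "\<dots> = (\<Sum>b=0..a. fps_nth (?Q i) b * fps_nth (newton_fps ?p) (a - b))"
      by (subst mult.commute) (rule fps_mult_nth)
    also have "\<dots> = (\<Sum>b=0..a. fps_nth (?Q i) b * hfun ?p (int a - int b))"
      by (rule sum.cong) (auto simp: newton_fps_def hfun_def nat_diff_distrib)
    also have "\<dots> = (\<Sum>b\<in>{..<N} \<union> {0..a}. fps_nth (?Q i) b * hfun ?p (int a - int b))"
      by (rule sum.mono_neutral_left) (auto simp: hfun_def)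
    also have "\<dots> = (\<Sum>b<N. fps_nth (?Q i) b * hfun ?p (int a - int b))"
      by (rule sum.mono_neutral_right) (auto intro: Q0)
    also have "\<dots> = (\<Sum>k<N. hfun ?p (\<alpha> j + int k + 1) * fps_nth (?Q i) (N - 1 - k))"
      by (rule sum.reindex_bij_witness[of _ "\<lambda>k. N - 1 - k" "\<lambda>k. N - 1 - k"])
        (auto simp: a of_nat_diff algebra_simps)
    finally show ?thesis by (simp add: a_def)
  qed
  have "fdet N (\<lambda>j i. x i ^ nat (int N + \<alpha> j))
      = fdet N (\<lambda>j i. \<Sum>k<N. hfun ?p (\<alpha> j + int k + 1) * fps_nth (?Q i) (N - 1 - k))"
    by (rule fdet_cong) (rule ent)
  also have "\<dots> = jt N ?p \<alpha> * fdet N (\<lambda>k i. fps_nth (?Q i) (N - 1 - k))"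
    unfolding jt_def by (rule fdet_mult)
  finally show ?thesis .
qed

lemma jt_beta_empty: "jt N p (beta empty_part) = 1"
proof -
  have "jt N p (beta empty_part) = (\<Prod>i<N. hfun p (beta empty_part i + int i + 1))"
    unfolding jt_def by (rule fdet_upper_triangular) (simp add: beta_def hfun_def)
  then show ?thesis by (simp add: beta_def hfun_def)
qed

text \<open>The second factor in \<open>alternant_eq_jt_mult\<close> does not depend on the
  exponents, and the empty partition identifies it as the Vandermonde determinant. This is the
  bialternant formula, free of divisions.\<close>

lemma alternant_eq_jt:
  fixes x :: "nat \<Rightarrow> complex"
  shows "fdet N (\<lambda>j i. x i ^ nat (int N + beta la j))
    = jt N (\<lambda>n. \<Sum>i<N. x i ^ n) (beta la) * fdet N (\<lambda>j i. x i ^ nat (int N + beta empty_part j))"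
proof -
  let ?E = "fdet N (\<lambda>k i. fps_nth (\<Prod>l\<in>{..<N} - {i}. (1 - fps_const (x l) * fps_X)) (N - 1 - k))"
  have alt: "fdet N (\<lambda>j i. x i ^ nat (int N + beta \<mu> j)) = jt N (\<lambda>n. \<Sum>i<N. x i ^ n) (beta \<mu>) * ?E" for \<mu>
    by (rule alternant_eq_jt_mult) (simp add: beta_def)
  show ?thesis using alt[of la] alt[of empty_part] by (simp only: jt_beta_empty mult_1)
qed

definition pair_det :: "nat \<Rightarrow> complex \<Rightarrow> partition \<Rightarrow> partition \<Rightarrow> complex" where
  "pair_det N t la \<mu> = fdet N (\<lambda>j i. t powi (- 2 * beta la j * beta \<mu> i))"

lemma pair_det_commute: "pair_det N t la \<mu> = pair_det N t \<mu> la"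
  unfolding pair_det_def
  using fdet_transpose[of N "\<lambda>j i. t powi (- 2 * beta \<mu> j * beta la i)"] by (simp add: mult_ac)

definition beta_vandermonde :: "nat \<Rightarrow> complex \<Rightarrow> partition \<Rightarrow> complex" where
  "beta_vandermonde N q la = (\<Prod>j<N. \<Prod>i<j. (q powi beta la j - q powi beta la i))"

lemma power_int_inj:
  fixes t :: complex
  assumes "t \<noteq> 0" "norm t < 1" "t powi a = t powi b"
  shows "a = b"
proof -
  have lt: "norm t powi b < norm t powi a" if "a < b" for a b
    using power_int_strict_decreasing[of a b "norm t"] that assms by auto
  have "norm t powi a = norm t powi b" using assms(3) by (metis norm_power_int)
  then show ?thesis using lt[of a b] lt[of b a] by (cases a b rule: linorder_cases) auto
qed

lemma beta_vandermonde_nonzero: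
  assumes "q \<noteq> 0" "norm q < 1"
  shows "beta_vandermonde N q la \<noteq> 0"
proof -
  have "q powi beta la j \<noteq> q powi beta la i" if "i < j" for i j
    using power_int_inj[OF assms, of "beta la j" "beta la i"] part_antimono[of "Suc i" "Suc j" la] that
    by (auto simp: beta_def)
  then show ?thesis unfolding beta_vandermonde_def by (auto simp: prod_zero_iff)
qed

text \<open>The shifted parts of the empty partition are -1, -2, ..., so each column consists of
  consecutive powers of one number.\<close>

lemma pair_det_empty:
  assumes "t \<noteq> 0"
  shows "pair_det N t empty_part \<mu> = (\<Prod>i<N. t\<^sup>2 powi beta \<mu> i) * beta_vandermonde N (t\<^sup>2) \<mu>"
proof -
  have sq: "t\<^sup>2 powi k = t powi (2 * k)" for k by (simp add: power_int_mult)
  have "pair_det N t empty_part \<mu> = fdet N (\<lambda>j i. t\<^sup>2 powi beta \<mu> i * (t\<^sup>2 powi beta \<mu> i) ^ j)"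
    unfolding pair_det_def
  proof (rule fdet_cong)
    fix i j
    have "- 2 * beta empty_part j * beta \<mu> i = (2 * beta \<mu> i) * int (Suc j)"
      by (simp add: beta_def algebra_simps)
    then show "t powi (- 2 * beta empty_part j * beta \<mu> i) = t\<^sup>2 powi beta \<mu> i * (t\<^sup>2 powi beta \<mu> i) ^ j"
      unfolding sq by (simp only: power_int_mult power_int_of_nat power_Suc)
  qed
  also have "\<dots> = (\<Prod>i<N. t\<^sup>2 powi beta \<mu> i) * fdet N (\<lambda>j i. (t\<^sup>2 powi beta \<mu> i) ^ j)"
    by (rule fdet_scale_cols)
  also have "fdet N (\<lambda>j i. (t\<^sup>2 powi beta \<mu> i) ^ j) = beta_vandermonde N (t\<^sup>2) \<mu>"
    unfolding beta_vandermonde_def vandermonde_fdet[symmetric] by (rule fdet_transpose)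
  finally show ?thesis .
qed

lemma pair_det_empty_nonzero:
  assumes "t \<noteq> 0" "norm t < 1"
  shows "pair_det N t empty_part \<mu> \<noteq> 0"
  using assms beta_vandermonde_nonzero[of "t\<^sup>2" N \<mu>]
  by (simp add: pair_det_empty prod_zero_iff norm_power power_less_one_iff)

lemma prod_powi_beta:
  fixes c :: complex
  assumes "c \<noteq> 0" "plen la \<le> N"
  shows "(\<Prod>i<N. c powi beta la i) = c ^ psize la * (\<Prod>i<N. c powi beta empty_part i)"
proof -
  have "(\<Prod>i<N. c powi beta la i) = (\<Prod>i<N. c ^ part la (Suc i) * c powi beta empty_part i)"
  proof (rule prod.cong)
    fix i
    have "beta la i = int (part la (Suc i)) + beta empty_part i" by (simp add: beta_def)
    then show "c powi beta la i = c ^ part la (Suc i) * c powi beta empty_part i"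
      using assms by (simp add: power_int_add)
  qed simp
  also have "\<dots> = c ^ (\<Sum>i<N. part la (Suc i)) * (\<Prod>i<N. c powi beta empty_part i)"
    by (simp add: prod.distrib power_sum)
  also have "(\<Sum>i<N. part la (Suc i)) = psize la"
    using psize_diff[of empty_part la N] assms by simp
  finally show ?thesis .
qed

lemma cancel_alternant_factors:
  fixes P X :: complex
  assumes "P \<noteq> 0" "X \<noteq> 0" "D0 \<noteq> 0" "c * P * (X * D) = s * (P * (X * D0))"
  shows "s = c * D / D0"
  using assms by (simp add: field_simps)

text \<open>At x_i = t^(-2 m - 1), with m the i-th shifted part of \<open>\<mu>\<close>, the
  alternant entry for a shifted part l is t^(-2 l m) times the row factor t^(-l) and the column
  factor x_i^N. In the quotient by the alternant of the empty partition these factors leave only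
  \<open>inverse t ^ psize la\<close>.\<close>

lemma schur_upto_pair_det:
  assumes t: "t \<noteq> 0" "norm t < 1" and N: "plen la \<le> N"
  shows "schur_upto N la (q_vars t \<mu>) = inverse t ^ psize la * pair_det N t la \<mu> / pair_det N t empty_part \<mu>"
proof -
  define x where "x i = q_vars t \<mu> (Suc i)" for i
  have x: "x i = t powi (- 2 * beta \<mu> i - 1)" for i
    by (simp add: x_def q_vars_def beta_def)
  have alt: "fdet N (\<lambda>j i. x i ^ nat (int N + beta \<nu> j))
      = (\<Prod>j<N. inverse t powi beta \<nu> j) * ((\<Prod>i<N. x i ^ N) * pair_det N t \<nu> \<mu>)" for \<nu>
  proof -
    have "fdet N (\<lambda>j i. x i ^ nat (int N + beta \<nu> j))
        = fdet N (\<lambda>j i. inverse t powi beta \<nu> j * (x i ^ N * t powi (- 2 * beta \<nu> j * beta \<mu> i)))"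
    proof (rule fdet_cong)
      fix j i assume "j < N"
      then have nn: "0 \<le> int N + beta \<nu> j" by (simp add: beta_def)
      have "x i \<noteq> 0" using t by (simp add: x)
      have "x i ^ nat (int N + beta \<nu> j) = x i powi (int N + beta \<nu> j)"
        using nn by (metis nat_0_le power_int_of_nat)
      also have "\<dots> = x i ^ N * x i powi beta \<nu> j" using \<open>x i \<noteq> 0\<close> by (simp add: power_int_add)
      also have "x i powi beta \<nu> j = t powi ((- 2 * beta \<mu> i - 1) * beta \<nu> j)"
        by (simp only: x power_int_mult)
      also have "(- 2 * beta \<mu> i - 1) * beta \<nu> j = - beta \<nu> j + - 2 * beta \<nu> j * beta \<mu> i"
        by (simp add: algebra_simps)
      also have "t powi \<dots> = inverse t powi beta \<nu> j * t powi (- 2 * beta \<nu> j * beta \<mu> i)"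
        using t by (subst power_int_add) (auto simp: power_int_minus power_int_inverse)
      finally show "x i ^ nat (int N + beta \<nu> j) = inverse t powi beta \<nu> j * (x i ^ N * t powi (- 2 * beta \<nu> j * beta \<mu> i))"
        by (simp only: mult.left_commute)
    qed
    then show ?thesis by (simp only: fdet_scale_rows fdet_scale_cols pair_det_def)
  qed
  have "power_sum_upto N (q_vars t \<mu>) = (\<lambda>n. \<Sum>i<N. x i ^ n)"
    unfolding power_sum_upto_def x_def
    by (intro ext sum.reindex_bij_witness[of _ Suc "\<lambda>i. i - 1"]) auto
  then have s: "schur_upto N la (q_vars t \<mu>) = jt N (\<lambda>n. \<Sum>i<N. x i ^ n) (beta la)"
    using schur_upto_jt[OF N] by simp
  have "(\<Prod>i<N. x i ^ N) \<noteq> 0" "(\<Prod>j<N. inverse t powi beta empty_part j) \<noteq> 0"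
    using t by (auto simp: x)
  moreover have "pair_det N t empty_part \<mu> \<noteq> 0" by (rule pair_det_empty_nonzero[OF t])
  moreover have "inverse t ^ psize la * (\<Prod>j<N. inverse t powi beta empty_part j) * ((\<Prod>i<N. x i ^ N) * pair_det N t la \<mu>)
      = schur_upto N la (q_vars t \<mu>) * ((\<Prod>j<N. inverse t powi beta empty_part j) * ((\<Prod>i<N. x i ^ N) * pair_det N t empty_part \<mu>))"
    using alternant_eq_jt[of N x la] prod_powi_beta[of "inverse t" la N] t N
    unfolding s alt by simp
  ultimately show ?thesis
    by (intro cancel_alternant_factors)
qed

text \<open>In the product of the truncated Schur polynomials the determinant that pairs
  \<open>\<mu>\<close> with the empty partition cancels. What is left, up to a symmetric power of
  \<open>t\<close>, is the determinant that pairs \<open>la\<close> with \<open>\<mu>\<close> over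
  the one that pairs two empty partitions.\<close>

theorem schur_q_vars_symmetric:
  assumes t: "t \<noteq> 0" "norm t < 1"
  shows "schur \<mu> (q_vars t empty_part) * schur la (q_vars t \<mu>)
    = schur la (q_vars t empty_part) * schur \<mu> (q_vars t la)"
proof (rule LIMSEQ_unique)
  let ?f = "\<lambda>la \<mu> N. schur_upto N \<mu> (q_vars t empty_part) * schur_upto N la (q_vars t \<mu>)"
  have lim: "(\<lambda>N. ?f la \<mu> N) \<longlonglongrightarrow> schur \<mu> (q_vars t empty_part) * schur la (q_vars t \<mu>)" for la \<mu>
    by (intro tendsto_intros schur_upto_tendsto q_vars_summable t)
  show "?f la \<mu> \<longlonglongrightarrow> schur \<mu> (q_vars t empty_part) * schur la (q_vars t \<mu>)" by (rule lim)
  have "?f la \<mu> N = ?f \<mu> la N" if "max (plen la) (plen \<mu>) \<le> N" for N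
  proof -
    have "?f la \<mu> N = inverse t ^ (psize la + psize \<mu>) * pair_det N t la \<mu> / pair_det N t empty_part empty_part"
      if "max (plen la) (plen \<mu>) \<le> N" for la \<mu>
      using that pair_det_empty_nonzero[OF t, of N \<mu>] pair_det_commute[of N t \<mu> empty_part]
      by (simp add: schur_upto_pair_det[OF t] power_add)
    from this[of la \<mu>] this[of \<mu> la] that show ?thesis
      by (simp add: pair_det_commute[of N t \<mu> la] add.commute max.commute)
  qed
  then have "eventually (\<lambda>N. ?f \<mu> la N = ?f la \<mu> N) sequentially"
    by (intro eventually_sequentiallyI[of "max (plen la) (plen \<mu>)"]) simp
  then show "?f la \<mu> \<longlonglongrightarrow> schur la (q_vars t empty_part) * schur \<mu> (q_vars t la)"
    using lim[where la = \<mu> and \<mu> = la] by (rule Lim_transform_eventually[rotated])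
qed

text \<open>By the symmetry of \<open>pair_det\<close> the empty partition can take the first place,
  where the determinant is a Vandermonde product.\<close>

lemma schur_principal_tendsto:
  assumes t: "t \<noteq> 0" "norm t < 1"
  shows "(\<lambda>N. t ^ psize la * beta_vandermonde N (t\<^sup>2) la / beta_vandermonde N (t\<^sup>2) empty_part)
    \<longlonglongrightarrow> schur la (q_vars t empty_part)"
proof (rule Lim_transform_eventually)
  show "(\<lambda>N. schur_upto N la (q_vars t empty_part)) \<longlonglongrightarrow> schur la (q_vars t empty_part)"
    by (intro schur_upto_tendsto q_vars_summable t)
  show "eventually (\<lambda>N. schur_upto N la (q_vars t empty_part)
      = t ^ psize la * beta_vandermonde N (t\<^sup>2) la / beta_vandermonde N (t\<^sup>2) empty_part) sequentially"
  proof (rule eventually_sequentiallyI)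
    fix N assume N: "plen la \<le> N"
    define B where "B = (\<Prod>i<N. t\<^sup>2 powi beta empty_part i)"
    have B: "B \<noteq> 0" using t by (auto simp: B_def)
    have A: "(\<Prod>i<N. t\<^sup>2 powi beta la i) = (t ^ psize la * t ^ psize la) * B"
      using prod_powi_beta[of "t\<^sup>2" la N] t N
      by (simp only: B_def power2_eq_square power_mult_distrib) simp
    have c: "inverse t ^ n * (t ^ n * t ^ n * B * V) / (B * V0) = t ^ n * V / V0" for n V V0
      using t B by (simp add: field_simps)
    show "schur_upto N la (q_vars t empty_part)
      = t ^ psize la * beta_vandermonde N (t\<^sup>2) la / beta_vandermonde N (t\<^sup>2) empty_part"
      unfolding schur_upto_pair_det[OF t N] pair_det_commute[of N t la] pair_det_empty[OF t(1)]
        A B_def[symmetric] by (rule c)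
  qed
qed

section \<open>Normalization factors\<close>

text \<open>For partial products, |prod (1 + f) - 1| is at most prod (1 + |f|) - 1, which is bounded
  through the exponential of the sum.\<close>

lemma norm_prodinf_minus_1_le:
  fixes f :: "nat \<Rightarrow> complex"
  assumes "summable (\<lambda>n. norm (f n))"
  shows "convergent_prod (\<lambda>n. 1 + f n)"
    and "norm ((\<Prod>n. 1 + f n) - 1) \<le> exp (\<Sum>n. norm (f n)) - 1"
proof -
  have "abs_convergent_prod (\<lambda>n. 1 + f n)"
    using assms by (simp add: abs_convergent_prod_conv_summable)
  then show conv: "convergent_prod (\<lambda>n. 1 + f n)"
    by (rule abs_convergent_prod_imp_convergent_prod)
  have le: "norm ((\<Prod>n\<le>N. 1 + f n) - 1) \<le> exp (\<Sum>n. norm (f n)) - 1" for N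
  proof -
    have "norm ((\<Prod>n\<le>N. 1 + f n) - 1) \<le> (\<Prod>n\<le>N. 1 + norm (f n)) - 1"
      by (rule norm_prod_minus1_le_prod_minus1)
    also have "(\<Prod>n\<le>N. 1 + norm (f n)) \<le> exp (\<Sum>n\<le>N. norm (f n))"
      by (rule prod_le_exp_sum) auto
    also have "(\<Sum>n\<le>N. norm (f n)) \<le> (\<Sum>n. norm (f n))"
      by (rule sum_le_suminf[OF assms]) auto
    finally show ?thesis by simp
  qed
  show "norm ((\<Prod>n. 1 + f n) - 1) \<le> exp (\<Sum>n. norm (f n)) - 1"
  proof (rule Lim_bounded)
    show "(\<lambda>N. norm ((\<Prod>n\<le>N. 1 + f n) - 1)) \<longlonglongrightarrow> norm ((\<Prod>n. 1 + f n) - 1)"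
      by (intro tendsto_intros convergent_prod_LIMSEQ conv)
  qed (use le in blast)
qed

lemma exp_minus_1_le: "exp x - 1 \<le> x * exp (x :: real)"
proof -
  have "(1 - x) * exp x \<le> exp (- x) * exp x"
    using exp_ge_add_one_self[of "- x"] by (intro mult_right_mono) auto
  then show ?thesis by (simp add: exp_minus algebra_simps)
qed

text \<open>The norms in row i sum to at most C r^i / (1 - r), so the row product differs from 1 by
  a multiple of r^i, and the product of the row products converges in turn.\<close>

lemma double_product_bound:
  fixes f :: "nat \<Rightarrow> nat \<Rightarrow> complex"
  assumes f: "\<And>i j. norm (f i j) \<le> C * r ^ (i + j)" and C: "0 \<le> C" and r: "0 \<le> r" "r < 1"
  shows "convergent_prod (\<lambda>j. 1 + f i j)"
    and "norm ((\<Prod>j. 1 + f i j) - 1) \<le> C / (1 - r) * exp (C / (1 - r)) * r ^ i"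
    and "convergent_prod (\<lambda>i. \<Prod>j. 1 + f i j)"
proof -
  have geo: "(\<lambda>j. C * r ^ (i + j)) sums (C * r ^ i / (1 - r))" for i
    using sums_mult[OF geometric_sums[of r], of "C * r ^ i"] r by (simp add: power_add mult_ac)
  have summ: "summable (\<lambda>j. norm (f i j))" for i
    by (rule summable_comparison_test'[OF sums_summable[OF geo[of i]], of 0]) (use f in simp)
  have suminf: "(\<Sum>j. norm (f i j)) \<le> C * r ^ i / (1 - r)" for i
    using suminf_le[OF f[of i] summ[of i] sums_summable[OF geo[of i]]] sums_unique[OF geo[of i]] by simp
  show 1: "convergent_prod (\<lambda>j. 1 + f i j)" for i
    by (rule norm_prodinf_minus_1_le[OF summ])
  show 2: "norm ((\<Prod>j. 1 + f i j) - 1) \<le> C / (1 - r) * exp (C / (1 - r)) * r ^ i" for i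
  proof -
    let ?x = "C * r ^ i / (1 - r)"
    have "norm ((\<Prod>j. 1 + f i j) - 1) \<le> exp (\<Sum>j. norm (f i j)) - 1"
      by (rule norm_prodinf_minus_1_le[OF summ])
    also have "\<dots> \<le> exp ?x - 1" using suminf[of i] by simp
    also have "\<dots> \<le> ?x * exp ?x" by (rule exp_minus_1_le)
    also have "\<dots> \<le> ?x * exp (C / (1 - r))"
    proof (intro mult_left_mono)
      have "C * r ^ i \<le> C * 1" using C r by (intro mult_left_mono power_le_one) auto
      then show "exp ?x \<le> exp (C / (1 - r))" using r by (simp add: divide_right_mono)
    qed (use C r in auto)
    finally show ?thesis by (simp add: mult_ac)
  qed
  have "summable (\<lambda>i. norm ((\<Prod>j. 1 + f i j) - 1))"
  proof (rule summable_comparison_test')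
    show "summable (\<lambda>i. C / (1 - r) * exp (C / (1 - r)) * r ^ i)"
      using r by (intro summable_mult summable_geometric) auto
  qed (use 2 in simp)
  from norm_prodinf_minus_1_le(1)[OF this] show "convergent_prod (\<lambda>i. \<Prod>j. 1 + f i j)" by simp
qed

text \<open>On a cell of the diagram the exponent is minus the hook length; rows and columns are
  counted from 0.\<close>

definition hook_factor :: "complex \<Rightarrow> partition \<Rightarrow> nat \<Rightarrow> nat \<Rightarrow> complex" where
  "hook_factor q la i j = 1 - q powi (- beta la i - beta (conj_part la) j - 1)"

lemma hook_factor_conj: "hook_factor q (conj_part la) j i = hook_factor q la i j"
proof -
  have "- beta (conj_part la) j - beta la i - 1 = - beta la i - beta (conj_part la) j - 1" by simp
  then show ?thesis by (simp only: hook_factor_def conj_conj)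
qed

text \<open>The signed hook length is positive on the cells of the diagram and negative outside,
  hence never 0. This keeps all factors of the double product away from 0.\<close>

lemma beta_conj_neq: "beta la i \<noteq> - 1 - beta (conj_part la) j"
  using le_part_conj_iff[of "Suc i" "Suc j" la] unfolding beta_def by linarith

lemma hook_factor_nonzero:
  assumes "q \<noteq> 0" "norm q < 1"
  shows "hook_factor q la i j \<noteq> 0"
proof
  assume "hook_factor q la i j = 0"
  then have "q powi (- beta la i - beta (conj_part la) j - 1) = q powi 0" by (simp add: hook_factor_def)
  then have "- beta la i - beta (conj_part la) j - 1 = 0" by (rule power_int_inj[OF assms])
  then show False using beta_conj_neq[of la i j] by linarith
qed

lemma hook_factor_bound:
  assumes q: "q \<noteq> 0" "norm q < 1"
  shows "norm (hook_factor q la i j - 1) \<le> norm q powi (1 - int (part la 1) - int (plen la)) * norm q ^ (i + j)"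
proof -
  have "part la (Suc i) \<le> part la 1" "part (conj_part la) (Suc j) \<le> plen la"
    unfolding plen_def by (rule part_antimono; simp)+
  then have "norm q powi (- beta la i - beta (conj_part la) j - 1)
      \<le> norm q powi ((1 - int (part la 1) - int (plen la)) + int (i + j))"
    using q by (intro power_int_decreasing) (auto simp: beta_def)
  also have "\<dots> = norm q powi (1 - int (part la 1) - int (plen la)) * norm q ^ (i + j)"
    using q by (simp only: power_int_add power_int_of_nat norm_eq_zero simp_thms)
  finally show ?thesis by (simp add: hook_factor_def norm_power_int)
qed

definition row_product :: "complex \<Rightarrow> partition \<Rightarrow> nat \<Rightarrow> complex" where
  "row_product q la i = (\<Prod>j. hook_factor q la i j)"

context
  fixes q :: complex
  assumes q: "q \<noteq> 0" "norm q < 1"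
begin

lemma row_product_convergent: "convergent_prod (hook_factor q la i)"
  using double_product_bound(1)[of "\<lambda>i j. hook_factor q la i j - 1", OF hook_factor_bound[OF q]] q
  by (simp add: power_int_def)

lemma row_product_tendsto: "(\<lambda>M. \<Prod>j<M. hook_factor q la i j) \<longlonglongrightarrow> row_product q la i"
  unfolding row_product_def
  using convergent_prod_LIMSEQ[OF row_product_convergent] LIMSEQ_lessThan_iff_atMost by blast

lemma row_product_nonzero: "row_product q la i \<noteq> 0"
  unfolding row_product_def
  by (rule prodinf_nonzero[OF row_product_convergent]) (rule hook_factor_nonzero[OF q])

lemma row_products_convergent: "convergent_prod (row_product q la)"
  unfolding row_product_def
  using double_product_bound(3)[of "\<lambda>i j. hook_factor q la i j - 1", OF hook_factor_bound[OF q]] q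
  by (simp add: power_int_def)

lemma row_products_tendsto: "(\<lambda>N. \<Prod>i<N. row_product q la i) \<longlonglongrightarrow> (\<Prod>i. row_product q la i)"
  using convergent_prod_LIMSEQ[OF row_products_convergent] LIMSEQ_lessThan_iff_atMost by blast

lemma row_products_nonzero: "(\<Prod>i. row_product q la i) \<noteq> 0"
  by (rule prodinf_nonzero[OF row_products_convergent]) (rule row_product_nonzero)

lemma norm_prod_eq: "norm_prod la q = inverse (\<Prod>i. row_product q la i)"
proof -
  have f: "1 - q powi (- int (part la (Suc i)) - int (part (conj_part la) (Suc j)) + int (Suc i) + int (Suc j) - 1)
      = hook_factor q la i j" for i j
    by (simp add: hook_factor_def beta_def algebra_simps)
  show ?thesis
    unfolding norm_prod_def f prodinf_inverse[OF row_product_convergent] row_product_def[symmetric]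
    by (rule prodinf_inverse[OF row_products_convergent])
qed

end

text \<open>The exponents \<open>\<lambda>\<^sub>i - i\<close> and \<open>j - 1 - \<lambda>'\<^sub>j\<close> partition an interval of integers; this turns the
  truncated double product into q-factorials and a Vandermonde product.\<close>

lemma beta_complement:
  assumes "plen la \<le> N" "part la 1 \<le> M"
  shows "(\<lambda>j. - 1 - beta (conj_part la) j) ` {..<M} = {- int N..<int M} - beta la ` {..<N}"
proof (rule card_subset_eq)
  show "(\<lambda>j. - 1 - beta (conj_part la) j) ` {..<M} \<subseteq> {- int N..<int M} - beta la ` {..<N}"
  proof (rule image_subsetI)
    fix j assume "j \<in> {..<M}"
    moreover have "part (conj_part la) (Suc j) \<le> plen la" unfolding plen_def by (rule part_antimono) auto
    moreover have "- 1 - beta (conj_part la) j \<notin> beta la ` {..<N}"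
    proof
      assume "- 1 - beta (conj_part la) j \<in> beta la ` {..<N}"
      then obtain i where "- 1 - beta (conj_part la) j = beta la i" by blast
      then show False using beta_conj_neq[of la i j] by simp
    qed
    ultimately show "- 1 - beta (conj_part la) j \<in> {- int N..<int M} - beta la ` {..<N}"
      using assms by (auto simp: beta_def)
  qed
  have inj: "inj_on (beta \<mu>) A" for \<mu> A
    by (rule inj_on_subset[OF inj_beta]) simp
  have "beta la ` {..<N} \<subseteq> {- int N..<int M}"
  proof (rule image_subsetI)
    fix i assume "i \<in> {..<N}"
    moreover have "part la (Suc i) \<le> part la 1" by (rule part_antimono) auto
    ultimately show "beta la i \<in> {- int N..<int M}" using assms by (auto simp: beta_def)
  qed
  then have "card ({- int N..<int M} - beta la ` {..<N}) = M"
    by (subst card_Diff_subset) (auto simp: card_image[OF inj])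
  moreover have "card ((\<lambda>j. - 1 - beta (conj_part la) j) ` {..<M}) = M"
    using inj[of "conj_part la" "{..<M}"] by (subst card_image) (auto simp: inj_on_def)
  ultimately show "card ((\<lambda>j. - 1 - beta (conj_part la) j) ` {..<M}) = card ({- int N..<int M} - beta la ` {..<N})"
    by simp
qed simp

section \<open>Truncated double products and q-factorials\<close>

definition qfact :: "complex \<Rightarrow> nat \<Rightarrow> complex" where
  "qfact q n = (\<Prod>m=1..n. 1 - q ^ m)"

lemma qfact_nonzero:
  assumes "norm q < 1"
  shows "qfact q k \<noteq> 0"
proof -
  have "1 - q ^ l \<noteq> 0" if "l \<in> {1..k}" for l
  proof
    assume "1 - q ^ l = 0"
    then have "q ^ l = 1" by simp
    then have "norm q ^ l = 1" by (metis norm_one norm_power)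
    moreover have "norm q ^ l < 1" using assms that by (simp add: power_less_one_iff)
    ultimately show False by simp
  qed
  then show ?thesis unfolding qfact_def by (auto simp: prod_zero_iff)
qed

lemma qfact_inverse:
  assumes "q \<noteq> 0"
  shows "(\<Prod>m=1..n. 1 - q powi (- int m)) = (-1) ^ n * inverse q ^ (\<Sum>{1..n}) * qfact q n"
proof -
  have "(\<Prod>m=1..n. 1 - q powi (- int m)) = (\<Prod>m=1..n. (-1) * inverse q ^ m * (1 - q ^ m))"
  proof (rule prod.cong)
    fix m
    have "q powi (- int m) = inverse q ^ m"
      by (simp add: power_int_minus power_inverse)
    then show "1 - q powi (- int m) = (-1) * inverse q ^ m * (1 - q ^ m)"
      using assms by (simp add: field_simps)
  qed simp
  also have "\<dots> = (\<Prod>m=1..n. -1) * (\<Prod>m=1..n. inverse q ^ m) * (\<Prod>m=1..n. 1 - q ^ m)"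
    by (simp only: prod.distrib)
  finally show ?thesis by (simp add: power_sum qfact_def)
qed

text \<open>The hook factors of row i have exponents k - beta_i with k outside the set of shifted
  parts (\<open>beta_complement\<close>), the second product those with k inside. Together k runs
  through {-N..<M} without beta_i: larger k give a q-factorial, smaller ones its analogue with
  negative exponents.\<close>

lemma row_product_truncated:
  assumes N: "plen la \<le> N" "part la 1 \<le> M" and i: "i < N"
  shows "(\<Prod>j<M. hook_factor q la i j) * (\<Prod>j\<in>{..<N} - {i}. 1 - q powi (beta la j - beta la i))
    = qfact q (nat (int M - 1 - beta la i)) * (\<Prod>m=1..nat (int N + beta la i). 1 - q powi (- int m))"
proof -
  let ?b = "beta la i" and ?g = "\<lambda>k. 1 - q powi (k - beta la i)"
  have bi: "- int N \<le> ?b" "?b < int M"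
    using part_antimono[of 1 "Suc i" la] N i by (auto simp: beta_def)
  have "- ?b - beta (conj_part la) j - 1 = - 1 - beta (conj_part la) j - ?b" for j by simp
  then have "(\<Prod>j<M. hook_factor q la i j) = (\<Prod>j<M. ?g (- 1 - beta (conj_part la) j))"
    by (simp only: hook_factor_def)
  also have "\<dots> = prod ?g ((\<lambda>j. - 1 - beta (conj_part la) j) ` {..<M})"
    using inj_on_subset[OF inj_beta subset_UNIV, of "conj_part la" "{..<M}"]
    by (subst prod.reindex) (auto simp: inj_on_def)
  finally have 1: "(\<Prod>j<M. hook_factor q la i j) = prod ?g ({- int N..<int M} - beta la ` {..<N})"
    unfolding beta_complement[OF N] .
  have "(\<Prod>j\<in>{..<N} - {i}. ?g (beta la j)) = prod ?g (beta la ` ({..<N} - {i}))"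
    by (subst prod.reindex[OF inj_on_subset[OF inj_beta subset_UNIV]]) simp
  also have "beta la ` ({..<N} - {i}) = beta la ` {..<N} - {?b}"
    using i by (subst inj_on_image_set_diff[OF inj_beta]) auto
  finally have 2: "(\<Prod>j\<in>{..<N} - {i}. ?g (beta la j)) = prod ?g (beta la ` {..<N} - {?b})" .
  have sub: "beta la j \<in> {- int N..<int M}" if "j < N" for j
    using part_antimono[of 1 "Suc j" la] N that by (auto simp: beta_def)
  have "prod ?g ({- int N..<int M} - beta la ` {..<N}) * prod ?g (beta la ` {..<N} - {?b})
      = prod ?g (({- int N..<int M} - beta la ` {..<N}) \<union> (beta la ` {..<N} - {?b}))"
    by (rule prod.union_disjoint[symmetric]) auto
  also have "({- int N..<int M} - beta la ` {..<N}) \<union> (beta la ` {..<N} - {?b}) = {?b<..<int M} \<union> {- int N..<?b}"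
    using sub i bi by force
  also have "prod ?g ({?b<..<int M} \<union> {- int N..<?b}) = prod ?g {?b<..<int M} * prod ?g {- int N..<?b}"
    by (rule prod.union_disjoint) auto
  also have "prod ?g {?b<..<int M} = qfact q (nat (int M - 1 - ?b))"
    unfolding qfact_def
    by (rule prod.reindex_bij_witness[of _ "\<lambda>m. ?b + int m" "\<lambda>k. nat (k - ?b)"]) (auto simp: power_int_def)
  also have "prod ?g {- int N..<?b} = (\<Prod>m=1..nat (int N + ?b). 1 - q powi (- int m))"
    by (rule prod.reindex_bij_witness[of _ "\<lambda>m. ?b - int m" "\<lambda>k. nat (?b - k)"]) auto
  finally show ?thesis using 1 2 by simp
qed

lemma prod_off_diagonal:
  fixes f :: "nat \<Rightarrow> nat \<Rightarrow> 'a::comm_monoid_mult"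
  shows "(\<Prod>i<N. \<Prod>j\<in>{..<N} - {i}. f i j) = (\<Prod>j<N. \<Prod>i<j. f i j * f j i)"
proof (induction N)
  case (Suc N)
  have "(\<Prod>i<Suc N. \<Prod>j\<in>{..<Suc N} - {i}. f i j)
      = (\<Prod>i<N. \<Prod>j\<in>{..<Suc N} - {i}. f i j) * (\<Prod>j\<in>{..<Suc N} - {N}. f N j)" by simp
  also have "{..<Suc N} - {N} = {..<N}" by auto
  also have "(\<Prod>i<N. \<Prod>j\<in>{..<Suc N} - {i}. f i j) = (\<Prod>i<N. f i N * (\<Prod>j\<in>{..<N} - {i}. f i j))"
  proof (rule prod.cong)
    fix i assume "i \<in> {..<N}"
    then have "{..<Suc N} - {i} = insert N ({..<N} - {i})" by auto
    then show "(\<Prod>j\<in>{..<Suc N} - {i}. f i j) = f i N * (\<Prod>j\<in>{..<N} - {i}. f i j)" by simp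
  qed simp
  finally show ?case using Suc by (simp add: prod.distrib mult_ac)
qed simp

lemma sum_triangular: "2 * (\<Sum>{1..n}) = n * (n + 1 :: nat)"
  by (induction n) auto

text \<open>The product of \<open>row_product_truncated\<close> over all rows. Writing y_i for
  q^(beta_i), the identity 1 - y_j / y_i = (y_i - y_j) / y_i makes the off-diagonal factors a
  squared Vandermonde product, up to a sign and a monomial.\<close>

lemma double_product_truncated:
  assumes q: "q \<noteq> 0" and N: "plen la \<le> N" "part la 1 \<le> M"
  defines "n \<equiv> \<lambda>i. nat (int N + beta la i)"
  shows "(\<Prod>i<N. \<Prod>j<M. hook_factor q la i j)
      * (inverse (\<Prod>i<N. q powi beta la i) ^ (N - 1) * ((\<Prod>j<N. \<Prod>i<j. - 1) * (beta_vandermonde N q la)\<^sup>2))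
    = (\<Prod>i<N. qfact q (nat (int M - 1 - beta la i)))
      * ((-1) ^ (\<Sum>i<N. n i) * inverse q ^ (\<Sum>i<N. \<Sum>{1..n i}) * (\<Prod>i<N. qfact q (n i)))"
proof -
  let ?y = "\<lambda>i. q powi beta la i"
  have "(\<Prod>i<N. \<Prod>j\<in>{..<N} - {i}. 1 - q powi (beta la j - beta la i))
      = (\<Prod>i<N. \<Prod>j\<in>{..<N} - {i}. inverse (?y i) * (?y i - ?y j))"
    using q by (intro prod.cong refl) (simp add: power_int_diff field_simps)
  also have "\<dots> = (\<Prod>i<N. inverse (?y i) ^ (N - 1) * (\<Prod>j\<in>{..<N} - {i}. ?y i - ?y j))"
    by (rule prod.cong) (auto simp: prod.distrib)
  also have "\<dots> = inverse (\<Prod>i<N. ?y i) ^ (N - 1) * (\<Prod>i<N. \<Prod>j\<in>{..<N} - {i}. ?y i - ?y j)"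
    by (simp only: prod.distrib prod_power_distrib[symmetric] prod_inversef[symmetric] o_def)
  also have "(\<Prod>i<N. \<Prod>j\<in>{..<N} - {i}. ?y i - ?y j) = (\<Prod>j<N. \<Prod>i<j. (?y i - ?y j) * (?y j - ?y i))"
    by (rule prod_off_diagonal)
  also have "\<dots> = (\<Prod>j<N. \<Prod>i<j. - 1 * (?y j - ?y i)\<^sup>2)"
    by (intro prod.cong refl) (simp add: power2_eq_square algebra_simps)
  also have "\<dots> = (\<Prod>j<N. \<Prod>i<j. - 1) * (beta_vandermonde N q la)\<^sup>2"
    by (simp only: prod.distrib beta_vandermonde_def prod_power_distrib)
  finally have D: "(\<Prod>i<N. \<Prod>j\<in>{..<N} - {i}. 1 - q powi (beta la j - beta la i))
    = inverse (\<Prod>i<N. ?y i) ^ (N - 1) * ((\<Prod>j<N. \<Prod>i<j. - 1) * (beta_vandermonde N q la)\<^sup>2)" .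
  have "(\<Prod>i<N. \<Prod>j<M. hook_factor q la i j) * (\<Prod>i<N. \<Prod>j\<in>{..<N} - {i}. 1 - q powi (beta la j - beta la i))
    = (\<Prod>i<N. qfact q (nat (int M - 1 - beta la i)) * ((-1) ^ n i * inverse q ^ (\<Sum>{1..n i}) * qfact q (n i)))"
    unfolding prod.distrib[symmetric]
    by (rule prod.cong) (simp_all only: n_def row_product_truncated[OF N] lessThan_iff qfact_inverse[OF q])
  also have "\<dots> = (\<Prod>i<N. qfact q (nat (int M - 1 - beta la i)))
      * ((-1) ^ (\<Sum>i<N. n i) * inverse q ^ (\<Sum>i<N. \<Sum>{1..n i}) * (\<Prod>i<N. qfact q (n i)))"
    by (simp only: prod.distrib power_sum)
  finally show ?thesis unfolding D .
qed

text \<open>These sums of triangular numbers are the exponents of q produced by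
  \<open>qfact_inverse\<close>. Expanded in the parts of \<open>la\<close>, they exceed those of the
  empty partition by a term linear in N and half of \<open>kappa\<close>.\<close>

lemma half_kappa_shift:
  assumes "plen la \<le> N"
  shows "int (\<Sum>i<N. \<Sum>{1..nat (int N + beta la i)})
    = int (\<Sum>i<N. \<Sum>{1..nat (int N + beta empty_part i)}) + (int N * int (psize la) + kappa la div 2)"
proof -
  have tri: "2 * int (\<Sum>{1..nat k}) = k * (k + 1)" if "0 \<le> k" for k
    using sum_triangular[of "nat k"] that by (metis int_nat_eq of_nat_1 of_nat_add of_nat_mult of_nat_numeral)
  have nn: "0 \<le> int N + beta \<mu> i" if "i < N" for \<mu> i using that by (simp add: beta_def)
  have "2 * int (\<Sum>i<N. \<Sum>{1..nat (int N + beta \<mu> i)}) = (\<Sum>i<N. (int N + beta \<mu> i) * (int N + beta \<mu> i + 1))" for \<mu>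
    unfolding of_nat_sum[of _ "{..<N}"] sum_distrib_left
    by (rule sum.cong) (use nn in \<open>simp_all only: tri lessThan_iff\<close>)
  note two = this
  have "(\<Sum>i<N. (int N + beta la i) * (int N + beta la i + 1))
    = (\<Sum>i<N. (int N + beta empty_part i) * (int N + beta empty_part i + 1)
        + (2 * int N * int (part la (Suc i)) + int (part la (Suc i)) * (int (part la (Suc i)) - 2 * int (Suc i) + 1)))"
    by (rule sum.cong) (auto simp: beta_def algebra_simps)
  also have "\<dots> = (\<Sum>i<N. (int N + beta empty_part i) * (int N + beta empty_part i + 1))
      + (2 * int N * (\<Sum>i<N. int (part la (Suc i)))
        + (\<Sum>i<N. int (part la (Suc i)) * (int (part la (Suc i)) - 2 * int (Suc i) + 1)))"
    by (simp only: sum.distrib sum_distrib_left)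
  also have "(\<Sum>i<N. int (part la (Suc i))) = int (psize la)"
    using psize_diff[of empty_part la N] assms by (simp add: of_nat_sum[symmetric] del: of_nat_sum)
  also have "(\<Sum>i<N. int (part la (Suc i)) * (int (part la (Suc i)) - 2 * int (Suc i) + 1)) = kappa la"
    unfolding kappa_eq[OF assms] by (rule sum.reindex_bij_witness[of _ "\<lambda>i. i - 1" Suc]) auto
  finally have "2 * int (\<Sum>i<N. \<Sum>{1..nat (int N + beta la i)})
    = 2 * int (\<Sum>i<N. \<Sum>{1..nat (int N + beta empty_part i)}) + (2 * (int N * int (psize la)) + kappa la)"
    unfolding two by simp
  moreover have "kappa la = 2 * (kappa la div 2)" using even_kappa[of la] by simp
  ultimately show ?thesis by linarith
qed

text \<open>The identity \<open>double_product_truncated\<close> for \<open>la\<close> is divided by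
  the one for the empty partition. The signs of the squared Vandermonde products and the powers of q
  that grow with N cancel.\<close>

lemma double_product_ratio:
  assumes q: "q \<noteq> 0" "norm q < 1" and N: "plen la \<le> N" "part la 1 \<le> M" "1 \<le> N"
  shows "(beta_vandermonde N q la / beta_vandermonde N q empty_part)\<^sup>2 * q ^ psize la
      * (\<Prod>i<N. \<Prod>j<M. hook_factor q la i j)
    = (\<Prod>i<N. \<Prod>j<M. hook_factor q empty_part i j)
      * ((-1) ^ psize la * q powi (- (kappa la div 2)))
      * (\<Prod>i<N. qfact q (nat (int M - 1 - beta la i)) / qfact q (nat (int M - 1 - beta empty_part i)))
      * (\<Prod>i<N. qfact q (nat (int N + beta la i)) / qfact q (nat (int N + beta empty_part i)))"
proof -
  define T V S where "T \<mu> = (\<Prod>i<N. \<Prod>j<M. hook_factor q \<mu> i j)"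
    and "V \<mu> = beta_vandermonde N q \<mu>" and "S = (\<Prod>j<N. \<Prod>i<j::nat. - 1 :: complex)" for \<mu>
  define A B where "A \<mu> = (\<Prod>i<N. qfact q (nat (int M - 1 - beta \<mu> i)))"
    and "B \<mu> = (\<Prod>i<N. qfact q (nat (int N + beta \<mu> i)))" for \<mu>
  define Y where "Y = inverse (\<Prod>i<N. q powi beta empty_part i) ^ (N - 1)"
  define n where "n \<mu> = (\<Sum>i<N. nat (int N + beta \<mu> i))" for \<mu>
  define m where "m \<mu> = (\<Sum>i<N. \<Sum>{1..nat (int N + beta \<mu> i)})" for \<mu>
  note qf = qfact_nonzero[OF q(2)]
  have nz: "A empty_part \<noteq> 0" "B empty_part \<noteq> 0" "S \<noteq> 0" "V empty_part \<noteq> 0" "Y \<noteq> 0"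
    using qf q beta_vandermonde_nonzero[OF q] by (auto simp: A_def B_def S_def V_def Y_def)
  have e: "T \<mu> * (inverse (\<Prod>i<N. q powi beta \<mu> i) ^ (N - 1) * (S * (V \<mu>)\<^sup>2))
      = A \<mu> * ((-1) ^ n \<mu> * inverse q ^ m \<mu> * B \<mu>)" if "plen \<mu> \<le> N" "part \<mu> 1 \<le> M" for \<mu>
    unfolding T_def S_def V_def A_def B_def n_def m_def
    by (rule double_product_truncated[OF q(1) that])
  have Yla: "inverse (\<Prod>i<N. q powi beta la i) ^ (N - 1) = inverse q ^ (psize la * (N - 1)) * Y"
    unfolding prod_powi_beta[OF q(1) N(1)] Y_def by (simp add: power_mult_distrib power_mult power_inverse)
  have nla: "n la = n empty_part + psize la"
  proof -
    have "n la = (\<Sum>i<N. nat (int N + beta empty_part i) + part la (Suc i))"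
      unfolding n_def by (rule sum.cong) (auto simp: beta_def nat_add_distrib[symmetric])
    then show ?thesis using psize_diff[of empty_part la N] N(1) by (simp add: sum.distrib n_def)
  qed
  have mla: "inverse q ^ m la = inverse q ^ m empty_part * q powi (- (int N * int (psize la) + kappa la div 2))"
  proof -
    have "inverse q ^ m \<mu> = q powi (- int (m \<mu>))" for \<mu> by (simp add: power_int_minus power_inverse)
    moreover have "int (m la) = int (m empty_part) + (int N * int (psize la) + kappa la div 2)"
      unfolding m_def by (rule half_kappa_shift[OF N(1)])
    ultimately show ?thesis using q by (simp add: power_int_add[symmetric])
  qed
  have sh: "q ^ psize la * q powi (- (int N * int (psize la) + kappa la div 2))
      = inverse q ^ (psize la * (N - 1)) * q powi (- (kappa la div 2))"
  proof -
    have "inverse q ^ k = q powi (- int k)" for k by (simp add: power_int_minus power_inverse)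
    then have "inverse q ^ (psize la * (N - 1)) = q powi (- int (psize la * (N - 1)))" .
    moreover have "q ^ psize la = q powi int (psize la)" by simp
    moreover have "int (psize la) + - (int N * int (psize la) + kappa la div 2)
        = - int (psize la * (N - 1)) + - (kappa la div 2)"
      using N(3) by (simp add: of_nat_diff algebra_simps)
    ultimately show ?thesis using q by (metis power_int_add)
  qed
  have e0: "T empty_part * (Y * (S * (V empty_part)\<^sup>2))
      = A empty_part * ((-1) ^ n empty_part * inverse q ^ m empty_part * B empty_part)"
    using e[of empty_part] by (simp add: Y_def)
  have e1: "T la * (inverse q ^ (psize la * (N - 1)) * Y * (S * (V la)\<^sup>2))
      = A la * ((-1) ^ (n empty_part + psize la) * (inverse q ^ m empty_part
          * q powi (- (int N * int (psize la) + kappa la div 2))) * B la)"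
    using e[OF N(1,2)] unfolding Yla nla mla .
  define Z where "Z = inverse q ^ (psize la * (N - 1))"
  define K where "K = q powi (- (kappa la div 2))"
  define X where "X = q powi (- (int N * int (psize la) + kappa la div 2))"
  define C where "C = (-1) ^ n empty_part * inverse q ^ m empty_part"
  have nz': "Z \<noteq> 0" "C \<noteq> 0" using q by (auto simp: Z_def C_def)
  have sh': "q ^ psize la * X = Z * K" using sh by (simp add: X_def Z_def K_def)
  have e0': "C = T empty_part * (Y * (S * (V empty_part)\<^sup>2)) / (A empty_part * B empty_part)"
    using e0 nz by (simp add: C_def field_simps)
  have "Z * Y * S * (T la * (V la)\<^sup>2 * q ^ psize la) = A la * ((-1) ^ psize la * C * (q ^ psize la * X) * B la)"
    using e1 unfolding Z_def[symmetric] X_def[symmetric] C_def by (simp add: power_add mult_ac)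
  also have "\<dots> = Z * Y * S * (T empty_part * (V empty_part)\<^sup>2 * ((-1) ^ psize la * K) * (A la / A empty_part) * (B la / B empty_part))"
    unfolding sh' e0' by (simp add: mult_ac)
  finally have eq: "Z * Y * S * (T la * (V la)\<^sup>2 * q ^ psize la)
      = Z * Y * S * (T empty_part * (V empty_part)\<^sup>2 * ((-1) ^ psize la * K) * (A la / A empty_part) * (B la / B empty_part))" .
  have ne: "Z * Y * S \<noteq> 0" using nz nz' by simp
  have "T la * (V la)\<^sup>2 * q ^ psize la
      = T empty_part * (V empty_part)\<^sup>2 * ((-1) ^ psize la * K) * (A la / A empty_part) * (B la / B empty_part)"
    using eq unfolding mult_cancel_left using ne by blast
  then have "(V la / V empty_part)\<^sup>2 * q ^ psize la * T la
      = T empty_part * ((-1) ^ psize la * K) * (A la / A empty_part) * (B la / B empty_part)"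
    using nz by (simp add: power_divide field_simps)
  then show ?thesis
    by (simp only: T_def V_def K_def A_def B_def prod_dividef)
qed

lemma qfact_tendsto:
  assumes "norm q < 1"
  obtains L where "L \<noteq> 0" "qfact q \<longlonglongrightarrow> L"
proof -
  let ?f = "\<lambda>m. - (q ^ Suc m)"
  have "summable (\<lambda>m. norm (?f m))"
    using assms by (simp add: norm_mult norm_power summable_mult summable_geometric)
  then have conv: "convergent_prod (\<lambda>m. 1 + ?f m)" by (rule norm_prodinf_minus_1_le(1))
  have nz: "1 + ?f m \<noteq> 0" for m
  proof
    assume "1 + ?f m = 0"
    then have "norm q ^ Suc m = 1" by (metis eq_iff_diff_eq_0 norm_one norm_power diff_conv_add_uminus)
    moreover have "norm q ^ Suc m < 1" using assms by (subst power_less_one_iff) auto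
    ultimately show False by simp
  qed
  have "(\<lambda>n. \<Prod>m<n. 1 + ?f m) \<longlonglongrightarrow> (\<Prod>m. 1 + ?f m)"
    using convergent_prod_LIMSEQ[OF conv] LIMSEQ_lessThan_iff_atMost by blast
  moreover have "(\<lambda>n. \<Prod>m<n. 1 + ?f m) = qfact q"
    unfolding qfact_def by (intro ext prod.reindex_bij_witness[of _ "\<lambda>m. m - 1" Suc]) auto
  ultimately show ?thesis using that[OF prodinf_nonzero[OF conv nz]] by simp
qed

text \<open>A shift of the argument does not change the limit of the q-factorials, which is
  nonzero.\<close>

lemma qfact_ratio_tendsto:
  assumes "norm q < 1"
  shows "(\<lambda>N. qfact q (nat (int N + a)) / qfact q (nat (int N + b))) \<longlonglongrightarrow> 1"
proof -
  obtain L where L: "L \<noteq> 0" "qfact q \<longlonglongrightarrow> L" using qfact_tendsto[OF assms] .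
  have "filterlim (\<lambda>N. nat (int N + a)) sequentially sequentially" for a
    unfolding filterlim_at_top
  proof
    fix Z show "eventually (\<lambda>N. Z \<le> nat (int N + a)) sequentially"
      by (rule eventually_sequentiallyI[of "Z + nat \<bar>a\<bar>"]) linarith
  qed
  then have "(\<lambda>N. qfact q (nat (int N + a))) \<longlonglongrightarrow> L" for a
    by (rule filterlim_compose[OF L(2)])
  then have "(\<lambda>N. qfact q (nat (int N + a)) / qfact q (nat (int N + b))) \<longlonglongrightarrow> L / L"
    using L(1) by (intro tendsto_divide)
  then show ?thesis using L(1) by simp
qed

text \<open>Rows beyond the length of \<open>la\<close> contribute 1. The number of factors thus
  does not grow with N, and limits can be taken factor by factor.\<close>

lemma ratio_product_restrict:
  fixes g :: "int \<Rightarrow> complex"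
  assumes "\<And>i. g (beta empty_part i) \<noteq> 0" "plen la \<le> N"
  shows "(\<Prod>i<N. g (beta la i) / g (beta empty_part i)) = (\<Prod>i<plen la. g (beta la i) / g (beta empty_part i))"
proof (rule prod.mono_neutral_right)
  show "\<forall>i\<in>{..<N} - {..<plen la}. g (beta la i) / g (beta empty_part i) = 1"
  proof
    fix i assume "i \<in> {..<N} - {..<plen la}"
    then have "beta la i = beta empty_part i" by (simp add: beta_def part_eq_0)
    then show "g (beta la i) / g (beta empty_part i) = 1" using assms(1) by simp
  qed
qed (use assms in auto)

text \<open>The double product converges for either order of the two limits, which gives the value at
  \<open>la\<close> and at its conjugate.\<close>

theorem norm_prod_schur:
  assumes t: "t \<noteq> 0" "norm t < 1"
  defines "q \<equiv> t\<^sup>2"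
  shows "norm_prod la q = (-1) ^ psize la * q powi (kappa la div 2) * (schur la (q_vars t empty_part))\<^sup>2 * norm_prod empty_part q"
    and "norm_prod (conj_part la) q = norm_prod la q"
proof -
  have q: "q \<noteq> 0" "norm q < 1" using t by (auto simp: q_def norm_power power_less_one_iff)
  define s where "s N = (beta_vandermonde N q la / beta_vandermonde N q empty_part)\<^sup>2 * q ^ psize la" for N
  define c where "c = (-1) ^ psize la * q powi (- (kappa la div 2))"
  define A where "A M = (\<Prod>i<plen la. qfact q (nat (int M + (- 1 - beta la i))) / qfact q (nat (int M + (- 1 - beta empty_part i))))" for M
  define B where "B N = (\<Prod>i<plen la. qfact q (nat (int N + beta la i)) / qfact q (nat (int N + beta empty_part i)))" for N
  let ?s = "schur la (q_vars t empty_part)"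
  let ?T = "\<lambda>\<mu> N M. \<Prod>i<N. \<Prod>j<M. hook_factor q \<mu> i j"
  have A: "A \<longlonglongrightarrow> 1"
  proof -
    have "A \<longlonglongrightarrow> (\<Prod>i<plen la. 1)" unfolding A_def by (intro tendsto_prod qfact_ratio_tendsto q)
    then show ?thesis by simp
  qed
  have B: "B \<longlonglongrightarrow> 1"
  proof -
    have "B \<longlonglongrightarrow> (\<Prod>i<plen la. 1)" unfolding B_def by (intro tendsto_prod qfact_ratio_tendsto q)
    then show ?thesis by simp
  qed
  have s: "s \<longlonglongrightarrow> ?s\<^sup>2"
  proof -
    have "(\<lambda>N. (t ^ psize la * beta_vandermonde N q la / beta_vandermonde N q empty_part)\<^sup>2) \<longlonglongrightarrow> ?s\<^sup>2"
      unfolding q_def by (intro tendsto_power schur_principal_tendsto t)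
    moreover have "(t ^ psize la * beta_vandermonde N q la / beta_vandermonde N q empty_part)\<^sup>2 = s N" for N
      by (simp add: s_def q_def power_mult_distrib power_divide power_mult[symmetric] mult.commute)
    ultimately show ?thesis by simp
  qed
  have eq: "s N * ?T la N M = ?T empty_part N M * c * A M * B N"
    if "max 1 (plen la) \<le> N" "part la 1 \<le> M" for N M
  proof -
    have N: "plen la \<le> N" "1 \<le> N" using that by auto
    have "(\<Prod>i<N. qfact q (nat (int M - 1 - beta la i)) / qfact q (nat (int M - 1 - beta empty_part i))) = A M"
      unfolding A_def using ratio_product_restrict[of "\<lambda>b. qfact q (nat (int M - 1 - b))" la N] qfact_nonzero[OF q(2)] N
      by (simp add: algebra_simps)
    moreover have "(\<Prod>i<N. qfact q (nat (int N + beta la i)) / qfact q (nat (int N + beta empty_part i))) = B N"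
      unfolding B_def using ratio_product_restrict[of "\<lambda>b. qfact q (nat (int N + b))" la N] qfact_nonzero[OF q(2)] N
      by simp
    ultimately show ?thesis
      using double_product_ratio[OF q N(1) that(2) N(2)] by (simp only: s_def c_def)
  qed
  have limM: "(\<lambda>M. ?T \<mu> N M) \<longlonglongrightarrow> (\<Prod>i<N. row_product q \<mu> i)" for \<mu> N
    by (intro tendsto_prod row_product_tendsto q)
  have limN: "(\<lambda>N. ?T \<mu> N M) \<longlonglongrightarrow> (\<Prod>j<M. row_product q (conj_part \<mu>) j)" for \<mu> M
  proof -
    have "?T \<mu> N M = (\<Prod>j<M. \<Prod>i<N. hook_factor q (conj_part \<mu>) j i)" for N
      by (subst prod.swap) (simp add: hook_factor_conj)
    then show ?thesis by (simp only:) (intro tendsto_prod row_product_tendsto q)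
  qed
  have 1: "s N * (\<Prod>i<N. row_product q la i) = (\<Prod>i<N. row_product q empty_part i) * c * B N"
    if N: "max 1 (plen la) \<le> N" for N
  proof (rule LIMSEQ_unique)
    show "(\<lambda>M. s N * ?T la N M) \<longlonglongrightarrow> s N * (\<Prod>i<N. row_product q la i)"
      by (intro tendsto_intros limM)
    have "(\<lambda>M. ?T empty_part N M * c * A M * B N) \<longlonglongrightarrow> (\<Prod>i<N. row_product q empty_part i) * c * 1 * B N"
      by (intro tendsto_mult limM tendsto_const A)
    then have "(\<lambda>M. ?T empty_part N M * c * A M * B N) \<longlonglongrightarrow> (\<Prod>i<N. row_product q empty_part i) * c * B N" by simp
    then show "(\<lambda>M. s N * ?T la N M) \<longlonglongrightarrow> (\<Prod>i<N. row_product q empty_part i) * c * B N"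
      by (rule Lim_transform_eventually)
        (rule eventually_sequentiallyI[of "part la 1"], rule eq[OF N, symmetric])
  qed
  have 2: "?s\<^sup>2 * (\<Prod>j<M. row_product q (conj_part la) j) = (\<Prod>j<M. row_product q empty_part j) * c * A M"
    if M: "part la 1 \<le> M" for M
  proof (rule LIMSEQ_unique)
    show "(\<lambda>N. s N * ?T la N M) \<longlonglongrightarrow> ?s\<^sup>2 * (\<Prod>j<M. row_product q (conj_part la) j)"
      by (intro tendsto_mult s limN)
    have "(\<lambda>N. ?T empty_part N M * c * A M * B N) \<longlonglongrightarrow> (\<Prod>j<M. row_product q (conj_part empty_part) j) * c * A M * 1"
      by (intro tendsto_mult limN tendsto_const B)
    then have "(\<lambda>N. ?T empty_part N M * c * A M * B N) \<longlonglongrightarrow> (\<Prod>j<M. row_product q empty_part j) * c * A M" by simp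
    then show "(\<lambda>N. s N * ?T la N M) \<longlonglongrightarrow> (\<Prod>j<M. row_product q empty_part j) * c * A M"
      by (rule Lim_transform_eventually)
        (rule eventually_sequentiallyI[of "max 1 (plen la)"], rule eq[OF _ M, symmetric])
  qed
  have P1: "?s\<^sup>2 * (\<Prod>i. row_product q la i) = (\<Prod>i. row_product q empty_part i) * c"
  proof (rule LIMSEQ_unique)
    show "(\<lambda>N. s N * (\<Prod>i<N. row_product q la i)) \<longlonglongrightarrow> ?s\<^sup>2 * (\<Prod>i. row_product q la i)"
      by (intro tendsto_mult s row_products_tendsto q)
    have "(\<lambda>N. (\<Prod>i<N. row_product q empty_part i) * c * B N) \<longlonglongrightarrow> (\<Prod>i. row_product q empty_part i) * c * 1"
      by (intro tendsto_mult tendsto_const row_products_tendsto q B)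
    then have "(\<lambda>N. (\<Prod>i<N. row_product q empty_part i) * c * B N) \<longlonglongrightarrow> (\<Prod>i. row_product q empty_part i) * c" by simp
    then show "(\<lambda>N. s N * (\<Prod>i<N. row_product q la i)) \<longlonglongrightarrow> (\<Prod>i. row_product q empty_part i) * c"
      by (rule Lim_transform_eventually)
        (rule eventually_sequentiallyI[of "max 1 (plen la)"], rule 1[symmetric])
  qed
  have P2: "?s\<^sup>2 * (\<Prod>i. row_product q (conj_part la) i) = (\<Prod>i. row_product q empty_part i) * c"
  proof (rule LIMSEQ_unique)
    show "(\<lambda>M. ?s\<^sup>2 * (\<Prod>i<M. row_product q (conj_part la) i)) \<longlonglongrightarrow> ?s\<^sup>2 * (\<Prod>i. row_product q (conj_part la) i)"
      by (intro tendsto_mult tendsto_const row_products_tendsto q)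
    have "(\<lambda>M. (\<Prod>i<M. row_product q empty_part i) * c * A M) \<longlonglongrightarrow> (\<Prod>i. row_product q empty_part i) * c * 1"
      by (intro tendsto_mult tendsto_const row_products_tendsto q A)
    then have "(\<lambda>M. (\<Prod>i<M. row_product q empty_part i) * c * A M) \<longlonglongrightarrow> (\<Prod>i. row_product q empty_part i) * c" by simp
    then show "(\<lambda>M. ?s\<^sup>2 * (\<Prod>i<M. row_product q (conj_part la) i)) \<longlonglongrightarrow> (\<Prod>i. row_product q empty_part i) * c"
      by (rule Lim_transform_eventually)
        (rule eventually_sequentiallyI[of "part la 1"], rule 2[symmetric])
  qed
  have nz: "(\<Prod>i. row_product q \<mu> i) \<noteq> 0" for \<mu> by (rule row_products_nonzero[OF q])
  have c: "c \<noteq> 0" "inverse c = (-1) ^ psize la * q powi (kappa la div 2)"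
    using q by (auto simp: c_def power_int_minus power_inverse[symmetric])
  have s0: "?s\<^sup>2 \<noteq> 0" using P1 nz[of empty_part] c by auto
  have "inverse (\<Prod>i. row_product q la i) = inverse c * ?s\<^sup>2 * inverse (\<Prod>i. row_product q empty_part i)"
    using P1 nz[of la] nz[of empty_part] c(1) by (simp add: field_simps)
  then show "norm_prod la q = (-1) ^ psize la * q powi (kappa la div 2) * ?s\<^sup>2 * norm_prod empty_part q"
    by (simp only: norm_prod_eq[OF q] c(2))
  have "(\<Prod>i. row_product q (conj_part la) i) = (\<Prod>i. row_product q la i)"
    using P1 P2 s0 by (metis mult_left_cancel)
  then show "norm_prod (conj_part la) q = norm_prod la q" by (simp only: norm_prod_eq[OF q])
qed

section \<open>Holomorphic infinite products and square roots on the disc\<close>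

lemma holomorphic_prodinf:
  fixes f :: "nat \<Rightarrow> complex \<Rightarrow> complex"
  assumes hol: "\<And>n. f n holomorphic_on ball 0 1"
    and bound: "\<And>r. 0 < r \<Longrightarrow> r < 1 \<Longrightarrow> \<exists>M. summable M \<and> (\<forall>n z. norm z \<le> r \<longrightarrow> norm (f n z - 1) \<le> M n)"
  shows "(\<lambda>z. \<Prod>n. f n z) holomorphic_on ball 0 1"
proof (rule holomorphic_uniform_sequence)
  show "(\<lambda>z. \<Prod>n<N. f n z) holomorphic_on ball 0 1" for N
    by (intro holomorphic_intros hol)
  fix z :: complex assume z: "z \<in> ball 0 1"
  \<comment> \<open>The radius \<open>r\<close> lies half way between |z| and 1, and the closed disc
    of radius \<open>d\<close> around \<open>z\<close> stays within norm \<open>r\<close>, where the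
    majorants apply.\<close>
  define d where "d = (1 - norm z) / 2"
  define r where "r = (1 + norm z) / 2"
  have d: "0 < d" and r: "0 < r" "r < 1" using z by (simp_all add: d_def r_def add_pos_nonneg)
  have sub: "norm x \<le> r" if "x \<in> cball z d" for x
  proof -
    have "norm x \<le> norm z + norm (x - z)" by (rule norm_triangle_sub)
    also have "\<dots> \<le> norm z + d" using that by (simp add: dist_norm norm_minus_commute)
    also have "\<dots> = r" by (simp add: d_def r_def field_simps)
    finally show ?thesis .
  qed
  then have ball: "cball z d \<subseteq> ball 0 1" using r by fastforce
  obtain M where M: "summable M" "\<And>n x. norm x \<le> r \<Longrightarrow> norm (f n x - 1) \<le> M n"
    using bound[OF r] by blast
  have "uniformly_convergent_on (cball z d) (\<lambda>N x. \<Sum>n<N. norm (f n x - 1))"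
  proof (rule Weierstrass_m_test')
    show "norm (norm (f n x - 1)) \<le> M n" if "x \<in> cball z d" for n x
      using M(2)[OF sub[OF that]] by simp
  qed (rule M)
  then have "uniformly_convergent_on (cball z d) (\<lambda>N x. \<Prod>n<N. f n x)"
    using hol ball
    by (intro uniformly_convergent_on_prod') (auto intro: holomorphic_on_imp_continuous_on holomorphic_on_subset)
  then have ul: "uniform_limit (cball z d) (\<lambda>N x. \<Prod>n<N. f n x) (\<lambda>x. lim (\<lambda>N. \<Prod>n<N. f n x)) sequentially"
    by (simp add: uniformly_convergent_uniform_limit_iff)
  have lim_eq: "lim (\<lambda>N. \<Prod>n<N. f n x) = (\<Prod>n. f n x)" if "x \<in> cball z d" for x
  proof -
    have "summable (\<lambda>n. norm (f n x - 1))"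
      by (rule summable_comparison_test'[OF M(1), of 0]) (use M(2)[OF sub[OF that]] in simp)
    then have "convergent_prod (\<lambda>n. f n x)"
      by (intro abs_convergent_prod_imp_convergent_prod) (simp add: abs_convergent_prod_conv_summable)
    then have "(\<lambda>N. \<Prod>n<N. f n x) \<longlonglongrightarrow> (\<Prod>n. f n x)"
      using convergent_prod_LIMSEQ LIMSEQ_lessThan_iff_atMost by blast
    then show ?thesis by (rule limI)
  qed
  have "uniform_limit (cball z d) (\<lambda>N x. \<Prod>n<N. f n x) (\<lambda>x. lim (\<lambda>N. \<Prod>n<N. f n x)) sequentially
      \<longleftrightarrow> uniform_limit (cball z d) (\<lambda>N x. \<Prod>n<N. f n x) (\<lambda>x. \<Prod>n. f n x) sequentially"
    by (rule uniform_limit_cong') (rule refl, erule lim_eq)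
  then have "uniform_limit (cball z d) (\<lambda>N x. \<Prod>n<N. f n x) (\<lambda>x. \<Prod>n. f n x) sequentially"
    using ul by (rule iffD1)
  then show "\<exists>d>0. cball z d \<subseteq> ball 0 1 \<and> uniform_limit (cball z d) (\<lambda>N x. \<Prod>n<N. f n x) (\<lambda>x. \<Prod>n. f n x) sequentially"
    using d ball by blast
qed simp

text \<open>Collecting the factors with i + j + 1 = n gives the product of (1 - z^n)^n, the
  reciprocal of the MacMahon function. With natural exponents it is also meaningful at the
  origin.\<close>

definition macmahon_product :: "complex \<Rightarrow> complex" where
  "macmahon_product z = (\<Prod>i. \<Prod>j. 1 - z ^ (i + j + 1))"

lemma macmahon_bound:
  fixes z :: complex
  assumes "norm z \<le> r" "r < 1"
  shows "norm (- (z ^ (i + j + 1))) \<le> 1 * r ^ (i + j)"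
proof -
  have r: "0 \<le> r" using assms(1) norm_ge_zero[of z] by linarith
  have "norm z ^ (i + j + 1) \<le> r ^ (i + j + 1)" by (rule power_mono) (use assms in auto)
  also have "\<dots> \<le> r ^ (i + j)" by (rule power_decreasing) (use assms r in auto)
  finally show ?thesis by (simp add: norm_power norm_mult)
qed

lemma macmahon_row_convergent: "norm z < 1 \<Longrightarrow> convergent_prod (\<lambda>j. 1 - z ^ (i + j + 1))" for z :: complex
  using double_product_bound(1)[of "\<lambda>i j. - (z ^ (i + j + 1))" 1 "norm z" i] macmahon_bound[OF order_refl, of z]
  by simp

lemma macmahon_convergent: "norm z < 1 \<Longrightarrow> convergent_prod (\<lambda>i. \<Prod>j. 1 - z ^ (i + j + 1))" for z :: complex
  using double_product_bound(3)[of "\<lambda>i j. - (z ^ (i + j + 1))" 1 "norm z"] macmahon_bound[OF order_refl, of z]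
  by simp

lemma macmahon_factor_nonzero: "norm z < 1 \<Longrightarrow> 1 - z ^ (i + j + 1) \<noteq> 0" for z :: complex
proof
  assume z: "norm z < 1" and "1 - z ^ (i + j + 1) = 0"
  then have "z ^ (i + j + 1) = 1" by simp
  then have "norm z ^ (i + j + 1) = 1" by (metis norm_one norm_power)
  moreover have "norm z ^ (i + j + 1) < 1" using z by (subst power_less_one_iff) auto
  ultimately show False by simp
qed

lemma macmahon_row_nonzero: "norm z < 1 \<Longrightarrow> (\<Prod>j. 1 - z ^ (i + j + 1)) \<noteq> 0" for z :: complex
  by (rule prodinf_nonzero[OF macmahon_row_convergent macmahon_factor_nonzero])

lemma macmahon_nonzero: "norm z < 1 \<Longrightarrow> macmahon_product z \<noteq> 0"
  unfolding macmahon_product_def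
  by (rule prodinf_nonzero[OF macmahon_convergent macmahon_row_nonzero])

lemma macmahon_holomorphic: "macmahon_product holomorphic_on ball 0 1"
  unfolding macmahon_product_def[abs_def]
proof (rule holomorphic_prodinf)
  fix i
  show "(\<lambda>z. \<Prod>j. 1 - z ^ (i + j + 1)) holomorphic_on ball 0 1"
  proof (rule holomorphic_prodinf)
    fix r :: real assume r: "0 < r" "r < 1"
    show "\<exists>M. summable M \<and> (\<forall>j z. norm z \<le> r \<longrightarrow> norm (1 - z ^ (i + j + 1) - 1 :: complex) \<le> M j)"
    proof (intro exI conjI allI impI)
      show "summable (\<lambda>j. r ^ i * r ^ j)" using r by (intro summable_mult summable_geometric) auto
      fix j and z :: complex assume "norm z \<le> r"
      moreover have "1 - z ^ (i + j + 1) - 1 = - (z ^ (i + j + 1))" by simp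
      ultimately show "norm (1 - z ^ (i + j + 1) - 1) \<le> r ^ i * r ^ j"
        using macmahon_bound[OF _ r(2), of z i j] by (simp only: power_add mult_1)
    qed
  qed (intro holomorphic_intros)
next
  fix r :: real assume r: "0 < r" "r < 1"
  show "\<exists>M. summable M \<and> (\<forall>i z. norm z \<le> r \<longrightarrow> norm ((\<Prod>j. 1 - z ^ (i + j + 1)) - 1 :: complex) \<le> M i)"
  proof (intro exI conjI allI impI)
    show "summable (\<lambda>i. 1 / (1 - r) * exp (1 / (1 - r)) * r ^ i)"
      using r by (intro summable_mult summable_geometric) auto
    show "norm ((\<Prod>j. 1 - z ^ (i + j + 1)) - 1) \<le> 1 / (1 - r) * exp (1 / (1 - r)) * r ^ i"
      if "norm z \<le> r" for i and z :: complex
      using double_product_bound(2)[of "\<lambda>i j. - (z ^ (i + j + 1))" 1 r i] macmahon_bound[OF that r(2)] r by simp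
  qed
qed

lemma prodinf_nonneg_Reals:
  assumes "convergent_prod f" "\<And>n. f n \<in> \<real>\<^sub>\<ge>\<^sub>0"
  shows "(\<Prod>n. f n) \<in> (\<real>\<^sub>\<ge>\<^sub>0 :: complex set)"
proof (rule closed_sequentially[OF closed_nonneg_Reals_complex])
  show "(\<lambda>N. \<Prod>n\<le>N. f n) \<longlonglongrightarrow> (\<Prod>n. f n)" by (rule convergent_prod_LIMSEQ[OF assms(1)])
  show "(\<Prod>n\<le>N. f n) \<in> \<real>\<^sub>\<ge>\<^sub>0" for N
    by (induction N) (auto intro: nonneg_Reals_mult_I assms(2))
qed

text \<open>All factors are nonnegative reals, hence so is the limit; strict positivity comes from
  \<open>macmahon_nonzero\<close>.\<close>

lemma macmahon_pos:
  assumes "0 < x" "x < 1"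
  shows "\<exists>y. 0 < y \<and> macmahon_product (of_real x) = of_real y"
proof -
  have x: "norm (of_real x :: complex) < 1" using assms by simp
  have "1 - of_real x ^ (i + j + 1) \<in> (\<real>\<^sub>\<ge>\<^sub>0 :: complex set)" for i j
  proof -
    have "x ^ (i + j + 1) \<le> 1" using assms by (intro power_le_one) auto
    then have "of_real (1 - x ^ (i + j + 1)) \<in> (\<real>\<^sub>\<ge>\<^sub>0 :: complex set)" unfolding nonneg_Reals_of_real_iff by simp
    then show ?thesis by simp
  qed
  then have "macmahon_product (of_real x) \<in> \<real>\<^sub>\<ge>\<^sub>0"
    unfolding macmahon_product_def
    by (intro prodinf_nonneg_Reals macmahon_convergent macmahon_row_convergent x)
  then obtain y where "macmahon_product (of_real x) = of_real y" "0 \<le> y"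
    by (auto elim: nonneg_Reals_cases)
  then show ?thesis using macmahon_nonzero[OF x] by (intro exI[of _ y]) (auto simp: less_le)
qed

lemma norm_prod_empty: "norm z < 1 \<Longrightarrow> norm_prod empty_part z = inverse (macmahon_product z)"
proof -
  assume z: "norm z < 1"
  have "z powi (- int (part empty_part (Suc i)) - int (part (conj_part empty_part) (Suc j)) + int (Suc i) + int (Suc j) - 1)
      = z ^ (i + j + 1)" for i j
  proof -
    have "- int (part empty_part (Suc i)) - int (part (conj_part empty_part) (Suc j)) + int (Suc i) + int (Suc j) - 1 = int (i + j + 1)"
      by simp
    then show ?thesis by (simp only: power_int_of_nat)
  qed
  then show ?thesis
    unfolding norm_prod_def macmahon_product_def
    by (simp only: prodinf_inverse[OF macmahon_row_convergent[OF z]] prodinf_inverse[OF macmahon_convergent[OF z]])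
qed

text \<open>The function chosen by \<open>SOME\<close> and \<open>f\<close> have the same square and
  are both positive on ]0, 1[, so they agree there. The interval has limit points inside the disc,
  and the identity theorem extends the equality.\<close>

lemma disc_sqrt_eqI:
  assumes f: "f holomorphic_on ball 0 1" "\<And>z. z \<in> ball 0 1 - {0} \<Longrightarrow> (f z)\<^sup>2 = F z"
    and pos: "\<And>x::real. 0 < x \<Longrightarrow> x < 1 \<Longrightarrow> \<exists>y::real. 0 < y \<and> f (of_real x) = of_real y"
    and z: "z \<in> ball 0 1"
  shows "disc_sqrt F z = f z"
proof -
  let ?P = "\<lambda>f. f holomorphic_on ball 0 1 \<and> (\<forall>z\<in>ball 0 1 - {0}. (f z)\<^sup>2 = F z) \<and>
     (\<forall>x::real. 0 < x \<and> x < 1 \<longrightarrow> (\<exists>y::real. 0 < y \<and> f (of_real x) = of_real y))"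
  have pf: "?P f" using f pos by auto
  have g: "?P (disc_sqrt F)" unfolding disc_sqrt_def by (rule someI[where P = ?P, OF pf])
  let ?g = "disc_sqrt F"
  have eq: "?g (of_real x) - f (of_real x) = 0" if x: "0 < x" "x < 1" for x :: real
  proof -
    obtain a b where a: "0 < a" "f (of_real x) = of_real a" and b: "0 < b" "?g (of_real x) = of_real b"
      using pos[OF x] g x by blast
    have "(of_real x :: complex) \<in> ball 0 1 - {0}" using x by simp
    then have "(f (of_real x))\<^sup>2 = (?g (of_real x))\<^sup>2" using f(2) g by simp
    then have "complex_of_real (a\<^sup>2) = of_real (b\<^sup>2)" unfolding a b by simp
    then have "a\<^sup>2 = b\<^sup>2" by (rule of_real_eq_iff[THEN iffD1])
    then show ?thesis using a b by (simp add: power2_eq_iff_nonneg)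
  qed
  have "?g z - f z = 0"
  proof (rule analytic_continuation[where f = "\<lambda>z. ?g z - f z" and S = "ball 0 1" and U = "of_real ` {0<..<1::real}" and \<xi> = "of_real (1/2)"])
    show "(\<lambda>z. ?g z - f z) holomorphic_on ball 0 1" using g f(1) by (intro holomorphic_intros) auto
    show "complex_of_real (1/2) islimpt of_real ` {0<..<1::real}"
      unfolding islimpt_approachable
    proof (intro allI impI)
      fix e :: real assume e: "0 < e"
      define x where "x = 1/2 + min (e/2) (1/4)"
      have "0 < x" "x < 1" "x \<noteq> 1/2" "\<bar>x - 1/2\<bar> < e" using e by (auto simp: x_def)
      then show "\<exists>x'\<in>of_real ` {0<..<1::real}. x' \<noteq> complex_of_real (1/2) \<and> dist x' (complex_of_real (1/2)) < e"
        by (intro bexI[of _ "of_real x"]) (auto simp: dist_norm simp flip: of_real_diff of_real_divide)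
    qed
  qed (use eq z in auto)
  then show ?thesis by simp
qed

text \<open>The disc is contractible and the product has no zeros, so a holomorphic root exists. On
  ]0, 1[ its square is positive, so it is real and nonzero there and has constant sign by
  connectedness; its sign at 1/2 normalizes it.\<close>

lemma ex_sqrt_norm_prod_empty:
  obtains f where "f holomorphic_on ball 0 1"
    "\<And>z. z \<in> ball 0 1 \<Longrightarrow> (f z)\<^sup>2 = norm_prod empty_part z"
    "\<And>x::real. 0 < x \<Longrightarrow> x < 1 \<Longrightarrow> \<exists>y::real. 0 < y \<and> f (of_real x) = of_real y"
proof -
  have "(\<lambda>z. inverse (macmahon_product z)) holomorphic_on ball 0 1"
    by (intro holomorphic_intros macmahon_holomorphic) (use macmahon_nonzero in auto)
  then obtain g where g: "g holomorphic_on ball 0 1" "\<And>z. z \<in> ball 0 1 \<Longrightarrow> inverse (macmahon_product z) = (g z)\<^sup>2"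
    by (rule contractible_imp_holomorphic_sqrt) (use macmahon_nonzero in \<open>auto intro: convex_imp_contractible\<close>)
  have real: "Im (g (of_real x)) = 0 \<and> Re (g (of_real x)) \<noteq> 0" if x: "0 < x" "x < 1" for x
  proof -
    obtain y where y: "0 < y" "macmahon_product (of_real x) = of_real y" using macmahon_pos[OF x] by blast
    have "(g (of_real x))\<^sup>2 = of_real (inverse y)" using g(2)[of "of_real x"] x y by simp
    then have "Im ((g (of_real x))\<^sup>2) = 0" "Re ((g (of_real x))\<^sup>2) > 0" using y by simp_all
    then show ?thesis by (auto simp: power2_eq_square)
  qed
  let ?h = "\<lambda>x. Re (g (of_real x))"
  have "continuous_on (ball 0 1) g" using g(1) by (rule holomorphic_on_imp_continuous_on)
  then have cont: "continuous_on {0<..<1} (\<lambda>x::real. g (of_real x))"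
    by (rule continuous_on_compose2) (auto intro!: continuous_intros)
  have sgn: "sgn (?h x) = sgn (?h (1/2))" if x: "0 < x" "x < 1" for x
  proof (rule ccontr)
    assume ne: "sgn (?h x) \<noteq> sgn (?h (1/2))"
    have c: "connected (?h ` {0<..<1})"
      by (intro connected_continuous_image continuous_intros cont) auto
    have mem: "?h x \<in> ?h ` {0<..<1}" "?h (1/2) \<in> ?h ` {0<..<1}" by (rule imageI, use x in simp)+
    have nz: "?h x \<noteq> 0" "?h (1/2) \<noteq> 0" using real[OF x] real[of "1/2"] by auto
    have "0 \<in> ?h ` {0<..<1}"
    proof (cases "?h x < 0")
      case True
      then have "?h (1/2) > 0" using ne nz by (auto simp: sgn_if split: if_splits)
      then show ?thesis using connectedD_interval[OF c mem, of 0] True by simp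
    next
      case False
      then have "?h (1/2) < 0" "?h x > 0" using ne nz by (auto simp: sgn_if split: if_splits)
      then show ?thesis using connectedD_interval[OF c mem(2) mem(1), of 0] by simp
    qed
    then obtain y where "0 < y" "y < 1" "?h y = 0" by auto
    then show False using real[of y] by simp
  qed
  let ?f = "\<lambda>z. of_real (sgn (?h (1/2))) * g z"
  have nz: "?h (1/2) \<noteq> 0" using real[of "1/2"] by simp
  show ?thesis
  proof (rule that[of ?f])
    show "?f holomorphic_on ball 0 1" by (intro holomorphic_intros g)
    show "(?f z)\<^sup>2 = norm_prod empty_part z" if "z \<in> ball 0 1" for z
    proof -
      have "(of_real (sgn (?h (1/2))) :: complex)\<^sup>2 = 1" using nz by (auto simp: sgn_if)
      then show ?thesis using g(2)[OF that] norm_prod_empty[of z] that by (simp add: power_mult_distrib)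
    qed
    show "\<exists>y. 0 < y \<and> ?f (of_real x) = of_real y" if x: "0 < x" "x < 1" for x
    proof (intro exI conjI)
      show "0 < \<bar>?h x\<bar>" using real[OF x] by simp
      have "g (of_real x) = of_real (?h x)" using real[OF x] by (simp add: complex_eq_iff)
      then have "?f (of_real x) = of_real (sgn (?h x) * ?h x)" unfolding sgn[OF x, symmetric] by simp
      also have "sgn (?h x) * ?h x = \<bar>?h x\<bar>" by (simp add: abs_sgn mult.commute)
      finally show "?f (of_real x) = of_real \<bar>?h x\<bar>" .
    qed
  qed
qed

text \<open>The Schur function at z^m, z^(m+1), ..., whose n-th power sum is z^(m n) / (1 - z^n). As
  a determinant of rational functions without poles in the disc it is holomorphic there, including
  the origin. The bra leads to m = 1, the ket to m = 0.\<close>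

definition schur_geom :: "nat \<Rightarrow> partition \<Rightarrow> complex \<Rightarrow> complex" where
  "schur_geom m la z = jt (plen la) (\<lambda>n. z ^ (m * n) / (1 - z ^ n)) (beta la)"

lemma schur_geom_holomorphic: "schur_geom m la holomorphic_on ball 0 1"
proof -
  have nz: "1 - z ^ n \<noteq> 0" if "1 \<le> n" "norm z < 1" for n and z :: complex
    using macmahon_factor_nonzero[OF that(2), of "n - 1" 0] that(1) by simp
  have "(\<lambda>z. hfun (\<lambda>n. z ^ (m * n) / (1 - z ^ n)) k) holomorphic_on ball 0 1" for k
  proof (cases "k < 0")
    case False
    have "(\<lambda>z. newton (\<lambda>n. z ^ (m * n) / (1 - z ^ n)) (nat k)) holomorphic_on ball 0 1"
      by (intro newton_holomorphic holomorphic_intros nz) auto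
    then show ?thesis using False by (simp add: hfun_def)
  qed (simp add: hfun_def)
  then show ?thesis unfolding schur_geom_def[abs_def] jt_def by (intro fdet_holomorphic)
qed

lemma schur_geom_eq:
  assumes "norm z < 1"
  shows "schur_geom m la z = schur la (\<lambda>i. z ^ (m + i - 1))"
proof -
  let ?x = "\<lambda>i. z ^ (m + i - 1)"
  have summ: "summable (\<lambda>i. norm (?x (Suc i)))"
    using assms by (simp add: norm_mult norm_power power_add summable_mult summable_geometric)
  have p: "power_sum ?x n = z ^ (m * n) / (1 - z ^ n)" if n: "1 \<le> n" for n
  proof (rule LIMSEQ_unique)
    show "(\<lambda>N. power_sum_upto N ?x n) \<longlonglongrightarrow> power_sum ?x n"
      by (rule power_sum_upto_tendsto[OF summ n])
    have zn: "norm (z ^ n) < 1" using assms n by (simp add: norm_power power_less_one_iff)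
    have "(\<lambda>i. z ^ (m * n) * (z ^ n) ^ i) sums (z ^ (m * n) * (1 / (1 - z ^ n)))"
      by (intro sums_mult geometric_sums zn)
    then have "(\<lambda>N. \<Sum>i<N. z ^ (m * n) * (z ^ n) ^ i) \<longlonglongrightarrow> z ^ (m * n) / (1 - z ^ n)"
      by (simp add: sums_def)
    moreover have "(\<Sum>i<N. z ^ (m * n) * (z ^ n) ^ i) = power_sum_upto N ?x n" for N
      unfolding power_sum_upto_def
      by (rule sum.reindex_bij_witness[of _ "\<lambda>i. i - 1" Suc])
        (auto simp: power_mult[symmetric] power_add[symmetric] algebra_simps)
    ultimately show "(\<lambda>N. power_sum_upto N ?x n) \<longlonglongrightarrow> z ^ (m * n) / (1 - z ^ n)" by simp
  qed
  have "newton (\<lambda>n. z ^ (m * n) / (1 - z ^ n)) = newton (power_sum ?x)"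
    by (intro ext newton_cong) (rule p[symmetric])
  then have "hfun (\<lambda>n. z ^ (m * n) / (1 - z ^ n)) = hfun (power_sum ?x)"
    by (simp add: hfun_def fun_eq_iff)
  then show ?thesis
    unfolding schur_geom_def schur_eq_jt[OF summ order_refl] jt_def by simp
qed

lemma schur_pos:
  fixes x :: "nat \<Rightarrow> real"
  assumes pos: "\<And>i. 1 \<le> i \<Longrightarrow> 0 < x i" and summ: "summable (\<lambda>i. x (Suc i))"
  shows "\<exists>y. 0 < y \<and> schur la (\<lambda>i. of_real (x i)) = of_real y"
proof -
  let ?S = "skew_ssyt la empty_part" and ?f = "\<lambda>T. \<Prod>c\<in>cells la. x (T c)"
  have "summable (\<lambda>i. norm (complex_of_real (x (Suc i))))"
    using summ pos by (simp add: abs_of_pos)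
  from schur_summable[OF this] have "(\<lambda>T. complex_of_real (?f T)) summable_on ?S" by simp
  then have "(\<lambda>T. Re (complex_of_real (?f T))) summable_on ?S" by (rule summable_on_Re)
  then have sm: "?f summable_on ?S" by (simp only: Re_complex_of_real)
  have pos': "0 < ?f T" if "T \<in> ?S" for T
  proof (rule prod_pos)
    fix c assume "c \<in> cells la"
    then have "T c \<in> {1..}" using that unfolding skew_ssyt_def skew_cells_empty by blast
    then show "0 < x (T c)" using pos by simp
  qed
  \<comment> \<open>Filling every cell with its row number gives a tableau, so the sum has at least
    one positive term.\<close>
  define T0 where "T0 = restrict fst (cells la)"
  have T0: "T0 \<in> ?S"
    unfolding skew_ssyt_def skew_cells_empty T0_def by (auto simp: cells_def)
  have "0 < ?f T0" by (rule pos'[OF T0])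
  also have "?f T0 = (\<Sum>\<^sub>\<infinity>T\<in>{T0}. ?f T)" by simp
  also have "\<dots> \<le> (\<Sum>\<^sub>\<infinity>T\<in>?S. ?f T)"
    by (rule infsum_mono_neutral) (use sm pos' T0 in \<open>auto intro: less_imp_le\<close>)
  finally have "0 < (\<Sum>\<^sub>\<infinity>T\<in>?S. ?f T)" .
  moreover have "schur la (\<lambda>i. of_real (x i)) = of_real (\<Sum>\<^sub>\<infinity>T\<in>?S. ?f T)"
  proof -
    have "(\<Sum>\<^sub>\<infinity>T\<in>?S. complex_of_real (?f T)) = of_real (\<Sum>\<^sub>\<infinity>T\<in>?S. ?f T)"
      by (rule infsumI[OF has_sum_of_real[OF has_sum_infsum[OF sm]]])
    then show ?thesis by (simp add: schur_def skew_schur_def skew_cells_empty)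
  qed
  ultimately show ?thesis by blast
qed

lemma schur_geom_pos:
  assumes "0 < x" "x < 1"
  shows "\<exists>y. 0 < y \<and> schur_geom m la (of_real x) = of_real y"
proof -
  have "summable (\<lambda>i. x ^ (m + Suc i - 1))"
    using assms by (simp add: power_add summable_mult summable_geometric)
  then have "\<exists>y. 0 < y \<and> schur la (\<lambda>i. of_real (x ^ (m + i - 1))) = of_real y"
    by (intro schur_pos) (use assms in auto)
  then show ?thesis using schur_geom_eq[of "of_real x" m la] assms by simp
qed

text \<open>The variables q^(-rho) are t, t^3, t^5, ...; multiplication by \<open>t\<close> or by
  its inverse makes them integral powers of q, and homogeneity accounts for the factor in
  front.\<close>

lemma schur_geom_q_vars:
  assumes "t \<noteq> 0" "norm t < 1"
  shows "schur_geom 1 la (t\<^sup>2) = t ^ psize la * schur la (q_vars t empty_part)"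
    and "schur_geom 0 la (t\<^sup>2) = inverse t ^ psize la * schur la (q_vars t empty_part)"
proof -
  have n: "norm (t\<^sup>2) < 1" using assms by (simp add: norm_power power_less_one_iff)
  have qv: "q_vars t empty_part i = t powi (2 * int i - 1)" for i by (simp add: q_vars_def)
  have cong: "schur la x = schur la y" if "\<And>i. 1 \<le> i \<Longrightarrow> x i = y i" for x y :: "nat \<Rightarrow> complex"
  proof -
    have "(\<Prod>c\<in>cells la. x (T c)) = (\<Prod>c\<in>cells la. y (T c))" if "T \<in> skew_ssyt la empty_part" for T
    proof (rule prod.cong)
      fix c assume "c \<in> cells la"
      then have "T c \<in> {1..}" using that unfolding skew_ssyt_def skew_cells_empty by blast
      then show "x (T c) = y (T c)" using \<open>\<And>i. 1 \<le> i \<Longrightarrow> x i = y i\<close> by simp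
    qed simp
    then show ?thesis unfolding schur_def skew_schur_def skew_cells_empty by (simp cong: infsum_cong)
  qed
  have "t\<^sup>2 ^ i = t * q_vars t empty_part i" for i
  proof -
    have "t * q_vars t empty_part i = t powi (1 + (2 * int i - 1))"
      using assms by (subst power_int_add) (auto simp: qv)
    also have "\<dots> = t powi int (2 * i)" by simp
    finally show ?thesis by (simp only: power_int_of_nat power_mult)
  qed
  then have "schur la (\<lambda>i. t\<^sup>2 ^ (1 + i - 1)) = schur la (\<lambda>i. t * q_vars t empty_part i)" by (intro cong) simp
  then show "schur_geom 1 la (t\<^sup>2) = t ^ psize la * schur la (q_vars t empty_part)"
    unfolding schur_geom_eq[OF n] by (simp only: schur_scale)
  have "t\<^sup>2 ^ (i - 1) = inverse t * q_vars t empty_part i" if "1 \<le> i" for i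
  proof -
    have "inverse t * q_vars t empty_part i = t powi (- 1 + (2 * int i - 1))"
      using assms by (subst power_int_add) (auto simp: qv)
    also have "- 1 + (2 * int i - 1) = int (2 * (i - 1))" using that by (simp add: of_nat_diff)
    finally show ?thesis by (simp only: power_int_of_nat power_mult)
  qed
  then have "schur la (\<lambda>i. t\<^sup>2 ^ (0 + i - 1)) = schur la (\<lambda>i. inverse t * q_vars t empty_part i)" by (intro cong) simp
  then show "schur_geom 0 la (t\<^sup>2) = inverse t ^ psize la * schur la (q_vars t empty_part)"
    unfolding schur_geom_eq[OF n] by (simp only: schur_scale)
qed

text \<open>By \<open>norm_prod_schur\<close> the radicand is the square of a
  \<open>schur_geom\<close> times \<open>norm_prod empty_part\<close>: the sign and the power of q
  with exponent kappa / 2 cancel. The root is then \<open>schur_geom\<close> times the root for the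
  empty partition, with the required positivity. For the ket, conjugation reverses the sign of
  \<open>kappa\<close> but preserves \<open>norm_prod\<close>.\<close>

theorem norm_factors:
  assumes t: "t \<noteq> 0" "norm t < 1"
  shows "norm_ket empty_part (t\<^sup>2) \<noteq> 0"
    and "norm_bra la (t\<^sup>2) = (- t) ^ psize la * schur la (q_vars t empty_part) * norm_ket empty_part (t\<^sup>2)"
    and "norm_ket (conj_part la) (t\<^sup>2) = inverse t ^ psize la * schur la (q_vars t empty_part) * norm_ket empty_part (t\<^sup>2)"
proof -
  obtain f where f: "f holomorphic_on ball 0 1"
    "\<And>z. z \<in> ball 0 1 \<Longrightarrow> (f z)\<^sup>2 = norm_prod empty_part z"
    "\<And>x::real. 0 < x \<Longrightarrow> x < 1 \<Longrightarrow> \<exists>y::real. 0 < y \<and> f (of_real x) = of_real y"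
    using ex_sqrt_norm_prod_empty by blast
  have tq: "t\<^sup>2 \<in> ball 0 1" using t by (simp add: norm_power power_less_one_iff)
  \<comment> \<open>\<open>norm_prod_schur\<close> is stated at squares u^2, so every point of the
    punctured disc is written as one.\<close>
  have root: "\<exists>u. u \<noteq> 0 \<and> norm u < 1 \<and> z = u\<^sup>2" if "z \<in> ball 0 1 - {0}" for z :: complex
  proof (intro exI conjI)
    show "z = (csqrt z)\<^sup>2" by simp
    show "csqrt z \<noteq> 0" using that by simp
    show "norm (csqrt z) < 1" using that by simp
  qed
  have ds: "disc_sqrt F (t\<^sup>2) = schur_geom m la (t\<^sup>2) * f (t\<^sup>2)"
    if "\<And>z. z \<in> ball 0 1 - {0} \<Longrightarrow> (schur_geom m la z)\<^sup>2 * norm_prod empty_part z = F z" for m la F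
  proof (rule disc_sqrt_eqI)
    show "(\<lambda>z. schur_geom m la z * f z) holomorphic_on ball 0 1"
      by (intro holomorphic_intros schur_geom_holomorphic f)
    show "(schur_geom m la z * f z)\<^sup>2 = F z" if "z \<in> ball 0 1 - {0}" for z
      using that f(2)[of z] \<open>\<And>z. z \<in> ball 0 1 - {0} \<Longrightarrow> (schur_geom m la z)\<^sup>2 * norm_prod empty_part z = F z\<close>[OF that]
      by (simp add: power_mult_distrib)
    show "\<exists>y>0. schur_geom m la (of_real x) * f (of_real x) = of_real y" if x: "0 < x" "x < 1" for x
    proof -
      obtain a b where "0 < a" "schur_geom m la (of_real x) = of_real a" "0 < b" "f (of_real x) = of_real b"
        using schur_geom_pos[OF x, of m la] f(3)[OF x] by blast
      then show ?thesis by (intro exI[of _ "a * b"]) simp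
    qed
  qed (rule tq)
  have k0: "norm_ket empty_part (t\<^sup>2) = f (t\<^sup>2)"
    unfolding norm_ket_def
  proof (rule disc_sqrt_eqI)
    have "kappa empty_part = 0" by (simp add: kappa_def)
    then show "(f z)\<^sup>2 = (- 1) ^ psize empty_part * z powi (kappa empty_part div 2 - int (psize empty_part)) * norm_prod empty_part z"
      if "z \<in> ball 0 1 - {0}" for z
      using f(2)[of z] that by simp
  qed (use f tq in auto)
  have "(f (t\<^sup>2))\<^sup>2 \<noteq> 0" unfolding f(2)[OF tq] using macmahon_nonzero[of "t\<^sup>2"] norm_prod_empty[of "t\<^sup>2"] tq by simp
  then show "norm_ket empty_part (t\<^sup>2) \<noteq> 0" unfolding k0 by simp
  have sgn2: "(-1 :: complex) ^ n * (-1) ^ n = 1" for n by (simp add: power_mult_distrib[symmetric])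
  have "disc_sqrt (\<lambda>q. (-1) ^ psize la * q powi (- (kappa la div 2) + int (psize la)) * norm_prod la q) (t\<^sup>2)
      = schur_geom 1 la (t\<^sup>2) * f (t\<^sup>2)"
  proof (rule ds)
    fix z :: complex assume "z \<in> ball 0 1 - {0}"
    then obtain u where u: "u \<noteq> 0" "norm u < 1" "z = u\<^sup>2" using root by blast
    have p: "z powi (- (kappa la div 2) + int (psize la)) * z powi (kappa la div 2) = z ^ psize la"
      using u by (simp add: power_int_add[symmetric])
    have "(-1) ^ psize la * z powi (- (kappa la div 2) + int (psize la)) * norm_prod la z
      = ((-1) ^ psize la * (-1) ^ psize la) * (z powi (- (kappa la div 2) + int (psize la)) * z powi (kappa la div 2))
        * (schur la (q_vars u empty_part))\<^sup>2 * norm_prod empty_part z"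
      unfolding u(3) norm_prod_schur(1)[OF u(1,2), of la] by (simp only: mult_ac)
    also have "\<dots> = (schur_geom 1 la z)\<^sup>2 * norm_prod empty_part z"
      unfolding sgn2 p unfolding u(3) schur_geom_q_vars[OF u(1,2)] by (simp add: power_mult_distrib power_mult[symmetric] mult.commute)
    finally show "(schur_geom 1 la z)\<^sup>2 * norm_prod empty_part z
      = (-1) ^ psize la * z powi (- (kappa la div 2) + int (psize la)) * norm_prod la z" ..
  qed
  then show "norm_bra la (t\<^sup>2) = (- t) ^ psize la * schur la (q_vars t empty_part) * norm_ket empty_part (t\<^sup>2)"
    unfolding norm_bra_def k0 schur_geom_q_vars[OF t] by (simp add: power_minus[of t])
  have "norm_ket (conj_part la) (t\<^sup>2) = schur_geom 0 la (t\<^sup>2) * f (t\<^sup>2)"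
    unfolding norm_ket_def
  proof (rule ds)
    fix z :: complex assume "z \<in> ball 0 1 - {0}"
    then obtain u where u: "u \<noteq> 0" "norm u < 1" "z = u\<^sup>2" using root by blast
    have e: "kappa (conj_part la) div 2 - int (psize (conj_part la)) = - (kappa la div 2) - int (psize la)"
      using even_kappa[of la] by (auto elim!: evenE)
    have p: "z powi (- (kappa la div 2) - int (psize la)) * z powi (kappa la div 2) = inverse z ^ psize la"
      using u by (simp add: power_int_add[symmetric] power_int_minus power_inverse)
    have "(-1) ^ psize la * z powi (- (kappa la div 2) - int (psize la)) * norm_prod la z
      = ((-1) ^ psize la * (-1) ^ psize la) * (z powi (- (kappa la div 2) - int (psize la)) * z powi (kappa la div 2))
        * (schur la (q_vars u empty_part))\<^sup>2 * norm_prod empty_part z"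
      unfolding u(3) norm_prod_schur(1)[OF u(1,2), of la] by (simp only: mult_ac)
    also have "\<dots> = (schur_geom 0 la z)\<^sup>2 * norm_prod empty_part z"
      unfolding sgn2 p unfolding u(3) schur_geom_q_vars[OF u(1,2)]
      by (simp add: power_mult_distrib power_mult[symmetric] power_inverse mult.commute)
    finally show "(schur_geom 0 la z)\<^sup>2 * norm_prod empty_part z
      = (-1) ^ psize (conj_part la) * z powi (kappa (conj_part la) div 2 - int (psize (conj_part la))) * norm_prod (conj_part la) z"
      unfolding e unfolding u(3) norm_prod_schur(2)[OF u(1,2), of la] psize_conj by simp
  qed
  then show "norm_ket (conj_part la) (t\<^sup>2) = inverse t ^ psize la * schur la (q_vars t empty_part) * norm_ket empty_part (t\<^sup>2)"
    unfolding k0 schur_geom_q_vars[OF t] .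
qed

section \<open>Fermions and wedges\<close>

context fermion_fock
begin

text \<open>Level \<open>k\<close> is the pair of modes \<open>\<psi>\<^sup>\<dagger>\<close> of index \<open>- k - 1/2\<close>, which fills it, and \<open>\<psi>\<close> of
  index \<open>k + 1/2\<close>, which empties it. In the vacuum exactly the negative levels are filled.\<close>

definition cr :: "int \<Rightarrow> 'v \<Rightarrow> 'v" where
  "cr k = psid (of_int (- k) - 1/2)"

definition an :: "int \<Rightarrow> 'v \<Rightarrow> 'v" where
  "an k = psi (of_int k + 1/2)"

lemma half_ints_plus: "of_int k + 1/2 \<in> half_ints"
  by (auto simp: half_ints_def)

lemma half_ints_minus: "of_int k - 1/2 \<in> half_ints"
  using half_ints_plus[of "k - 1"] by (simp add: algebra_simps)

lemma cr_hom: "module_hom scale scale (cr k)"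
  unfolding cr_def by (rule Vector_Spaces.linear.axioms(3)[OF psid_linear]) (rule half_ints_minus)

lemma an_hom: "module_hom scale scale (an k)"
  unfolding an_def by (rule Vector_Spaces.linear.axioms(3)[OF psi_linear]) (rule half_ints_plus)

lemmas cr_simps [simp] = module_hom.add[OF cr_hom] module_hom.scale[OF cr_hom] module_hom.zero[OF cr_hom]
  module_hom.neg[OF cr_hom] module_hom.diff[OF cr_hom]
lemmas an_simps [simp] = module_hom.add[OF an_hom] module_hom.scale[OF an_hom] module_hom.zero[OF an_hom]
  module_hom.neg[OF an_hom] module_hom.diff[OF an_hom]
lemmas cr_sum = module_hom.sum[OF cr_hom]
lemmas an_sum = module_hom.sum[OF an_hom]

lemma an_cr: "an k (cr l v) = (if k = l then v else 0) - cr l (an k v)"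
proof -
  have "of_int k + 1/2 + (of_int (- l) - 1/2) = (0::rat) \<longleftrightarrow> k = l"
    by (auto simp: algebra_simps)
  then have "an k (cr l v) + cr l (an k v) = (if k = l then v else 0)"
    unfolding an_def cr_def using anticomm_psi_psid[OF half_ints_plus half_ints_minus, of k "- l" v] by (simp only:)
  then show ?thesis by (simp add: eq_diff_eq)
qed

lemma an_an: "an k (an l v) = - an l (an k v)"
  using anticomm_psi_psi[OF half_ints_plus half_ints_plus, of k l v]
  by (simp add: an_def eq_neg_iff_add_eq_0)

lemma cr_cr: "cr k (cr l v) = - cr l (cr k v)"
  using anticomm_psid_psid[OF half_ints_minus half_ints_minus, of "- k" "- l" v]
  by (simp add: cr_def eq_neg_iff_add_eq_0)

lemma eq_neg_imp_0: "v = - v \<Longrightarrow> v = (0 :: 'v)"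
proof -
  assume "v = - v"
  then have "scale 2 v = 0"
    by (metis add.right_inverse one_add_one scale_left_distrib scale_one)
  then show "v = 0" by simp
qed

lemma cr_cr_same [simp]: "cr k (cr k v) = 0"
  by (rule eq_neg_imp_0) (rule cr_cr)

lemma an_an_same [simp]: "an k (an k v) = 0"
  by (rule eq_neg_imp_0) (rule an_an)

lemma cr_vac: "k < 0 \<Longrightarrow> cr k vac = 0"
proof -
  assume "k < 0"
  then have "(1::rat) \<le> of_int (- k)" by simp
  then show ?thesis unfolding cr_def by (intro psid_vac half_ints_minus) linarith
qed

lemma an_vac: "0 \<le> k \<Longrightarrow> an k vac = 0"
  unfolding an_def by (intro psi_vac half_ints_plus) (simp add: add_nonneg_pos)

text \<open>Cyclicity of the vacuum as an induction rule: every mode \<open>psi r\<close> or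
  \<open>psid r\<close> is some \<open>an k\<close> or \<open>cr k\<close>.\<close>

lemma fock_induct [consumes 0, case_names add scale vac cr an]:
  assumes add: "\<And>v w. P v \<Longrightarrow> P w \<Longrightarrow> P (v + w)" and sc: "\<And>c v. P v \<Longrightarrow> P (scale c v)"
    and "P vac" and cr: "\<And>k v. P v \<Longrightarrow> P (cr k v)" and an: "\<And>k v. P v \<Longrightarrow> P (an k v)"
  shows "P v"
proof -
  have "P 0" using sc[OF \<open>P vac\<close>, of 0] by simp
  then have sub: "subspace {v. P v}"
    using add sc by (auto simp: subspace_def)
  have "{v. P v} = UNIV"
  proof (rule vac_cyclic[OF sub])
    fix r v assume r: "r \<in> half_ints" and v: "v \<in> {v. P v}"
    obtain k :: int where k: "r = of_int k + 1/2" using r by (auto simp: half_ints_def)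
    have "psid r = cr (- k - 1)" unfolding k cr_def by (simp add: algebra_simps)
    moreover have "psi r = an k" by (simp add: k an_def)
    ultimately show "psi r v \<in> {v. P v} \<and> psid r v \<in> {v. P v}" using cr an v by auto
  qed (use \<open>P vac\<close> in simp)
  then show ?thesis by auto
qed

text \<open>In every vector high levels are empty and low levels are filled, as in the vacuum. This
  makes the mode sum of a boson finite.\<close>

lemma locally_finite: "\<exists>M::int. \<forall>k\<ge>M. an k v = 0 \<and> cr (- k) v = 0"
proof (induction v rule: fock_induct)
  case (add v w)
  then obtain M M' :: int where "\<forall>k\<ge>M. an k v = 0 \<and> cr (- k) v = 0" "\<forall>k\<ge>M'. an k w = 0 \<and> cr (- k) w = 0"
    by blast
  then show ?case by (intro exI[of _ "max M M'"]) auto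
next
  case (scale c v)
  then show ?case by auto
next
  case vac
  show ?case by (intro exI[of _ 1]) (auto simp: cr_vac an_vac)
next
  case (cr l v)
  then obtain M :: int where M: "\<forall>k\<ge>M. an k v = 0 \<and> cr (- k) v = 0" by blast
  have "an k (cr l v) = 0 \<and> cr (- k) (cr l v) = 0" if "max M (l + 1) \<le> k" for k
    using M that by (auto simp: an_cr cr_cr[of "- k"])
  then show ?case by blast
next
  case (an l v)
  then obtain M :: int where M: "\<forall>k\<ge>M. an k v = 0 \<and> cr (- k) v = 0" by blast
  have "an k (an l v) = 0 \<and> cr (- k) (an l v) = 0" if k: "max M (\<bar>l\<bar> + 1) \<le> k" for k
  proof
    show "an k (an l v) = 0" using M k by (simp add: an_an[of k])
    have "an l (cr (- k) v) = (if l = - k then v else 0) - cr (- k) (an l v)" by (rule an_cr)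
    moreover have "l \<noteq> - k" using k by auto
    ultimately show "cr (- k) (an l v) = 0" using M k by auto
  qed
  then show ?case by blast
qed

text \<open>For \<open>n \<noteq> 0\<close> the two modes anticommute, so both branches of the
  normal ordering give the same operator.\<close>

lemma normal_ordered_eq:
  assumes "n \<noteq> 0"
  shows "normal_ordered (of_int k + 1/2) (of_int n - (of_int k + 1/2)) v = - cr (k - n) (an k v)"
proof -
  have s: "of_int n - (of_int k + 1/2) = of_int (- (k - n)) - (1/2::rat)" by simp
  have p: "(of_int k + 1/2 > (0::rat)) \<longleftrightarrow> 0 \<le> k"
  proof
    assume *: "0 < of_int k + (1/2::rat)"
    show "0 \<le> k"
    proof (rule ccontr)
      assume "\<not> 0 \<le> k"
      then have "of_int k \<le> (of_int (- 1) :: rat)" unfolding of_int_le_iff by simp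
      then show False using * by simp
    qed
  qed (simp add: add_nonneg_pos)
  show ?thesis
  proof (cases "0 \<le> k")
    case True
    then show ?thesis unfolding normal_ordered_def s using p by (simp add: cr_def an_def)
  next
    case False
    then have "normal_ordered (of_int k + 1/2) (of_int n - (of_int k + 1/2)) v = an k (cr (k - n) v)"
      unfolding normal_ordered_def s using p by (simp add: cr_def an_def)
    then show ?thesis using assms by (simp add: an_cr)
  qed
qed

text \<open>Any finite range that contains a suitable window will do, so bosons on different vectors
  can be summed over a common range.\<close>

lemma boson_eq_sum:
  assumes n: "n \<noteq> 0"
  shows "\<exists>M. \<forall>A. finite A \<longrightarrow> {- M..M} \<subseteq> A \<longrightarrow> boson n v = (\<Sum>k\<in>A. cr (k - n) (an k v))"
proof -
  obtain M :: int where M: "\<And>k. M \<le> k \<Longrightarrow> an k v = 0 \<and> cr (- k) v = 0"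
    using locally_finite[of v] by blast
  \<comment> \<open>High levels are killed by the inner mode; for low ones the two modes are
    exchanged first.\<close>
  have 0: "cr (k - n) (an k v) = 0" if "k \<notin> {- (\<bar>M\<bar> + \<bar>n\<bar>)..\<bar>M\<bar> + \<bar>n\<bar>}" for k
  proof (cases "0 \<le> k")
    case True
    then show ?thesis using that M[of k] by auto
  next
    case False
    then have "cr (- (n - k)) v = 0" using that M[of "n - k"] by auto
    then have "cr (k - n) v = 0" by simp
    then show ?thesis using an_cr[of k "k - n" v] n by simp
  qed
  show ?thesis
  proof (intro exI allI impI)
    fix A assume A: "finite A" "{- (\<bar>M\<bar> + \<bar>n\<bar>)..\<bar>M\<bar> + \<bar>n\<bar>} \<subseteq> A"
    let ?B = "{k. cr (k - n) (an k v) \<noteq> 0}" and ?h = "\<lambda>k. of_int k + 1/2 :: rat"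
    have B: "?B \<subseteq> A" using 0 A by blast
    have img: "{r. r \<in> half_ints \<and> normal_ordered r (of_int n - r) v \<noteq> 0} = ?h ` ?B"
      using n by (auto simp: half_ints_def normal_ordered_eq image_iff)
    have "boson n v = - (\<Sum>k\<in>?B. - cr (k - n) (an k v))"
      unfolding boson_def img
      by (subst sum.reindex) (auto simp: inj_on_def normal_ordered_eq[OF n] intro!: sum.cong)
    also have "\<dots> = (\<Sum>k\<in>?B. cr (k - n) (an k v))" by (simp add: sum_negf)
    also have "\<dots> = (\<Sum>k\<in>A. cr (k - n) (an k v))"
      by (rule sum.mono_neutral_left) (use A B in auto)
    finally show "boson n v = \<dots>" .
  qed
qed

lemma boson_eq_sumE:
  assumes "n \<noteq> 0"
  obtains M where "\<And>A. finite A \<Longrightarrow> {- M..M} \<subseteq> A \<Longrightarrow> boson n v = (\<Sum>k\<in>A. cr (k - n) (an k v))"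
proof -
  from boson_eq_sum[OF assms, of v] obtain M
    where "\<forall>A. finite A \<longrightarrow> {- M..M} \<subseteq> A \<longrightarrow> boson n v = (\<Sum>k\<in>A. cr (k - n) (an k v))" ..
  then show thesis by (intro that[of M]) blast
qed

lemma boson_scale: "n \<noteq> 0 \<Longrightarrow> boson n (scale c v) = scale c (boson n v)"
proof -
  assume n: "n \<noteq> 0"
  obtain M where s1: "\<And>A. finite A \<Longrightarrow> {- M..M} \<subseteq> A \<Longrightarrow> boson n v = (\<Sum>k\<in>A. cr (k - n) (an k v))"
    using boson_eq_sumE[OF n] by blast
  obtain M' where s2: "\<And>A. finite A \<Longrightarrow> {- M'..M'} \<subseteq> A \<Longrightarrow> boson n (scale c v) = (\<Sum>k\<in>A. cr (k - n) (an k (scale c v)))"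
    using boson_eq_sumE[OF n] by blast
  note * = s1 s2
  show ?thesis
    using *[of "{- M..M} \<union> {- M'..M'}"] by (simp add: scale_sum_right)
qed

lemma boson_add: "n \<noteq> 0 \<Longrightarrow> boson n (v + w) = boson n v + boson n w"
proof -
  assume n: "n \<noteq> 0"
  obtain M where s1: "\<And>A. finite A \<Longrightarrow> {- M..M} \<subseteq> A \<Longrightarrow> boson n v = (\<Sum>k\<in>A. cr (k - n) (an k v))"
    using boson_eq_sumE[OF n] by blast
  obtain M' where s2: "\<And>A. finite A \<Longrightarrow> {- M'..M'} \<subseteq> A \<Longrightarrow> boson n w = (\<Sum>k\<in>A. cr (k - n) (an k w))"
    using boson_eq_sumE[OF n] by blast
  obtain M'' where s3: "\<And>A. finite A \<Longrightarrow> {- M''..M''} \<subseteq> A \<Longrightarrow> boson n (v + w) = (\<Sum>k\<in>A. cr (k - n) (an k (v + w)))"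
    using boson_eq_sumE[OF n] by blast
  note * = s1 s2 s3
  let ?A = "{- M..M} \<union> {- M'..M'} \<union> {- M''..M''}"
  have "boson n v = (\<Sum>k\<in>?A. cr (k - n) (an k v))" "boson n w = (\<Sum>k\<in>?A. cr (k - n) (an k w))"
    "boson n (v + w) = (\<Sum>k\<in>?A. cr (k - n) (an k (v + w)))"
    by ((rule *; blast)+)
  then show ?thesis by (simp only: an_simps cr_simps sum.distrib)
qed

lemma boson_0: "n \<noteq> 0 \<Longrightarrow> boson n 0 = 0"
  using boson_scale[of n 0 0] by simp

lemma boson_sum: "n \<noteq> 0 \<Longrightarrow> boson n (\<Sum>i\<in>I. f i) = (\<Sum>i\<in>I. boson n (f i))"
  by (induction I rule: infinite_finite_induct) (auto simp: boson_0 boson_add)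

text \<open>Only the term k = l of the mode sum fails to commute with \<open>cr l\<close>; it fills
  level l - n in place of l.\<close>

lemma boson_cr:
  assumes n: "n \<noteq> 0"
  shows "boson n (cr l v) = cr l (boson n v) + cr (l - n) v"
proof -
  obtain M where s1: "\<And>A. finite A \<Longrightarrow> {- M..M} \<subseteq> A \<Longrightarrow> boson n v = (\<Sum>k\<in>A. cr (k - n) (an k v))"
    using boson_eq_sumE[OF n] by blast
  obtain M' where s2: "\<And>A. finite A \<Longrightarrow> {- M'..M'} \<subseteq> A \<Longrightarrow> boson n (cr l v) = (\<Sum>k\<in>A. cr (k - n) (an k (cr l v)))"
    using boson_eq_sumE[OF n] by blast
  note * = s1 s2
  let ?A = "{- M..M} \<union> {- M'..M'} \<union> {l}"
  have "cr (k - n) (an k (cr l v)) = (if k = l then cr (k - n) v else 0) + cr l (cr (k - n) (an k v))" for k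
    by (simp add: an_cr cr_cr[of l])
  moreover have "{- M'..M'} \<subseteq> ?A" by blast
  ultimately have "boson n (cr l v) = (\<Sum>k\<in>?A. (if k = l then cr (k - n) v else 0)) + (\<Sum>k\<in>?A. cr l (cr (k - n) (an k v)))"
    using *(2)[of ?A] by (simp add: sum.distrib)
  also have "(\<Sum>k\<in>?A. (if k = l then cr (k - n) v else 0)) = cr (l - n) v"
    by (subst sum.delta) auto
  finally have "boson n (cr l v) = cr (l - n) v + cr l (\<Sum>k\<in>?A. cr (k - n) (an k v))"
    by (simp only: cr_sum)
  also have "(\<Sum>k\<in>?A. cr (k - n) (an k v)) = boson n v" by (rule *(1)[symmetric]) auto
  finally show ?thesis by (simp only: add.commute)
qed

lemma boson_an:
  assumes n: "n \<noteq> 0"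
  shows "boson n (an l v) = an l (boson n v) - an (l + n) v"
proof -
  obtain M where s1: "\<And>A. finite A \<Longrightarrow> {- M..M} \<subseteq> A \<Longrightarrow> boson n v = (\<Sum>k\<in>A. cr (k - n) (an k v))"
    using boson_eq_sumE[OF n] by blast
  obtain M' where s2: "\<And>A. finite A \<Longrightarrow> {- M'..M'} \<subseteq> A \<Longrightarrow> boson n (an l v) = (\<Sum>k\<in>A. cr (k - n) (an k (an l v)))"
    using boson_eq_sumE[OF n] by blast
  note * = s1 s2
  let ?A = "{- M..M} \<union> {- M'..M'} \<union> {l + n}"
  have "cr (k - n) (an k (an l v)) = an l (cr (k - n) (an k v)) - (if k = l + n then an k v else 0)" for k
    by (auto simp: an_cr an_an[of k l])
  moreover have "{- M'..M'} \<subseteq> ?A" by blast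
  ultimately have "boson n (an l v) = (\<Sum>k\<in>?A. an l (cr (k - n) (an k v))) - (\<Sum>k\<in>?A. (if k = l + n then an k v else 0))"
    using *(2)[of ?A] by (simp add: sum_subtractf)
  also have "(\<Sum>k\<in>?A. (if k = l + n then an k v else 0)) = an (l + n) v"
    by (subst sum.delta) auto
  finally have "boson n (an l v) = an l (\<Sum>k\<in>?A. cr (k - n) (an k v)) - an (l + n) v"
    by (simp only: an_sum)
  also have "(\<Sum>k\<in>?A. cr (k - n) (an k v)) = boson n v" by (rule *(1)[symmetric]) auto
  finally show ?thesis .
qed

lemma boson_vac: "0 < n \<Longrightarrow> boson n vac = 0"
proof -
  assume n: "0 < n"
  have "cr (k - n) (an k vac) = 0" for k
  proof (cases "0 \<le> k")
    case False
    then have "cr (k - n) vac = 0" using n by (intro cr_vac) simp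
    then show ?thesis using an_cr[of k "k - n" vac] n by simp
  qed (simp add: an_vac)
  moreover obtain M where M: "\<And>A. finite A \<Longrightarrow> {- M..M} \<subseteq> A \<Longrightarrow> boson n vac = (\<Sum>k\<in>A. cr (k - n) (an k vac))"
    using boson_eq_sum[of n vac] n by auto
  from M[of "{- M..M}"] calculation show ?thesis by simp
qed

lemma boson_diff: "n \<noteq> 0 \<Longrightarrow> boson n (v - w) = boson n v - boson n w"
  using boson_add[of n "v - w" w] by (simp add: eq_diff_eq)

text \<open>Both orders have the same commutators with every mode and annihilate the vacuum. For
  positive indices no central term arises.\<close>

lemma boson_commute:
  assumes "0 < m" "0 < n"
  shows "boson m (boson n v) = boson n (boson m v)"
proof (induction v rule: fock_induct)
  case (cr k v)
  then show ?case using assms by (simp add: boson_cr boson_add algebra_simps)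
next
  case (an k v)
  then show ?case using assms by (simp add: boson_an boson_diff) (simp add: algebra_simps)
qed (use assms in \<open>simp_all add: boson_add boson_scale boson_vac boson_0\<close>)

end

text \<open>A rearrangement is a chain of adjacent transpositions: the head of \<open>xs\<close> is
  carried to its place step by step (\<open>front\<close>), then the tail is treated. Serves for
  statements about alternating functions of a list.\<close>

lemma adjacent_swap_induct:
  assumes swap: "\<And>xs a b ys. P (xs @ [a, b] @ ys) \<Longrightarrow> P (xs @ [b, a] @ ys)"
    and "P ys" and "mset xs = mset ys"
  shows "P xs"
proof -
  have front: "P (pre @ a # u @ v)" if "P (pre @ u @ a # v)" for pre a u v
    using that
  proof (induction u arbitrary: v rule: rev_induct)
    case (snoc b u)
    then have "P ((pre @ u) @ [a, b] @ v)" using swap[of "pre @ u" b a v] by simp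
    then show ?case using snoc.IH[of "b # v"] by simp
  qed simp
  have "P (pre @ xs)" if "P (pre @ ys)" "mset xs = mset ys" for pre
    using that
  proof (induction xs arbitrary: pre ys)
    case (Cons a xs)
    then have "a \<in> set ys" by (metis list.set_intros(1) set_mset_mset)
    then obtain u v where ys: "ys = u @ a # v" by (meson split_list)
    then have "mset xs = mset (u @ v)" using Cons.prems(2) by simp
    moreover have "P ((pre @ [a]) @ u @ v)" using front[of pre u a v] Cons.prems(1) ys by simp
    ultimately show ?case using Cons.IH[of "pre @ [a]" "u @ v"] by simp
  qed simp
  from this[of "[]"] show ?thesis using assms by simp
qed

text \<open>In every Leibniz term of \<open>jt\<close> the indices of the h_k add up to this number;
  for the shifted parts of a partition it is the size (\<open>degree_betas\<close>).\<close>

definition degree_seq :: "nat \<Rightarrow> (nat \<Rightarrow> int) \<Rightarrow> int" where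
  "degree_seq K \<alpha> = (\<Sum>i<K. \<alpha> i + int i + 1)"

lemma jt_leibniz:
  "jt K p \<alpha> = (\<Sum>\<pi> | \<pi> permutes {0..<K}. of_int (sign \<pi>) * (\<Prod>i<K. hfun p (\<alpha> i + int (\<pi> i) + 1)))"
  unfolding jt_def fdet_leibniz atLeast0LessThan ..

lemma sum_permuted_degree:
  assumes "\<pi> permutes {0..<K}"
  shows "(\<Sum>i<K. \<alpha> i + int (\<pi> i) + 1) = degree_seq K \<alpha>"
proof -
  have "(\<Sum>i<K. int (\<pi> i)) = (\<Sum>i<K. int i)"
    using sum.permute[OF assms, of int] by (simp add: atLeast0LessThan o_def)
  then show ?thesis by (simp add: degree_seq_def sum.distrib)
qed

text \<open>Every Leibniz term has a factor of negative index.\<close>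

lemma jt_negative_degree:
  assumes "degree_seq K \<alpha> < 0"
  shows "jt K p \<alpha> = 0"
  unfolding jt_leibniz
proof (rule sum.neutral, rule ballI, clarify)
  fix \<pi> assume \<pi>: "\<pi> permutes {0..<K}"
  have "\<exists>i<K. \<alpha> i + int (\<pi> i) + 1 < 0"
  proof (rule ccontr)
    assume "\<not> ?thesis"
    then have "0 \<le> \<alpha> i + int (\<pi> i) + 1" if "i < K" for i using that by force
    then have "0 \<le> (\<Sum>i<K. \<alpha> i + int (\<pi> i) + 1)"
      by (intro sum_nonneg) simp
    then show False using sum_permuted_degree[OF \<pi>] assms by simp
  qed
  then obtain i where "i < K" "hfun p (\<alpha> i + int (\<pi> i) + 1) = 0" by (auto simp: hfun_def)
  then have "(\<Prod>i<K. hfun p (\<alpha> i + int (\<pi> i) + 1)) = 0" by (intro prod_zero) auto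
  then show "of_int (sign \<pi>) * (\<Prod>i<K. hfun p (\<alpha> i + int (\<pi> i) + 1)) = 0" by simp
qed

text \<open>The Euler derivation, applied row by row with the recursion
  \<open>k h\<^sub>k = \<Sum>n. p\<^sub>n h\<^sub>k\<^sub>-\<^sub>n\<close>; the row shifts are the action of the bosons.\<close>

lemma jt_degree_rec:
  assumes d: "degree_seq K \<alpha> = int d"
  shows "of_nat d * jt K p \<alpha> = (\<Sum>n=1..d. p n * (\<Sum>i<K. jt K p (\<alpha>(i := \<alpha> i - int n))))"
proof -
  \<comment> \<open>\<open>B\<close> bounds all indices in the matrix, so the recursion holds with
    one range of n for every entry. The terms with n > d drop out at the end because they have
    negative degree.\<close>
  define B where "B = d + (\<Sum>i<K. nat \<bar>\<alpha> i\<bar>) + K"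
  have B: "\<alpha> i + int j + 1 \<le> int B" if "i < K" "j < K" for i j
  proof -
    have "nat \<bar>\<alpha> i\<bar> \<le> (\<Sum>i<K. nat \<bar>\<alpha> i\<bar>)" by (rule member_le_sum) (use that in auto)
    then show ?thesis using that unfolding B_def by linarith
  qed
  have row: "(\<Sum>i<K. of_int (\<alpha> i + int (\<pi> i) + 1)) * (\<Prod>i<K. hfun p (\<alpha> i + int (\<pi> i) + 1))
      = (\<Sum>n=1..B. p n * (\<Sum>i<K. \<Prod>j<K. hfun p ((\<alpha>(i := \<alpha> i - int n)) j + int (\<pi> j) + 1)))"
    (is "?L = ?R") if \<pi>: "\<pi> permutes {0..<K}" for \<pi>
  proof -
    have lt: "\<pi> i < K" if "i < K" for i using permutes_in_image[OF \<pi>, of i] that by auto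
    have "?L = (\<Sum>i<K. (of_int (\<alpha> i + int (\<pi> i) + 1) * hfun p (\<alpha> i + int (\<pi> i) + 1))
        * (\<Prod>j\<in>{..<K} - {i}. hfun p (\<alpha> j + int (\<pi> j) + 1)))"
      unfolding sum_distrib_right by (rule sum.cong) (auto simp: prod.remove)
    also have "\<dots> = (\<Sum>i<K. \<Sum>n=1..B. p n * (hfun p (\<alpha> i + int (\<pi> i) + 1 - int n)
        * (\<Prod>j\<in>{..<K} - {i}. hfun p (\<alpha> j + int (\<pi> j) + 1))))"
    proof (rule sum.cong)
      fix i assume "i \<in> {..<K}"
      then show "(of_int (\<alpha> i + int (\<pi> i) + 1) * hfun p (\<alpha> i + int (\<pi> i) + 1))
        * (\<Prod>j\<in>{..<K} - {i}. hfun p (\<alpha> j + int (\<pi> j) + 1)) = (\<Sum>n=1..B. p n * (hfun p (\<alpha> i + int (\<pi> i) + 1 - int n)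
        * (\<Prod>j\<in>{..<K} - {i}. hfun p (\<alpha> j + int (\<pi> j) + 1))))"
        using hfun_rec[OF B[of i "\<pi> i"]] lt by (simp add: sum_distrib_right mult.assoc)
    qed simp
    also have "\<dots> = (\<Sum>i<K. \<Sum>n=1..B. p n * (\<Prod>j<K. hfun p ((\<alpha>(i := \<alpha> i - int n)) j + int (\<pi> j) + 1)))"
    proof (intro sum.cong refl)
      fix i n assume i: "i \<in> {..<K}"
      have "(\<Prod>j<K. hfun p ((\<alpha>(i := \<alpha> i - int n)) j + int (\<pi> j) + 1))
        = hfun p ((\<alpha>(i := \<alpha> i - int n)) i + int (\<pi> i) + 1)
          * (\<Prod>j\<in>{..<K} - {i}. hfun p ((\<alpha>(i := \<alpha> i - int n)) j + int (\<pi> j) + 1))"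
        by (rule prod.remove) (use i in auto)
      also have "(\<Prod>j\<in>{..<K} - {i}. hfun p ((\<alpha>(i := \<alpha> i - int n)) j + int (\<pi> j) + 1))
        = (\<Prod>j\<in>{..<K} - {i}. hfun p (\<alpha> j + int (\<pi> j) + 1))"
        by (rule prod.cong) auto
      finally show "p n * (hfun p (\<alpha> i + int (\<pi> i) + 1 - int n)
        * (\<Prod>j\<in>{..<K} - {i}. hfun p (\<alpha> j + int (\<pi> j) + 1)))
        = p n * (\<Prod>j<K. hfun p ((\<alpha>(i := \<alpha> i - int n)) j + int (\<pi> j) + 1))"
        by (simp add: algebra_simps)
    qed
    also have "\<dots> = ?R" by (subst sum.swap) (simp add: sum_distrib_left)
    finally show ?thesis .
  qed
  have "of_nat d * jt K p \<alpha> = (\<Sum>\<pi> | \<pi> permutes {0..<K}. of_int (sign \<pi>) *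
      ((\<Sum>i<K. of_int (\<alpha> i + int (\<pi> i) + 1)) * (\<Prod>i<K. hfun p (\<alpha> i + int (\<pi> i) + 1))))"
    unfolding jt_leibniz sum_distrib_left
  proof (rule sum.cong)
    fix \<pi> assume "\<pi> \<in> {\<pi>. \<pi> permutes {0..<K}}"
    then have "(\<Sum>i<K. \<alpha> i + int (\<pi> i) + 1) = int d" using sum_permuted_degree d by simp
    then have "(\<Sum>i<K. of_int (\<alpha> i + int (\<pi> i) + 1)) = (of_nat d :: complex)"
      by (simp only: of_int_sum[symmetric] of_int_of_nat_eq)
    then show "of_nat d * (of_int (sign \<pi>) * (\<Prod>i<K. hfun p (\<alpha> i + int (\<pi> i) + 1))) = of_int (sign \<pi>) *
      ((\<Sum>i<K. of_int (\<alpha> i + int (\<pi> i) + 1)) * (\<Prod>i<K. hfun p (\<alpha> i + int (\<pi> i) + 1)))"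
      by (simp only: mult.left_commute)
  qed simp
  also have "\<dots> = (\<Sum>\<pi> | \<pi> permutes {0..<K}. of_int (sign \<pi>) *
      (\<Sum>n=1..B. p n * (\<Sum>i<K. \<Prod>j<K. hfun p ((\<alpha>(i := \<alpha> i - int n)) j + int (\<pi> j) + 1))))"
    by (rule sum.cong) (use row in auto)
  also have "\<dots> = (\<Sum>n=1..B. p n * (\<Sum>i<K. jt K p (\<alpha>(i := \<alpha> i - int n))))"
    unfolding jt_leibniz sum_distrib_left
    by (subst sum.swap, rule sum.cong[OF refl], subst sum.swap) (simp add: mult.left_commute)
  also have "\<dots> = (\<Sum>n=1..d. p n * (\<Sum>i<K. jt K p (\<alpha>(i := \<alpha> i - int n))))"
  proof (rule sum.mono_neutral_right)
    show "\<forall>n\<in>{1..B} - {1..d}. p n * (\<Sum>i<K. jt K p (\<alpha>(i := \<alpha> i - int n))) = 0"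
    proof
      fix n assume n: "n \<in> {1..B} - {1..d}"
      have "degree_seq K (\<alpha>(i := \<alpha> i - int n)) = int d - int n" if "i < K" for i
      proof -
        have "degree_seq K (\<alpha>(i := \<alpha> i - int n)) = (\<Sum>j<K. (\<alpha> j + int j + 1) - (if j = i then int n else 0))"
          unfolding degree_seq_def by (rule sum.cong) auto
        also have "\<dots> = int d - int n"
          using that by (simp add: sum_subtractf d[symmetric] degree_seq_def)
        finally show ?thesis .
      qed
      then have "jt K p (\<alpha>(i := \<alpha> i - int n)) = 0" if "i < K" for i
        using that n by (intro jt_negative_degree) auto
      then show "p n * (\<Sum>i<K. jt K p (\<alpha>(i := \<alpha> i - int n))) = 0" by simp
    qed
  qed (auto simp: B_def)
  finally show ?thesis .
qed

lemma jt_swap: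
  "jt (length (xs @ [b, a] @ ys)) p (\<lambda>i. (xs @ [b, a] @ ys) ! i)
    = - jt (length (xs @ [a, b] @ ys)) p (\<lambda>i. (xs @ [a, b] @ ys) ! i)"
proof -
  let ?i = "length xs" and ?j = "Suc (length xs)" and ?K = "length (xs @ [a, b] @ ys)"
  have "(xs @ [b, a] @ ys) ! k = (xs @ [a, b] @ ys) ! Transposition.transpose ?i ?j k" for k
    by (auto simp: Transposition.transpose_def nth_append nth_Cons split: nat.splits)
  then have "jt ?K p (\<lambda>i. (xs @ [b, a] @ ys) ! i)
      = fdet ?K (\<lambda>k. (\<lambda>i j. hfun p ((xs @ [a, b] @ ys) ! i + int j + 1)) (Transposition.transpose ?i ?j k))"
    by (simp only: jt_def)
  also have "\<dots> = - jt ?K p (\<lambda>i. (xs @ [a, b] @ ys) ! i)"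
    unfolding jt_def by (rule fdet_swap_rows) auto
  finally show ?thesis by simp
qed

context fermion_fock
begin

text \<open>\<open>sea N\<close> is the vacuum with its \<open>N\<close> topmost occupied levels emptied.\<close>

fun sea :: "nat \<Rightarrow> 'v" where
  "sea 0 = vac"
| "sea (Suc N) = an (- int (Suc N)) (sea N)"

text \<open>As many levels are filled as the sea has lost, so the charge is 0. The list holds the
  first factors of a semi-infinite wedge and the sea is its tail.\<close>

definition wedge :: "int list \<Rightarrow> 'v" where
  "wedge \<alpha> = foldr cr \<alpha> (sea (length \<alpha>))"

lemma cr_sea: "k < - int N \<Longrightarrow> cr k (sea N) = 0"
proof (induction N)
  case (Suc N)
  then have "cr k (sea N) = 0" by simp
  then show ?case using an_cr[of "- int (Suc N)" k "sea N"] Suc.prems by auto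
qed (simp add: cr_vac)

lemma an_sea: "- int N \<le> k \<Longrightarrow> an k (sea N) = 0"
proof (induction N)
  case (Suc N)
  then show ?case
    by (cases "k = - int (Suc N)") (auto simp: an_an[of k])
qed (simp add: an_vac)

lemma cr_sea_Suc: "cr (- int (Suc N)) (sea (Suc N)) = sea N"
  using an_cr[of "- int (Suc N)" "- int (Suc N)" "sea N"] cr_sea[of "- int (Suc N)" N] by simp

text \<open>Commuting the boson past an emptying mode leaves the mode of a higher level, which is
  already empty.\<close>

lemma boson_sea: "0 < n \<Longrightarrow> boson n (sea N) = 0"
proof (induction N)
  case (Suc N)
  then show ?case using an_sea[of N "- int (Suc N) + n"] by (simp add: boson_an)
qed (simp add: boson_vac)

lemma boson_foldr:
  assumes "n \<noteq> 0"
  shows "boson n (foldr cr \<alpha> v) = foldr cr \<alpha> (boson n v) + (\<Sum>i<length \<alpha>. foldr cr (\<alpha>[i := \<alpha> ! i - n]) v)"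
proof (induction \<alpha>)
  case (Cons a \<alpha>)
  then show ?case
    using assms by (simp add: boson_cr cr_sum sum.lessThan_Suc_shift add.commute add.left_commute del: sum.lessThan_Suc)
qed simp

lemma foldr_cr_0 [simp]: "foldr cr \<alpha> 0 = 0"
  by (induction \<alpha>) auto

lemma boson_wedge: "0 < n \<Longrightarrow> boson n (wedge \<alpha>) = (\<Sum>i<length \<alpha>. wedge (\<alpha>[i := \<alpha> ! i - n]))"
  by (simp add: wedge_def boson_foldr boson_sea)

lemma cr_foldr_mem: "k \<in> set \<alpha> \<Longrightarrow> cr k (foldr cr \<alpha> v) = 0"
  by (induction \<alpha>) (auto simp: cr_cr[of k])

lemma cr_foldr: "cr k (foldr cr \<alpha> v) = scale ((-1) ^ length \<alpha>) (foldr cr \<alpha> (cr k v))"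
  by (induction \<alpha>) (auto simp: cr_cr[of k])

lemma an_foldr: "k \<notin> set \<alpha> \<Longrightarrow> an k (foldr cr \<alpha> v) = scale ((-1) ^ length \<alpha>) (foldr cr \<alpha> (an k v))"
  by (induction \<alpha>) (auto simp: an_cr)

lemma cr_wedge: "k \<in> set \<alpha> \<or> k < - int (length \<alpha>) \<Longrightarrow> cr k (wedge \<alpha>) = 0"
  unfolding wedge_def using cr_foldr_mem cr_foldr cr_sea by auto

lemma an_wedge: "k \<notin> set \<alpha> \<Longrightarrow> - int (length \<alpha>) \<le> k \<Longrightarrow> an k (wedge \<alpha>) = 0"
  unfolding wedge_def by (simp add: an_foldr an_sea)

lemma foldr_cr_swap: "foldr cr (xs @ [b, a] @ ys) v = - foldr cr (xs @ [a, b] @ ys) v"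
proof (induction xs)
  case Nil
  show ?case using cr_cr[of b a] by simp
qed simp

lemma wedge_swap: "wedge (xs @ [b, a] @ ys) = - wedge (xs @ [a, b] @ ys)"
  unfolding wedge_def using foldr_cr_swap[of xs b a ys] by simp

lemma wedge_not_distinct: "\<not> distinct \<alpha> \<Longrightarrow> wedge \<alpha> = 0"
proof -
  assume "\<not> distinct \<alpha>"
  then obtain xs ys zs k where \<alpha>: "\<alpha> = xs @ [k] @ ys @ [k] @ zs"
    using not_distinct_decomp by blast
  have 0: "wedge ([k, k] @ xs @ ys @ zs) = 0" by (simp add: wedge_def)
  show ?thesis
  proof (rule adjacent_swap_induct[where P = "\<lambda>\<alpha>. wedge \<alpha> = 0", OF _ 0])
    show "wedge (xs @ [b, a] @ ys) = 0" if "wedge (xs @ [a, b] @ ys) = 0" for xs a b ys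
      using that wedge_swap[of xs b a ys] by simp
  qed (simp add: \<alpha>)
qed

lemma wedge_below: "\<exists>k\<in>set \<alpha>. k < - int (length \<alpha>) \<Longrightarrow> wedge \<alpha> = 0"
proof -
  assume "\<exists>k\<in>set \<alpha>. k < - int (length \<alpha>)"
  then obtain xs k ys where \<alpha>: "\<alpha> = xs @ k # ys" "k < - int (length \<alpha>)"
    by (metis split_list)
  define N where "N = length \<alpha>"
  have "cr k (foldr cr ys (sea N)) = 0"
    using cr_foldr[of k ys "sea N"] cr_sea[of k N] \<alpha>(2) by (simp add: N_def)
  then show ?thesis unfolding wedge_def N_def[symmetric] by (simp add: \<alpha>(1))
qed

lemma sea_nonzero: "sea N \<noteq> 0"
proof (induction N)
  case (Suc N)
  then show ?case using cr_sea_Suc[of N] by auto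
qed (simp add: vac_nonzero)

text \<open>Emptying the listed levels one by one leads back to the sea, and refilling the sea leads
  back to the vacuum.\<close>

lemma wedge_nonzero:
  assumes "distinct \<alpha>" "\<And>k. k \<in> set \<alpha> \<Longrightarrow> - int (length \<alpha>) \<le> k"
  shows "wedge \<alpha> \<noteq> 0"
proof -
  have "foldr cr \<beta> (sea N) \<noteq> 0" if "distinct \<beta>" "\<And>k. k \<in> set \<beta> \<Longrightarrow> - int N \<le> k" for \<beta> N
    using that
  proof (induction \<beta>)
    case (Cons k \<beta>)
    then have "an k (foldr cr \<beta> (sea N)) = 0" by (simp add: an_foldr an_sea)
    then have "an k (cr k (foldr cr \<beta> (sea N))) = foldr cr \<beta> (sea N)"
      by (simp add: an_cr)
    then show ?case using Cons by auto
  qed (simp add: sea_nonzero)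
  then show ?thesis using assms by (simp add: wedge_def)
qed

end

section \<open>Maya diagrams and sorted wedges\<close>

definition betas :: "nat \<Rightarrow> partition \<Rightarrow> int list" where
  "betas N la = map (beta la) [0..<N]"

lemma length_betas [simp]: "length (betas N la) = N"
  by (simp add: betas_def)

lemma betas_nth [simp]: "i < N \<Longrightarrow> betas N la ! i = beta la i"
  by (simp add: betas_def)

lemma beta_ge: "- int i - 1 \<le> beta la i"
  by (simp add: beta_def)

lemma beta_tail: "plen la \<le> i \<Longrightarrow> beta la i = - int i - 1"
  by (simp add: beta_def part_eq_0)

lemma distinct_betas: "distinct (betas N la)"
  unfolding betas_def using inj_beta by (auto simp: distinct_map intro: inj_on_subset)

lemma betas_ge: "k \<in> set (betas N la) \<Longrightarrow> - int N \<le> k"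
proof -
  assume "k \<in> set (betas N la)"
  then obtain i where "i < N" "k = beta la i" by (auto simp: betas_def)
  then show ?thesis using beta_ge[of i la] by simp
qed

definition maya :: "partition \<Rightarrow> int set" where
  "maya la = range (beta la)"

text \<open>Both sequences enumerate the same set in decreasing order, so they agree entry by
  entry.\<close>

lemma maya_inj:
  assumes "maya la = maya \<mu>"
  shows "la = \<mu>"
proof -
  have le: "beta la i \<le> beta \<mu> i" if "maya la = maya \<mu>" "\<And>j. j < i \<Longrightarrow> beta la j = beta \<mu> j" for la \<mu> i
  proof -
    have "beta la i \<in> maya la" by (simp add: maya_def)
    then have "beta la i \<in> maya \<mu>" by (simp only: that(1))
    then obtain m where m: "beta la i = beta \<mu> m" unfolding maya_def by (rule rangeE)
    have "\<not> m < i"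
    proof
      assume "m < i"
      then show False using that(2)[of m] m beta_less[of m i la] by simp
    qed
    then show ?thesis using m beta_less[of i m \<mu>] by (cases "m = i") auto
  qed
  have eq: "beta la i = beta \<mu> i" for i
  proof (induction i rule: less_induct)
    case (less i)
    show ?case by (rule antisym; rule le) (use assms less in auto)
  qed
  show ?thesis
  proof (rule partition_eqI)
    fix i :: nat assume "1 \<le> i"
    then show "part la i = part \<mu> i" using eq[of "i - 1"] by (simp add: beta_def)
  qed
qed

lemma degree_betas:
  assumes "plen la \<le> N"
  shows "degree_seq N (beta la) = int (psize la)"
proof -
  have "degree_seq N (beta la) = (\<Sum>i<N. int (part la (Suc i)))"
    by (simp add: degree_seq_def beta_def)
  also have "\<dots> = int (\<Sum>i=1..N. part la i)"
    unfolding of_nat_sum by (rule sum.reindex_bij_witness[of _ "\<lambda>i. i - 1" Suc]) auto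
  finally show ?thesis by (simp add: psize_eq[OF assms])
qed

text \<open>The list is sorted decreasingly. As its N entries are distinct and at least -N, entry i,
  counted from 0, is at least - i - 1, and the excess is the part.\<close>

lemma ex_betas:
  assumes "distinct \<alpha>" "\<And>k. k \<in> set \<alpha> \<Longrightarrow> - int (length \<alpha>) \<le> k"
  obtains la where "plen la \<le> length \<alpha>" "mset (betas (length \<alpha>) la) = mset \<alpha>"
proof -
  define N where "N = length \<alpha>"
  define ds where "ds = rev (sort \<alpha>)"
  have len: "length ds = N" by (simp add: ds_def N_def)
  have dec: "ds ! j < ds ! i" if "i < j" "j < N" for i j
  proof -
    have "sorted_wrt (<) (sort \<alpha>)" using assms(1) by (simp add: strict_sorted_iff)
    then have "sorted_wrt (>) ds" by (simp add: ds_def sorted_wrt_rev)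
    then show ?thesis using that len by (simp add: sorted_wrt_iff_nth_less)
  qed
  have ge: "- int N + int m \<le> ds ! (N - 1 - m)" if "m < N" for m
    using that
  proof (induction m)
    case 0
    then have "ds ! (N - 1) \<in> set ds" using len by (intro nth_mem) simp
    then show ?case using assms(2) by (simp add: ds_def N_def)
  next
    case (Suc m)
    have "ds ! (N - 1 - m) < ds ! (N - 1 - Suc m)" by (rule dec) (use Suc in auto)
    then show ?case using Suc by simp
  qed
  have ge': "0 \<le> ds ! i + int i + 1" if "i < N" for i
    using ge[of "N - 1 - i"] that by (simp add: of_nat_diff)
  let ?f = "\<lambda>i. if i \<le> N then nat (ds ! (i - 1) + int i) else 0"
  have "?f (Suc i) \<le> ?f i" if "1 \<le> i" for i
  proof (cases "Suc i \<le> N")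
    case True
    then have "ds ! i < ds ! (i - 1)" using that by (intro dec) auto
    then show ?thesis using True by simp
  qed simp
  then obtain la where la: "\<And>i. 1 \<le> i \<Longrightarrow> part la i = ?f i"
    using ex_partition[of ?f N] by auto
  have "plen la \<le> N"
    using la[of "Suc N"] part_eq_0_iff[of "Suc N" la] by simp
  moreover have "betas N la = ds"
  proof (rule nth_equalityI)
    fix i assume "i < length (betas N la)"
    then show "betas N la ! i = ds ! i" using la[of "Suc i"] ge'[of i] by (simp add: beta_def)
  qed (simp add: len)
  ultimately show ?thesis using that[of la] by (simp add: N_def ds_def)
qed

context fermion_fock
begin

text \<open>Beyond the length of the partition the next shifted part is the level emptied last, so
  filling it undoes one step of \<open>sea\<close>.\<close>

lemma wedge_betas_extend:
  assumes "plen la \<le> N"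
  shows "wedge (betas N la) = wedge (betas (plen la) la)"
  using assms
proof (induction N rule: dec_induct)
  case (step N)
  have "beta la N = - int (Suc N)" using beta_tail[of la N] step by simp
  then have "wedge (betas (Suc N) la) = foldr cr (betas N la) (cr (- int (Suc N)) (sea (Suc N)))"
    by (simp add: wedge_def betas_def del: sea.simps of_nat_Suc)
  also have "\<dots> = wedge (betas N la)" unfolding cr_sea_Suc by (simp add: wedge_def)
  finally show ?case using step by simp
qed simp

text \<open>One factor of \<open>ket\<close> in terms of levels: the i-th Frobenius hook moves a
  particle from level i - 1 - la'_i to level la_i - i.\<close>

definition hook_op :: "partition \<Rightarrow> nat \<Rightarrow> 'v \<Rightarrow> 'v" where
  "hook_op la i v = scale ((-1) powi (- int (part la i) + int i))
     (an (int i - 1 - int (part (conj_part la) i)) (cr (int (part la i) - int i) v))"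

lemma ket_hook: "ket la = foldr (hook_op la) [1..<Suc (diag_len la)] vac"
proof -
  have 1: "- of_nat (part (conj_part la) i) + of_nat i - 1/2
      = of_int (int i - 1 - int (part (conj_part la) i)) + (1/2 :: rat)" for i by simp
  have 2: "- of_nat (part la i) + of_nat i - 1/2 = of_int (- (int (part la i) - int i)) - (1/2 :: rat)" for i
    by simp
  show ?thesis unfolding ket_def hook_op_def an_def cr_def 1 2 ..
qed

lemma minus_one_powi: "(-1 :: complex) powi (1 - int m) = - ((-1) ^ m)"
proof -
  have "(-1 :: complex) powi (1 - int m) * (-1) ^ m = -1"
    using power_int_add[of "-1 :: complex" "1 - int m" "int m"] by simp
  then show ?thesis by (cases "even m") simp_all
qed

text \<open>Peel off the first hook: deleting the first row and the first column of \<open>la\<close> shifts the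
  remaining Frobenius coordinates by one.\<close>

lemma ket_eq_wedge_plen: "ket la = scale ((-1) ^ psize la) (wedge (betas (plen la) la))"
proof (induction "plen la" arbitrary: la rule: less_induct)
  case less
  show ?case
  proof (cases "plen la = 0")
    case True
    then have la: "la = empty_part" by (simp add: plen_eq_0_iff)
    have "{i. 1 \<le> i \<and> i \<le> part la i} = {}" by (auto simp: la)
    then have "diag_len la = 0" by (simp only: diag_len_def card.empty)
    then show ?thesis by (simp add: ket_hook wedge_def betas_def la)
  next
    case False
    define L where "L = plen la"
    have L: "1 \<le> L" using False by (simp add: L_def)
    have pos: "1 \<le> part la i" if "1 \<le> i" "i \<le> L" for i
      using part_eq_0_iff[of i la] that by (simp add: L_def)
    have z: "part la i = 0" if "L < i" for i using that by (simp add: L_def part_eq_0)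
    have a: "part la (Suc (Suc i)) - 1 \<le> part la (Suc i) - 1" if "1 \<le> i" for i
      by (intro diff_le_mono part_antimono) auto
    have b: "part la (Suc i) - 1 = 0" if "L < i" for i using z[of "Suc i"] that by simp
    have "\<exists>\<nu>. \<forall>i\<ge>1. part \<nu> i = part la (Suc i) - 1"
    proof (rule ex_partition[of "\<lambda>i. part la (Suc i) - 1" L])
      fix \<nu> assume "\<And>i. 1 \<le> i \<Longrightarrow> part \<nu> i = part la (Suc i) - 1"
      then show "\<exists>\<nu>. \<forall>i\<ge>1. part \<nu> i = part la (Suc i) - 1" by (intro exI[of _ \<nu>]) simp
    qed (rule a, assumption, rule b, assumption)
    then obtain \<nu> where \<nu>: "\<And>i. 1 \<le> i \<Longrightarrow> part \<nu> i = part la (Suc i) - 1" by auto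
    have \<nu>L: "part \<nu> L = 0" using \<nu>[OF L] z[of "Suc L"] by simp
    then have pl: "plen \<nu> < L" using part_eq_0_iff[OF L, of \<nu>] by simp
    \<comment> \<open>The wedge of \<open>\<nu>\<close> is written with L entries, although
      \<open>\<nu>\<close> is shorter, to match the length of the one for \<open>la\<close>.\<close>
    have IH: "ket \<nu> = scale ((-1) ^ psize \<nu>) (wedge (betas L \<nu>))"
      using less[of \<nu>] pl wedge_betas_extend[of \<nu> L] by (simp add: L_def)
    have conj: "part (conj_part \<nu>) j = part (conj_part la) (Suc j) - 1" if j: "1 \<le> j" for j
    proof (rule part_eqI_le)
      fix k :: nat assume k: "1 \<le> k"
      have "k \<le> part (conj_part \<nu>) j \<longleftrightarrow> j \<le> part la (Suc k) - 1"
        using le_part_conj_iff[OF k j, of \<nu>] \<nu>[OF k] by simp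
      also have "\<dots> \<longleftrightarrow> Suc j \<le> part la (Suc k)" using j by auto
      also have "\<dots> \<longleftrightarrow> Suc k \<le> part (conj_part la) (Suc j)" by (simp add: le_part_conj_iff)
      also have "\<dots> \<longleftrightarrow> k \<le> part (conj_part la) (Suc j) - 1" using k by auto
      finally show "k \<le> part (conj_part \<nu>) j \<longleftrightarrow> k \<le> part (conj_part la) (Suc j) - 1" .
    qed
    let ?D = "\<lambda>\<mu>. {i. 1 \<le> i \<and> i \<le> part \<mu> i}"
    have finD: "finite (?D \<mu>)" for \<mu>
    proof (rule finite_subset)
      show "?D \<mu> \<subseteq> {..part \<mu> 1}" using part_antimono[of 1 _ \<mu>] le_trans by blast
    qed simp
    have "?D la = insert 1 (Suc ` ?D \<nu>)"
    proof (rule Set.set_eqI)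
      fix i show "i \<in> ?D la \<longleftrightarrow> i \<in> insert 1 (Suc ` ?D \<nu>)"
      proof (cases i)
        case (Suc m)
        then show ?thesis using pos[of 1] L \<nu>[of m] by (cases "m = 0") auto
      qed auto
    qed
    then have "diag_len la = card (insert 1 (Suc ` ?D \<nu>))" by (simp only: diag_len_def)
    also have "\<dots> = Suc (card (Suc ` ?D \<nu>))"
      by (rule card_insert_disjoint) (use finD[of \<nu>] in auto)
    also have "card (Suc ` ?D \<nu>) = diag_len \<nu>" by (simp add: card_image diag_len_def)
    finally have d: "diag_len la = Suc (diag_len \<nu>)" .
    have D\<nu>: "?D \<nu> = {1..diag_len \<nu>}"
      unfolding diag_len_def
    proof (rule down_closed_eq_interval)
      fix j k assume "j \<in> ?D \<nu>" "1 \<le> k" "k < j"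
      then show "k \<in> ?D \<nu>" using part_antimono[of k j \<nu>] by simp
    qed (use finD in auto)
    \<comment> \<open>On the diagonal of \<open>\<nu>\<close> the truncated subtraction is a true
      one, so the hooks of \<open>\<nu>\<close> are those of \<open>la\<close> from the second
      on.\<close>
    have op: "hook_op la (Suc i) = hook_op \<nu> i" if "i \<in> {1..diag_len \<nu>}" for i
    proof -
      have "i \<in> ?D \<nu>" unfolding D\<nu> by (rule that)
      then have i: "1 \<le> i" "i \<le> part \<nu> i" by auto
      then have i': "i \<le> part (conj_part \<nu>) i" by (simp add: le_part_conj_iff)
      have 1: "int (part la (Suc i)) = int (part \<nu> i) + 1" using \<nu>[OF i(1)] i by linarith
      have 2: "int (part (conj_part la) (Suc i)) = int (part (conj_part \<nu>) i) + 1"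
        using conj[OF i(1)] i i' by linarith
      have e1: "int (Suc i) - 1 - int (part (conj_part la) (Suc i)) = int i - 1 - int (part (conj_part \<nu>) i)"
        using 2 by simp
      have e2: "int (part la (Suc i)) - int (Suc i) = int (part \<nu> i) - int i" using 1 by simp
      have e3: "- int (part la (Suc i)) + int (Suc i) = - int (part \<nu> i) + int i" using 1 by simp
      show ?thesis unfolding fun_eq_iff hook_op_def e1 e2 e3 by simp
    qed
    have "[1..<Suc (diag_len la)] = 1 # map Suc [1..<Suc (diag_len \<nu>)]"
      unfolding d map_Suc_upt by (simp add: upt_conv_Cons del: upt_Suc)
    then have "ket la = hook_op la 1 (foldr (hook_op la \<circ> Suc) [1..<Suc (diag_len \<nu>)] vac)"
      unfolding ket_hook by (simp add: foldr_map del: upt_Suc)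
    also have "foldr (hook_op la \<circ> Suc) [1..<Suc (diag_len \<nu>)] vac = ket \<nu>"
      unfolding ket_hook by (rule foldr_cong) (auto simp: op simp del: upt_Suc)
    finally have k: "ket la = hook_op la 1 (ket \<nu>)" .
    \<comment> \<open>Deleting a row and a column only renumbers the shifted parts; the last entry
      \<open>- L\<close> belongs to an empty row of \<open>\<nu>\<close>.\<close>
    have shift: "beta la 0 # betas L \<nu> = betas L la @ [- int L]"
    proof (rule nth_equalityI)
      fix i assume "i < length (beta la 0 # betas L \<nu>)"
      then have i: "i \<le> L" by simp
      have "i \<noteq> 0 \<Longrightarrow> i < L \<Longrightarrow> int (part \<nu> i) = int (part la (Suc i)) - 1"
        using \<nu>[of i] pos[of "Suc i"] by auto
      then show "(beta la 0 # betas L \<nu>) ! i = (betas L la @ [- int L]) ! i"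
        using i \<nu>L L by (cases i) (auto simp: nth_append beta_def less_Suc_eq_le)
    qed simp
    \<comment> \<open>All L rows of \<open>la\<close> are nonempty, so no shifted part reaches down
      to \<open>- L\<close>, and the emptying mode passes through the filled levels with sign
      (-1)^L.\<close>
    have nm: "- int L \<notin> set (betas L la)"
    proof
      assume "- int L \<in> set (betas L la)"
      then obtain i where "i < L" "beta la i = - int L" by (auto simp: betas_def)
      then show False using pos[of "Suc i"] by (simp add: beta_def)
    qed
    obtain L' where L': "L = Suc L'" using L by (cases L) auto
    have "an (- int L) (cr (beta la 0) (wedge (betas L \<nu>))) = an (- int L) (foldr cr (beta la 0 # betas L \<nu>) (sea L))"
      by (simp add: wedge_def)
    also have "\<dots> = an (- int L) (foldr cr (betas L la) (cr (- int L) (sea L)))"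
      unfolding shift by simp
    also have "\<dots> = scale ((-1) ^ L) (foldr cr (betas L la) (an (- int L) (cr (- int L) (sea L))))"
      using an_foldr[OF nm] by simp
    also have "an (- int L) (cr (- int L) (sea L)) = sea L"
      unfolding L' cr_sea_Suc by simp
    finally have w: "an (- int L) (cr (beta la 0) (wedge (betas L \<nu>))) = scale ((-1) ^ L) (wedge (betas L la))"
      by (simp add: wedge_def)
    have conj1: "part (conj_part la) 1 = L" by (simp add: L_def plen_def)
    have "ket la = scale ((-1) powi (1 - int (part la 1)) * (-1) ^ psize \<nu> * (-1) ^ L) (wedge (betas L la))"
      using w unfolding k hook_op_def IH conj1 by (simp add: beta_def mult.assoc)
    \<comment> \<open>The cells of \<open>la\<close> are those of the first row, those of
      \<open>\<nu>\<close> and the other L - 1 cells of the first column.\<close>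
    moreover have "(-1 :: complex) powi (1 - int (part la 1)) * (-1) ^ psize \<nu> * (-1) ^ L = (-1) ^ psize la"
    proof -
      have "psize la = (\<Sum>i\<in>{1..Suc L'}. part la i)" using psize_eq[of la L] by (simp add: L_def[symmetric] L')
      also have "\<dots> = part la 1 + (\<Sum>i\<in>{1..L'}. part la (Suc i))"
        using sum.atLeast_Suc_atMost[of 1 "Suc L'" "part la"] sum.shift_bounds_cl_Suc_ivl[of "part la" 1 L'] by simp
      also have "(\<Sum>i\<in>{1..L'}. part la (Suc i)) = (\<Sum>i\<in>{1..L'}. part \<nu> i + 1)"
      proof (rule sum.cong)
        fix i assume "i \<in> {1..L'}"
        then show "part la (Suc i) = part \<nu> i + 1" using \<nu>[of i] pos[of "Suc i"] L' by auto
      qed simp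
      also have "\<dots> = psize \<nu> + L'"
      proof -
        have "psize \<nu> = (\<Sum>i\<in>{1..L'}. part \<nu> i)"
          by (rule psize_eq) (use pl L' in linarith)
        then show ?thesis unfolding sum.distrib by simp
      qed
      finally have "psize la = part la 1 + (psize \<nu> + L')" .
      then show ?thesis unfolding minus_one_powi L' by (simp add: power_add)
    qed
    ultimately show ?thesis by (simp add: L_def)
  qed
qed

lemma ket_eq_wedge: "plen la \<le> N \<Longrightarrow> ket la = scale ((-1) ^ psize la) (wedge (betas N la))"
  using ket_eq_wedge_plen[of la] wedge_betas_extend[of la N] by simp

lemma cr_ket: "k \<in> maya la \<Longrightarrow> cr k (ket la) = 0"
proof -
  assume "k \<in> maya la"
  then obtain i where "k = beta la i" by (auto simp: maya_def)
  then have "k \<in> set (betas (max (plen la) (Suc i)) la)" by (simp add: betas_def)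
  then show ?thesis
    using ket_eq_wedge[of la "max (plen la) (Suc i)"] by (simp add: cr_wedge)
qed

lemma an_ket: "k \<notin> maya la \<Longrightarrow> an k (ket la) = 0"
proof -
  assume k: "k \<notin> maya la"
  let ?N = "max (plen la) (nat (- k))"
  have "k \<notin> set (betas ?N la)" using k by (auto simp: betas_def maya_def)
  moreover have "- int ?N \<le> k" by simp
  ultimately have "an k (wedge (betas ?N la)) = 0" by (intro an_wedge) auto
  then show ?thesis using ket_eq_wedge[of la ?N] by simp
qed

lemma number_ket: "cr k (an k (ket la)) = (if k \<in> maya la then ket la else 0)"
  using an_cr[of k k "ket la"] cr_ket[of k la] an_ket[of k la] by auto

lemma ket_nonzero: "ket la \<noteq> 0"
  using wedge_nonzero[OF distinct_betas, of "plen la" la] betas_ge[of _ "plen la" la]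
  by (simp add: ket_eq_wedge_plen)

text \<open>Different partitions differ in the occupation of some level k. The number operator of
  that level splits a linear relation into one for each occupation, and both parts involve fewer
  kets.\<close>

lemma kets_independent_aux:
  assumes "finite F" "(\<Sum>la\<in>F. scale (u la) (ket la)) = 0" "la \<in> F"
  shows "u la = 0"
  using assms
proof (induction F arbitrary: la rule: finite_psubset_induct)
  case (psubset F)
  show ?case
  proof (cases "F = {la}")
    case True
    then show ?thesis using psubset.prems ket_nonzero by simp
  next
    case False
    then obtain \<mu> where \<mu>: "\<mu> \<in> F" "\<mu> \<noteq> la" using psubset.prems by auto
    then obtain k where k: "k \<in> maya la \<longleftrightarrow> k \<notin> maya \<mu>" using maya_inj[of la \<mu>] by auto
    have "cr k (an k (\<Sum>la\<in>F. scale (u la) (ket la))) = 0" unfolding psubset.prems by simp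
    then have "(\<Sum>la\<in>F. if k \<in> maya la then scale (u la) (ket la) else 0) = 0"
      by (simp add: an_sum cr_sum number_ket if_distrib cong: if_cong)
    then have s1: "(\<Sum>la\<in>{la\<in>F. k \<in> maya la}. scale (u la) (ket la)) = 0"
      using psubset.hyps by (simp add: sum.inter_filter)
    moreover have "(\<Sum>la\<in>F. scale (u la) (ket la)) = (\<Sum>la\<in>{la\<in>F. k \<in> maya la}. scale (u la) (ket la))
        + (\<Sum>la\<in>{la\<in>F. k \<notin> maya la}. scale (u la) (ket la))"
      using psubset.hyps by (subst sum.union_disjoint[symmetric]) (auto intro!: sum.cong)
    ultimately have s2: "(\<Sum>la\<in>{la\<in>F. k \<notin> maya la}. scale (u la) (ket la)) = 0"
      using psubset.prems by simp
    show ?thesis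
    proof (cases "k \<in> maya la")
      case True
      then show ?thesis
        by (intro psubset.IH[OF _ s1]) (use \<mu> k psubset.prems in auto)
    next
      case False
      then show ?thesis
        by (intro psubset.IH[OF _ s2]) (use \<mu> k psubset.prems in auto)
    qed
  qed
qed

lemma inj_ket: "inj ket"
proof (rule injI, rule ccontr)
  fix la \<mu> assume eq: "ket la = ket \<mu>" and ne: "la \<noteq> \<mu>"
  have "(\<Sum>\<nu>\<in>{la, \<mu>}. scale (if \<nu> = la then 1 else -1) (ket \<nu>)) = 0"
    using eq ne by simp
  from kets_independent_aux[OF _ this, of la] show False by simp
qed

lemma independent_kets: "independent (range ket)"
  unfolding independent_explicit_finite_subsets
proof (intro allI impI ballI)
  fix S u v assume S: "S \<subseteq> range ket" "finite S" and sum: "(\<Sum>v\<in>S. scale (u v) v) = 0" and v: "v \<in> S"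
  obtain F where F: "S = ket ` F" using S(1) by (auto simp: subset_image_iff)
  have inj: "inj_on ket F" using inj_ket by (rule inj_on_subset) simp
  then have "finite F" using S F finite_imageD by blast
  moreover have "(\<Sum>la\<in>F. scale (u (ket la)) (ket la)) = 0"
    using sum unfolding F by (simp add: sum.reindex[OF inj])
  ultimately show "u v = 0" using kets_independent_aux[of F "\<lambda>la. u (ket la)"] v F by auto
qed

text \<open>\<open>bra\<close> is linear on this space; outside it \<open>representation\<close> has
  the default value 0.\<close>

definition kets_span :: "'v set" where
  "kets_span = span (range ket)"

lemma ket_in_span [simp]: "ket la \<in> kets_span"
  unfolding kets_span_def by (rule span_base) simp

lemma bra_ket: "bra la (ket \<mu>) = (if la = \<mu> then 1 else 0)"
proof -
  have "representation (range ket) (ket \<mu>) = (\<lambda>v. if v = ket \<mu> then 1 else 0)"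
    by (rule representation_basis[OF independent_kets]) simp
  then show ?thesis unfolding bra_def using inj_ket by (auto dest: injD)
qed

lemma bra_add: "v \<in> kets_span \<Longrightarrow> w \<in> kets_span \<Longrightarrow> bra la (v + w) = bra la v + bra la w"
  unfolding bra_def kets_span_def by (simp add: representation_add[OF independent_kets])

lemma bra_scale: "v \<in> kets_span \<Longrightarrow> bra la (scale c v) = c * bra la v"
  unfolding bra_def kets_span_def by (simp add: representation_scale[OF independent_kets])

lemma bra_0 [simp]: "bra la 0 = 0"
  by (simp add: bra_def representation_zero)

lemma wedge_perm:
  assumes "mset \<alpha> = mset \<beta>"
  shows "wedge \<alpha> = wedge \<beta> \<or> wedge \<alpha> = - wedge \<beta>"
proof (rule adjacent_swap_induct[where P = "\<lambda>\<alpha>. wedge \<alpha> = wedge \<beta> \<or> wedge \<alpha> = - wedge \<beta>", OF _ _ assms])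
  fix xs a b ys assume "wedge (xs @ [a, b] @ ys) = wedge \<beta> \<or> wedge (xs @ [a, b] @ ys) = - wedge \<beta>"
  then show "wedge (xs @ [b, a] @ ys) = wedge \<beta> \<or> wedge (xs @ [b, a] @ ys) = - wedge \<beta>"
    unfolding wedge_swap[of xs b a ys] by auto
qed simp

lemma wedge_cases:
  obtains (zero) "wedge \<alpha> = 0" "\<not> distinct \<alpha> \<or> (\<exists>k\<in>set \<alpha>. k < - int (length \<alpha>))"
  | (ket) la \<epsilon> where "plen la \<le> length \<alpha>" "mset (betas (length \<alpha>) la) = mset \<alpha>"
      "wedge \<alpha> = scale \<epsilon> (ket la)" "\<epsilon> = 1 \<or> \<epsilon> = -1"
proof (cases "distinct \<alpha> \<and> (\<forall>k\<in>set \<alpha>. - int (length \<alpha>) \<le> k)")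
  case False
  then show ?thesis using zero wedge_not_distinct[of \<alpha>] wedge_below[of \<alpha>] by (auto simp: not_le)
next
  case True
  then obtain la where la: "plen la \<le> length \<alpha>" "mset (betas (length \<alpha>) la) = mset \<alpha>"
    using ex_betas[of \<alpha>] by auto
  have k: "wedge (betas (length \<alpha>) la) = scale ((-1) ^ psize la) (ket la)"
    using ket_eq_wedge[OF la(1)] by (simp add: power_mult_distrib[symmetric])
  from wedge_perm[OF la(2)[symmetric]] show ?thesis
  proof
    assume "wedge \<alpha> = wedge (betas (length \<alpha>) la)"
    then show ?thesis using ket[OF la, of "(-1) ^ psize la"] k by (cases "even (psize la)") auto
  next
    assume "wedge \<alpha> = - wedge (betas (length \<alpha>) la)"
    then show ?thesis using ket[OF la, of "- ((-1) ^ psize la)"] k by (cases "even (psize la)") auto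
  qed
qed

lemma wedge_in_span [simp]: "wedge \<alpha> \<in> kets_span"
  by (rule wedge_cases[of \<alpha>]) (auto simp: kets_span_def intro: span_zero span_scale span_base)

text \<open>Both sides alternate under exchange of neighbouring entries and vanish for repeated or
  too low ones, so only the sorted lists of shifted parts remain to be compared.\<close>

lemma bra_empty_wedge: "bra empty_part (wedge \<alpha>) = jt (length \<alpha>) (\<lambda>_. 0) (\<lambda>i. \<alpha> ! i)"
proof (cases rule: wedge_cases[of \<alpha>])
  case zero
  have "jt (length \<alpha>) (\<lambda>_. 0) (\<lambda>i. \<alpha> ! i) = 0"
    using zero(2)
  proof
    assume "\<not> distinct \<alpha>"
    then obtain i j where "i < length \<alpha>" "j < length \<alpha>" "i \<noteq> j" "\<alpha> ! i = \<alpha> ! j"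
      by (auto simp: distinct_conv_nth)
    then show ?thesis by (rule jt_eq_0_dup)
  next
    assume "\<exists>k\<in>set \<alpha>. k < - int (length \<alpha>)"
    then obtain i where "i < length \<alpha>" "\<alpha> ! i < - int (length \<alpha>)" by (auto simp: in_set_conv_nth)
    then show ?thesis by (rule jt_eq_0_row)
  qed
  then show ?thesis using zero(1) by simp
next
  case (ket la \<epsilon>)
  let ?P = "\<lambda>\<alpha>. bra empty_part (wedge \<alpha>) = jt (length \<alpha>) (\<lambda>_. 0) (\<lambda>i. \<alpha> ! i)"
  show ?thesis
  proof (rule adjacent_swap_induct[where P = ?P, OF _ _ ket(2)[symmetric]])
    fix xs a b ys assume "?P (xs @ [a, b] @ ys)"
    moreover have "bra empty_part (- wedge (xs @ [a, b] @ ys)) = - bra empty_part (wedge (xs @ [a, b] @ ys))"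
      using bra_scale[of "wedge (xs @ [a, b] @ ys)" empty_part "-1"] by simp
    ultimately show "?P (xs @ [b, a] @ ys)" unfolding wedge_swap[of xs b a ys] jt_swap[of xs b a ys] by simp
  next
    have w: "wedge (betas (length \<alpha>) la) = scale ((-1) ^ psize la) (ket la)"
      using ket_eq_wedge[OF ket(1)] by (simp add: power_mult_distrib[symmetric])
    have "jt (length \<alpha>) (\<lambda>_. 0) (\<lambda>i. betas (length \<alpha>) la ! i) = jt (length \<alpha>) (\<lambda>_. 0) (beta la)"
      by (rule jt_cong) simp
    also have "\<dots> = (if la = empty_part then 1 else 0)" by (rule jt_zero[OF ket(1)])
    finally show "?P (betas (length \<alpha>) la)" unfolding w by (auto simp: bra_scale bra_ket)
  qed
qed

end

section \<open>Vertex operators\<close>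

lemma power2_powi: "t\<^sup>2 powi k = (t :: complex) powi (2 * k)"
  by (simp add: power_int_mult)

lemma jt_cong_psum: "(\<And>n. 1 \<le> n \<Longrightarrow> p n = p' n) \<Longrightarrow> jt K p \<alpha> = jt K p' \<alpha>"
proof -
  assume "\<And>n. 1 \<le> n \<Longrightarrow> p n = p' n"
  then have "newton p = newton p'" by (intro ext newton_cong)
  then have "hfun p = hfun p'" by (simp add: hfun_def fun_eq_iff)
  then show ?thesis by (simp add: jt_def)
qed

text \<open>Indices that add up to 0 are either all 0 or include a negative one; in both cases the
  Leibniz term does not depend on the power sums.\<close>

lemma jt_degree_0:
  assumes "degree_seq K \<alpha> = 0"
  shows "jt K p \<alpha> = jt K p' \<alpha>"
  unfolding jt_leibniz
proof (rule sum.cong)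
  fix \<pi> assume "\<pi> \<in> {\<pi>. \<pi> permutes {0..<K}}"
  then have s: "(\<Sum>i<K. \<alpha> i + int (\<pi> i) + 1) = 0" using sum_permuted_degree assms by simp
  have "(\<Prod>i<K. hfun p (\<alpha> i + int (\<pi> i) + 1)) = (\<Prod>i<K. hfun p' (\<alpha> i + int (\<pi> i) + 1))"
  proof (cases "\<exists>i<K. \<alpha> i + int (\<pi> i) + 1 < 0")
    case True
    then obtain i where i: "i < K" "\<alpha> i + int (\<pi> i) + 1 < 0" by blast
    have z: "(\<Prod>i<K. hfun r (\<alpha> i + int (\<pi> i) + 1)) = 0" for r
      by (rule prod_zero) (use i in \<open>auto intro!: bexI[of _ i] simp: hfun_def\<close>)
    show ?thesis by (simp only: z)
  next
    case False
    then have nn: "\<And>i. i \<in> {..<K} \<Longrightarrow> 0 \<le> \<alpha> i + int (\<pi> i) + 1" by force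
    have "\<forall>i\<in>{..<K}. \<alpha> i + int (\<pi> i) + 1 = 0"
      using s by (simp only: sum_nonneg_eq_0_iff[OF finite_lessThan nn])
    then show ?thesis by (intro prod.cong) (auto simp: hfun_def)
  qed
  then show "of_int (sign \<pi>) * (\<Prod>i<K. hfun p (\<alpha> i + int (\<pi> i) + 1))
    = of_int (sign \<pi>) * (\<Prod>i<K. hfun p' (\<alpha> i + int (\<pi> i) + 1))" by simp
qed simp

text \<open>In positive degree the right-hand side of \<open>jt_degree_rec\<close> is 0.\<close>

lemma jt_zero_psum_degree:
  assumes "degree_seq K \<alpha> \<noteq> 0"
  shows "jt K (\<lambda>_. 0) \<alpha> = 0"
proof (cases "degree_seq K \<alpha> < 0")
  case False
  then obtain d where d: "degree_seq K \<alpha> = int d" by (metis nat_0_le not_less)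
  then have "of_nat d * jt K (\<lambda>_. 0) \<alpha> = 0" using jt_degree_rec[OF d, of "\<lambda>_. 0"] by simp
  then show ?thesis using d assms by simp
qed (rule jt_negative_degree)

context fermion_fock
begin

section \<open>Exponentials of bosons acting on bras\<close>

definition bra0 :: "nat \<Rightarrow> 'v \<Rightarrow> complex" where
  "bra0 = (\<lambda>e. if e = 0 then bra empty_part else (\<lambda>_. 0))"

lemma raise_bra_commute: "raise_bra c (raise_bra c' b) = raise_bra c' (raise_bra c b)"
proof (intro ext)
  fix d v
  \<comment> \<open>The range n + m \<le> d is written symmetrically in n and m before the sums are
    exchanged.\<close>
  have tri: "(\<Sum>n=1..d. \<Sum>m=1..d - n. f n m) = (\<Sum>n=1..d. \<Sum>m=1..d. if n + m \<le> d then f n m else 0)"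
    for f :: "nat \<Rightarrow> nat \<Rightarrow> complex"
  proof (rule sum.cong)
    fix n assume "n \<in> {1..d}"
    have "(\<Sum>m=1..d - n. f n m) = (\<Sum>m=1..d - n. if n + m \<le> d then f n m else 0)"
      by (rule sum.cong) auto
    also have "\<dots> = (\<Sum>m=1..d. if n + m \<le> d then f n m else 0)"
      by (rule sum.mono_neutral_left) auto
    finally show "(\<Sum>m=1..d - n. f n m) = (\<Sum>m=1..d. if n + m \<le> d then f n m else 0)" .
  qed simp
  have R: "raise_bra c (raise_bra c' b) d v
      = (\<Sum>n=1..d. \<Sum>m=1..d. if n + m \<le> d then c n * c' m * b (d - n - m) (boson (int m) (boson (int n) v)) else 0)"
    for c c'
    unfolding raise_bra_def sum_distrib_left tri mult.assoc ..
  show "raise_bra c (raise_bra c' b) d v = raise_bra c' (raise_bra c b) d v"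
    unfolding R
    by (subst sum.swap, intro sum.cong refl)
      (auto simp: add.commute boson_commute diff_commute mult.commute)
qed

text \<open>Multiplication by the degree is a derivation: its commutator with
  \<open>raise_bra c\<close> is the raising operator with coefficients n c_n. As raising operators
  commute, a k-th power produces the factor k.\<close>

lemma raise_bra_pow_degree:
  "of_nat d * (raise_bra c ^^ k) bra0 d v
    = of_nat k * raise_bra (\<lambda>n. of_nat n * c n) ((raise_bra c ^^ (k - 1)) bra0) d v"
proof (induction k arbitrary: d v)
  case 0
  then show ?case by (simp add: bra0_def)
next
  case (Suc k)
  let ?R = "raise_bra c" and ?R' = "raise_bra (\<lambda>n. of_nat n * c n)"
  have "of_nat d * (?R ^^ Suc k) bra0 d v = (\<Sum>n=1..d. of_nat d * (c n * (?R ^^ k) bra0 (d - n) (boson (int n) v)))"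
    by (simp add: raise_bra_def sum_distrib_left)
  also have "\<dots> = (\<Sum>n=1..d. of_nat n * c n * (?R ^^ k) bra0 (d - n) (boson (int n) v)
      + c n * (of_nat (d - n) * (?R ^^ k) bra0 (d - n) (boson (int n) v)))"
    by (rule sum.cong) (auto simp: of_nat_diff algebra_simps)
  also have "\<dots> = ?R' ((?R ^^ k) bra0) d v
      + of_nat k * ?R (?R' ((?R ^^ (k - 1)) bra0)) d v"
    unfolding Suc.IH by (simp add: sum.distrib raise_bra_def[of c] raise_bra_def[of "\<lambda>n. of_nat n * c n" "(?R ^^ k) bra0"]
        sum_distrib_left mult.left_commute)
  also have "of_nat k * ?R (?R' ((?R ^^ (k - 1)) bra0)) d v = of_nat k * ?R' ((?R ^^ k) bra0) d v"
    unfolding raise_bra_commute[of c] by (cases k) auto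
  finally show ?case by (simp add: algebra_simps)
qed

lemma raise_bra_pow_eq_0: "d < k \<Longrightarrow> (raise_bra c ^^ k) bra0 d v = 0"
proof (induction k arbitrary: d v)
  case (Suc k)
  have "(raise_bra c ^^ k) bra0 (d - n) w = 0" if "n \<in> {1..d}" for n w
    by (rule Suc.IH) (use Suc.prems that in auto)
  then show ?case by (simp add: raise_bra_def[of c "(raise_bra c ^^ k) bra0"])
qed simp

lemma exp_bra_alt: "exp_bra c d v = (\<Sum>k\<le>d. inverse (fact k) * (raise_bra c ^^ k) bra0 d v)"
  by (simp add: exp_bra_def bra0_def)

text \<open>The exponential series absorbs the factor k of \<open>raise_bra_pow_degree\<close>. With
  p_n = n c_n this is the recursion \<open>jt_degree_rec\<close>, bosons taking the place of row
  shifts.\<close>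

lemma exp_bra_rec:
  "of_nat d * exp_bra c d v = (\<Sum>n=1..d. of_nat n * c n * exp_bra c (d - n) (boson (int n) v))"
proof (cases d)
  case (Suc e)
  let ?R = "raise_bra c"
  have "of_nat d * exp_bra c d v = (\<Sum>k\<le>d. inverse (fact k) * (of_nat d * (?R ^^ k) bra0 d v))"
    by (simp add: exp_bra_alt sum_distrib_left mult.left_commute)
  also have "\<dots> = (\<Sum>k\<le>Suc e. inverse (fact k) * (of_nat k * raise_bra (\<lambda>n. of_nat n * c n) ((?R ^^ (k - 1)) bra0) d v))"
    unfolding raise_bra_pow_degree Suc ..
  also have "\<dots> = (\<Sum>k\<le>e. inverse (fact k) * raise_bra (\<lambda>n. of_nat n * c n) ((?R ^^ k) bra0) d v)"
    unfolding sum.atMost_Suc_shift by (simp add: field_simps del: of_nat_Suc)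
  also have "\<dots> = (\<Sum>n=1..d. of_nat n * c n * (\<Sum>k\<le>e. inverse (fact k) * (?R ^^ k) bra0 (d - n) (boson (int n) v)))"
    unfolding raise_bra_def[of "\<lambda>n. of_nat n * c n"] sum_distrib_left
    by (subst sum.swap) (simp add: mult_ac)
  also have "\<dots> = (\<Sum>n=1..d. of_nat n * c n * exp_bra c (d - n) (boson (int n) v))"
  proof (rule sum.cong)
    fix n assume n: "n \<in> {1..d}"
    have "(\<Sum>k\<le>e. inverse (fact k) * (?R ^^ k) bra0 (d - n) (boson (int n) v)) = exp_bra c (d - n) (boson (int n) v)"
      unfolding exp_bra_alt
      by (rule sum.mono_neutral_right) (use n Suc in \<open>auto simp: raise_bra_pow_eq_0\<close>)
    then show "of_nat n * c n * (\<Sum>k\<le>e. inverse (fact k) * (?R ^^ k) bra0 (d - n) (boson (int n) v))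
      = of_nat n * c n * exp_bra c (d - n) (boson (int n) v)" by simp
  qed simp
  finally show ?thesis .
qed simp

section \<open>Transposition symmetry of the bosons\<close>

definition linear_on_kets :: "('v \<Rightarrow> complex) \<Rightarrow> bool" where
  "linear_on_kets f \<longleftrightarrow> (\<forall>v\<in>kets_span. \<forall>w\<in>kets_span. f (v + w) = f v + f w) \<and>
     (\<forall>c. \<forall>v\<in>kets_span. f (scale c v) = c * f v)"

lemma kets_span_closed [simp]:
  "0 \<in> kets_span" "v \<in> kets_span \<Longrightarrow> w \<in> kets_span \<Longrightarrow> v + w \<in> kets_span"
  "v \<in> kets_span \<Longrightarrow> scale c v \<in> kets_span"
  by (auto simp: kets_span_def span_zero span_add span_scale)

lemma kets_span_sum: "(\<And>i. i \<in> I \<Longrightarrow> f i \<in> kets_span) \<Longrightarrow> (\<Sum>i\<in>I. f i) \<in> kets_span"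
  unfolding kets_span_def by (rule span_sum)

lemma linear_on_kets_sum:
  assumes "linear_on_kets f" "\<And>i. i \<in> I \<Longrightarrow> g i \<in> kets_span"
  shows "f (\<Sum>i\<in>I. g i) = (\<Sum>i\<in>I. f (g i))"
proof -
  have "f (scale 0 0) = 0 * f 0" using assms(1) unfolding linear_on_kets_def by (metis kets_span_closed(1))
  then have 0: "f 0 = 0" by simp
  show ?thesis
    using assms(2)
  proof (induction I rule: infinite_finite_induct)
    case (insert i I)
    then show ?case using assms(1) kets_span_sum[of I g] by (simp add: linear_on_kets_def)
  qed (auto simp: 0)
qed

lemma linear_bra: "linear_on_kets (bra la)"
  by (simp add: linear_on_kets_def bra_add bra_scale)

lemma kets_span_induct [consumes 1, case_names zero step]:
  assumes "v \<in> kets_span" "P 0" "\<And>c la v. v \<in> kets_span \<Longrightarrow> P v \<Longrightarrow> P (scale c (ket la) + v)"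
  shows "P v"
proof -
  have "v \<in> kets_span \<and> P v"
    using assms(1) unfolding kets_span_def
  proof (induction rule: span_induct_alt)
    case (step c x y)
    then show ?case using assms(3) by (auto simp: kets_span_def[symmetric])
  qed (use assms(2) span_zero in auto)
  then show ?thesis ..
qed

text \<open>\<open>cr j (an k _)\<close> acts as a derivation that replaces level k by level
  j.\<close>

lemma cr_an_foldr:
  "cr j (an k (foldr cr \<alpha> v)) = foldr cr \<alpha> (cr j (an k v))
    + (\<Sum>i<length \<alpha>. if \<alpha> ! i = k then foldr cr (\<alpha>[i := j]) v else 0)"
proof (induction \<alpha>)
  case (Cons a \<alpha>)
  have "cr j (an k (cr a w)) = (if a = k then cr j w else 0) + cr a (cr j (an k w))" for w
    by (auto simp: an_cr cr_cr[of j a])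
  then show ?case
    using Cons by (simp add: sum.lessThan_Suc_shift cr_sum if_distrib[of "cr a"] add.commute add.left_commute
        del: sum.lessThan_Suc cong: if_cong)
qed simp

lemma cr_an_ket:
  assumes "j \<noteq> k"
  obtains (zero) "cr j (an k (ket \<nu>)) = 0"
  | (ket) la \<epsilon> where "cr j (an k (ket \<nu>)) = scale \<epsilon> (ket la)" "\<epsilon> = 1 \<or> \<epsilon> = -1"
proof (cases "k \<in> maya \<nu>")
  case False
  then show ?thesis using zero an_ket[of k \<nu>] by simp
next
  case True
  define N where "N = max (plen \<nu>) (nat (- k))"
  let ?\<alpha> = "betas N \<nu>"
  obtain i where i: "k = beta \<nu> i" using True by (auto simp: maya_def)
  have iN: "i < N"
  proof (rule ccontr)
    assume "\<not> i < N"
    then have "beta \<nu> i = - int i - 1" by (intro beta_tail) (simp add: N_def)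
    then show False using i \<open>\<not> i < N\<close> by (simp add: N_def)
  qed
  have uniq: "?\<alpha> ! m = k \<longleftrightarrow> m = i" if "m < N" for m
    using that i injD[OF inj_beta[of \<nu>], of m i] by auto
  have "cr j (an k (wedge ?\<alpha>)) = (\<Sum>m<N. if ?\<alpha> ! m = k then wedge (?\<alpha>[m := j]) else 0)"
    unfolding wedge_def using an_sea[of N k] by (simp add: cr_an_foldr N_def cong: if_cong)
  also have "\<dots> = (\<Sum>m<N. if m = i then wedge (?\<alpha>[m := j]) else 0)"
    by (rule sum.cong) (use uniq in auto)
  also have "\<dots> = wedge (?\<alpha>[i := j])" using iN by simp
  finally have w: "cr j (an k (ket \<nu>)) = scale ((-1) ^ psize \<nu>) (wedge (?\<alpha>[i := j]))"
    using ket_eq_wedge[of \<nu> N] by (simp add: N_def)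
  show ?thesis
  proof (cases rule: wedge_cases[of "?\<alpha>[i := j]"])
    case 1: zero
    then show ?thesis using zero w by simp
  next
    case 2: (ket la \<epsilon>)
    then show ?thesis
      using ket[of "(-1) ^ psize \<nu> * \<epsilon>" la] w by (cases "even (psize \<nu>)") auto
  qed
qed

lemma cr_an_in_span [simp]: "j \<noteq> k \<Longrightarrow> cr j (an k (ket \<nu>)) \<in> kets_span"
  by (rule cr_an_ket[of j k \<nu>]) auto

text \<open>Moving a particle from k to j and back restores the ket. A sign is its own inverse, so
  both moves carry the same one.\<close>

lemma cr_an_ket_sym:
  assumes jk: "j \<noteq> k" and e: "cr j (an k (ket \<nu>)) = scale \<epsilon> (ket la)" "\<epsilon> = 1 \<or> \<epsilon> = -1"
  shows "cr k (an j (ket la)) = scale \<epsilon> (ket \<nu>)"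
proof -
  have nz: "cr j (an k (ket \<nu>)) \<noteq> 0" using e ket_nonzero[of la] by auto
  have k: "k \<in> maya \<nu>"
  proof (rule ccontr)
    assume "k \<notin> maya \<nu>"
    then have "an k (ket \<nu>) = 0" by (rule an_ket)
    then show False using nz by simp
  qed
  have j: "j \<notin> maya \<nu>"
  proof
    assume "j \<in> maya \<nu>"
    then have "cr j (ket \<nu>) = 0" by (rule cr_ket)
    then show False using nz an_cr[of k j "ket \<nu>"] jk by simp
  qed
  have "ket la = scale \<epsilon> (cr j (an k (ket \<nu>)))" unfolding e(1) using e(2) by auto
  then have "cr k (an j (ket la)) = scale \<epsilon> (cr k (an j (cr j (an k (ket \<nu>)))))" by simp
  also have "an j (cr j (an k (ket \<nu>))) = an k (ket \<nu>)"
    using an_an[of j k "ket \<nu>"] an_ket[OF j] by (simp add: an_cr)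
  finally show ?thesis using k by (simp add: number_ket)
qed

lemma bra_cr_an_sym:
  assumes jk: "j \<noteq> k"
  shows "bra la (cr j (an k (ket \<nu>))) = bra \<nu> (cr k (an j (ket la)))"
proof -
  have eq: "bra la (cr j (an k (ket \<nu>))) = bra \<nu> (cr k (an j (ket la)))"
    if "bra la (cr j (an k (ket \<nu>))) \<noteq> 0" and jk: "j \<noteq> k" for j k la \<nu>
  proof (rule cr_an_ket[OF jk, of \<nu>])
    assume "cr j (an k (ket \<nu>)) = 0"
    then show ?thesis using that by simp
  next
    fix la' \<epsilon> assume ket: "cr j (an k (ket \<nu>)) = scale \<epsilon> (ket la')" "\<epsilon> = 1 \<or> \<epsilon> = -1"
    then have "la' = la" using that by (auto simp: bra_scale bra_ket split: if_splits)
    then show ?thesis using ket cr_an_ket_sym[OF jk, of \<nu> \<epsilon> la] by (simp add: bra_scale bra_ket)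
  qed
  show ?thesis
  proof (cases "bra la (cr j (an k (ket \<nu>))) = 0")
    case True
    show ?thesis
    proof (rule ccontr)
      assume "bra la (cr j (an k (ket \<nu>))) \<noteq> bra \<nu> (cr k (an j (ket la)))"
      then have "bra \<nu> (cr k (an j (ket la))) \<noteq> 0" using True by simp
      from eq[OF this] this True jk show False by simp
    qed
  next
    case False
    show ?thesis by (rule eq[OF False jk])
  qed
qed

lemma boson_ket_in_span [simp]:
  assumes "n \<noteq> 0"
  shows "boson n (ket la) \<in> kets_span"
proof -
  obtain M where M: "\<And>A. finite A \<Longrightarrow> {- M..M} \<subseteq> A \<Longrightarrow> boson n (ket la) = (\<Sum>k\<in>A. cr (k - n) (an k (ket la)))"
    using boson_eq_sumE[OF assms] by blast
  show ?thesis
    unfolding M[OF finite_atLeastAtMost_int order_refl] using assms by (intro kets_span_sum) simp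
qed

lemma boson_in_span [simp]: "n \<noteq> 0 \<Longrightarrow> v \<in> kets_span \<Longrightarrow> boson n v \<in> kets_span"
proof -
  assume n: "n \<noteq> 0" and "v \<in> kets_span"
  from this(2) show ?thesis
    by (induction v rule: kets_span_induct) (use n in \<open>simp_all add: boson_0 boson_add boson_scale\<close>)
qed

lemma bra_boson_sym:
  assumes n: "n \<noteq> 0"
  shows "bra la (boson (- n) (ket \<nu>)) = bra \<nu> (boson n (ket la))"
proof -
  obtain M where M: "\<And>A. finite A \<Longrightarrow> {- M..M} \<subseteq> A \<Longrightarrow> boson n (ket la) = (\<Sum>k\<in>A. cr (k - n) (an k (ket la)))"
    using boson_eq_sumE[OF n] by blast
  have n': "- n \<noteq> 0" using n by simp
  obtain M' where M': "\<And>A. finite A \<Longrightarrow> {- M'..M'} \<subseteq> A \<Longrightarrow> boson (- n) (ket \<nu>) = (\<Sum>k\<in>A. cr (k - (- n)) (an k (ket \<nu>)))"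
    using boson_eq_sumE[OF n'] by blast
  \<comment> \<open>Replacing k by k + n matches the terms of the two sums, so \<open>A\<close>
    joins the window of one boson with the shifted window of the other.\<close>
  define A where "A = {- M'..M'} \<union> (\<lambda>k. k - n) ` {- M..M}"
  have A: "finite A" "{- M'..M'} \<subseteq> A" by (auto simp: A_def)
  have B: "finite ((\<lambda>k. k + n) ` A)" "{- M..M} \<subseteq> (\<lambda>k. k + n) ` A"
    by (auto simp: A_def image_Un image_image)
  have "boson n (ket la) = (\<Sum>k\<in>(\<lambda>k. k + n) ` A. cr (k - n) (an k (ket la)))" by (rule M[OF B])
  also have "\<dots> = (\<Sum>k\<in>A. cr k (an (k + n) (ket la)))"
    by (subst sum.reindex) (auto simp: inj_on_def)
  finally have "bra \<nu> (boson n (ket la)) = (\<Sum>k\<in>A. bra \<nu> (cr k (an (k + n) (ket la))))"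
    using n linear_on_kets_sum[OF linear_bra, of A "\<lambda>k. cr k (an (k + n) (ket la))" \<nu>] by simp
  moreover have "bra la (boson (- n) (ket \<nu>)) = (\<Sum>k\<in>A. bra la (cr (k + n) (an k (ket \<nu>))))"
    using n linear_on_kets_sum[OF linear_bra, of A "\<lambda>k. cr (k + n) (an k (ket \<nu>))" la] M'[OF A] by simp
  moreover have "bra la (cr (k + n) (an k (ket \<nu>))) = bra \<nu> (cr k (an (k + n) (ket la)))" for k
    using n by (intro bra_cr_an_sym) simp
  ultimately show ?thesis by simp
qed

text \<open>The expansion is claimed over every larger finite set too, so that two vectors can be
  expanded over the same one.\<close>

lemma ket_expansion:
  assumes "v \<in> kets_span"
  shows "\<exists>F. finite F \<and> (\<forall>G. finite G \<longrightarrow> F \<subseteq> G \<longrightarrow> v = (\<Sum>\<nu>\<in>G. scale (bra \<nu> v) (ket \<nu>)))"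
  using assms
proof (induction v rule: kets_span_induct)
  case zero
  show ?case by (intro exI[of _ "{}"]) simp
next
  case (step c la v)
  then obtain F where F: "finite F" "\<And>G. finite G \<Longrightarrow> F \<subseteq> G \<Longrightarrow> v = (\<Sum>\<nu>\<in>G. scale (bra \<nu> v) (ket \<nu>))"
    by blast
  show ?case
  proof (intro exI[of _ "insert la F"] conjI allI impI)
    fix G assume G: "finite G" "insert la F \<subseteq> G"
    have "(\<Sum>\<nu>\<in>G. scale (bra \<nu> (scale c (ket la) + v)) (ket \<nu>))
      = (\<Sum>\<nu>\<in>G. (if \<nu> = la then scale c (ket la) else 0) + scale (bra \<nu> v) (ket \<nu>))"
      using step(1) by (intro sum.cong) (auto simp: bra_add bra_scale bra_ket scale_left_distrib)
    also have "\<dots> = scale c (ket la) + v"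
      using G F(2)[of G] by (simp add: sum.distrib)
    finally show "scale c (ket la) + v = (\<Sum>\<nu>\<in>G. scale (bra \<nu> (scale c (ket la) + v)) (ket \<nu>))" ..
  qed (use F in simp)
qed

text \<open>\<open>\<phi>\<close> is the transpose of \<open>w\<close>; expansion in kets extends
  \<open>bra_boson_sym\<close> to arbitrary vectors of the span.\<close>

lemma bra_boson_adjoint:
  assumes n: "n \<noteq> 0" and w: "w \<in> kets_span" and \<phi>: "linear_on_kets \<phi>" "\<And>\<nu>. \<phi> (ket \<nu>) = bra \<nu> w"
  shows "bra la (boson (- n) w) = \<phi> (boson n (ket la))"
proof -
  let ?u = "boson n (ket la)"
  have u: "?u \<in> kets_span" using n by simp
  obtain F where F: "finite F" "\<And>G. finite G \<Longrightarrow> F \<subseteq> G \<Longrightarrow> ?u = (\<Sum>\<nu>\<in>G. scale (bra \<nu> ?u) (ket \<nu>))"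
    using ket_expansion[OF u] by blast
  obtain F' where F': "finite F'" "\<And>G. finite G \<Longrightarrow> F' \<subseteq> G \<Longrightarrow> w = (\<Sum>\<nu>\<in>G. scale (bra \<nu> w) (ket \<nu>))"
    using ket_expansion[OF w] by blast
  let ?G = "F \<union> F'"
  have "\<phi> ?u = \<phi> (\<Sum>\<nu>\<in>?G. scale (bra \<nu> ?u) (ket \<nu>))" using F(2)[of ?G] F(1) F'(1) by simp
  also have "\<dots> = (\<Sum>\<nu>\<in>?G. bra \<nu> ?u * bra \<nu> w)"
    by (subst linear_on_kets_sum[OF \<phi>(1)]) (use \<phi> in \<open>auto simp: linear_on_kets_def\<close>)
  also have "\<dots> = (\<Sum>\<nu>\<in>?G. bra la (boson (- n) (scale (bra \<nu> w) (ket \<nu>))))"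
    using n by (intro sum.cong) (auto simp: boson_scale bra_scale bra_boson_sym)
  also have "\<dots> = bra la (\<Sum>\<nu>\<in>?G. boson (- n) (scale (bra \<nu> w) (ket \<nu>)))"
    using n by (intro linear_on_kets_sum[OF linear_bra, symmetric]) simp
  also have "(\<Sum>\<nu>\<in>?G. boson (- n) (scale (bra \<nu> w) (ket \<nu>))) = boson (- n) (\<Sum>\<nu>\<in>?G. scale (bra \<nu> w) (ket \<nu>))"
    using n by (intro boson_sum[symmetric]) simp
  also have "(\<Sum>\<nu>\<in>?G. scale (bra \<nu> w) (ket \<nu>)) = w" using F'(2)[of ?G] F(1) F'(1) by simp
  finally show ?thesis ..
qed

lemma linear_bra0: "linear_on_kets (bra0 d)"
  by (simp add: bra0_def linear_bra) (simp add: linear_on_kets_def)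

lemma linear_raise_bra: "(\<And>d. linear_on_kets (b d)) \<Longrightarrow> linear_on_kets (raise_bra c b d)"
  unfolding linear_on_kets_def raise_bra_def
  by (auto simp: boson_add boson_scale sum.distrib[symmetric] sum_distrib_left algebra_simps intro!: sum.cong)

lemma linear_raise_bra_pow: "linear_on_kets ((raise_bra c ^^ k) bra0 d)"
  by (induction k arbitrary: d) (auto simp: linear_bra0 intro: linear_raise_bra)

lemma linear_exp_bra: "linear_on_kets (exp_bra c d)"
  using linear_raise_bra_pow[where c = c and d = d] unfolding linear_on_kets_def exp_bra_alt
  by (auto simp: sum.distrib[symmetric] sum_distrib_left algebra_simps)

lemma exp_bra_wedge:
  "exp_bra c d (wedge \<alpha>) = (if degree_seq (length \<alpha>) (\<lambda>i. \<alpha> ! i) = int d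
     then jt (length \<alpha>) (\<lambda>n. of_nat n * c n) (\<lambda>i. \<alpha> ! i) else 0)"
proof (induction d arbitrary: \<alpha> rule: less_induct)
  case (less d)
  let ?N = "length \<alpha>" and ?p = "\<lambda>n. of_nat n * c n"
  show ?case
  proof (cases "d = 0")
    case True
    have "exp_bra c 0 (wedge \<alpha>) = jt ?N (\<lambda>_. 0) (\<lambda>i. \<alpha> ! i)"
      by (simp add: exp_bra_alt bra0_def bra_empty_wedge)
    then show ?thesis
      using True jt_degree_0[of ?N "\<lambda>i. \<alpha> ! i" "\<lambda>_. 0" ?p] jt_zero_psum_degree[of ?N "\<lambda>i. \<alpha> ! i"] by auto
  next
    case False
    have deg: "degree_seq ?N (\<lambda>j. \<alpha>[i := \<alpha> ! i - int n] ! j) = degree_seq ?N (\<lambda>i. \<alpha> ! i) - int n"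
      if "i < ?N" for i n
    proof -
      have "degree_seq ?N (\<lambda>j. \<alpha>[i := \<alpha> ! i - int n] ! j) = (\<Sum>j<?N. (\<alpha> ! j + int j + 1) - (if j = i then int n else 0))"
        unfolding degree_seq_def by (rule sum.cong) (auto simp: nth_list_update)
      then show ?thesis using that by (simp add: sum_subtractf degree_seq_def)
    qed
    have upd: "jt ?N ?p (\<lambda>j. \<alpha>[i := \<alpha> ! i - int n] ! j) = jt ?N ?p ((\<lambda>j. \<alpha> ! j)(i := \<alpha> ! i - int n))" for i n
      by (rule jt_cong) (auto simp: nth_list_update)
    have "of_nat d * exp_bra c d (wedge \<alpha>)
      = (\<Sum>n=1..d. ?p n * (\<Sum>i<?N. exp_bra c (d - n) (wedge (\<alpha>[i := \<alpha> ! i - int n]))))"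
      unfolding exp_bra_rec
      by (rule sum.cong) (auto simp: boson_wedge linear_on_kets_sum[OF linear_exp_bra])
    also have "\<dots> = (\<Sum>n=1..d. ?p n * (\<Sum>i<?N. if degree_seq ?N (\<lambda>i. \<alpha> ! i) = int d
        then jt ?N ?p ((\<lambda>j. \<alpha> ! j)(i := \<alpha> ! i - int n)) else 0))"
    proof (rule sum.cong[OF refl], rule arg_cong[where f = "\<lambda>x. _ * x"], rule sum.cong[OF refl])
      fix n i assume n: "n \<in> {1..d}" and i: "i \<in> {..<?N}"
      have "d - n < d" using n by auto
      then have "exp_bra c (d - n) (wedge (\<alpha>[i := \<alpha> ! i - int n]))
        = (if degree_seq ?N (\<lambda>j. \<alpha>[i := \<alpha> ! i - int n] ! j) = int (d - n)
           then jt ?N ?p (\<lambda>j. \<alpha>[i := \<alpha> ! i - int n] ! j) else 0)"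
        using less.IH[of "d - n" "\<alpha>[i := \<alpha> ! i - int n]"] by simp
      then show "exp_bra c (d - n) (wedge (\<alpha>[i := \<alpha> ! i - int n]))
        = (if degree_seq ?N (\<lambda>i. \<alpha> ! i) = int d then jt ?N ?p ((\<lambda>j. \<alpha> ! j)(i := \<alpha> ! i - int n)) else 0)"
        unfolding upd using deg[of i n] n i by (auto simp: of_nat_diff)
    qed
    also have "\<dots> = (if degree_seq ?N (\<lambda>i. \<alpha> ! i) = int d then of_nat d * jt ?N ?p (\<lambda>i. \<alpha> ! i) else 0)"
      using jt_degree_rec[of ?N "\<lambda>i. \<alpha> ! i" d ?p] by simp
    finally show ?thesis using False by (auto split: if_splits)
  qed
qed

theorem exp_bra_ket:
  assumes "plen la \<le> K"
  shows "exp_bra c d (ket la) = (if d = psize la then (-1) ^ psize la * jt K (\<lambda>n. of_nat n * c n) (beta la) else 0)"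
proof -
  have 1: "jt K p (\<lambda>i. betas K la ! i) = jt K p (beta la)" for p
    by (rule jt_cong) simp
  have "degree_seq K (\<lambda>i. betas K la ! i) = degree_seq K (beta la)"
    unfolding degree_seq_def by (rule sum.cong) auto
  then have 2: "degree_seq K (\<lambda>i. betas K la ! i) = int (psize la)" by (simp add: degree_betas[OF assms])
  have "exp_bra c d (ket la) = (-1) ^ psize la * exp_bra c d (wedge (betas K la))"
    unfolding ket_eq_wedge[OF assms] using linear_exp_bra by (simp add: linear_on_kets_def)
  then show ?thesis unfolding exp_bra_wedge length_betas 1 2 by auto
qed

section \<open>Completed kets and the mixed inner products\<close>

definition ket0 :: "nat \<Rightarrow> 'v" where
  "ket0 = (\<lambda>e. if e = 0 then vac else 0)"

lemma ket_empty: "ket empty_part = vac"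
  using ket_eq_wedge[of empty_part 0] by (simp add: wedge_def betas_def)

lemma raise_ket_pow_in_span: "(raise_ket c ^^ k) ket0 d \<in> kets_span"
proof (induction k arbitrary: d)
  case 0
  show ?case using ket_in_span[of empty_part] by (simp add: ket0_def ket_empty)
next
  case (Suc k)
  then show ?case by (auto simp: raise_ket_def intro!: kets_span_sum)
qed

text \<open>\<open>bra_boson_adjoint\<close> moves one boson across at a time, and the induction
  hypothesis provides the transposed bra.\<close>

lemma bra_raise_ket_pow: "bra la ((raise_ket c ^^ k) ket0 d) = (raise_bra c ^^ k) bra0 d (ket la)"
proof (induction k arbitrary: la d)
  case 0
  have "bra la vac = bra empty_part (ket la)"
    using bra_ket[of la empty_part] bra_ket[of empty_part la] by (auto simp: ket_empty)
  then show ?case by (simp add: ket0_def bra0_def)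
next
  case (Suc k)
  let ?w = "\<lambda>n. (raise_ket c ^^ k) ket0 (d - n)"
  have "bra la ((raise_ket c ^^ Suc k) ket0 d) = bra la (\<Sum>n=1..d. scale (c n) (boson (- int n) (?w n)))"
    by (simp add: raise_ket_def)
  also have "\<dots> = (\<Sum>n=1..d. bra la (scale (c n) (boson (- int n) (?w n))))"
    by (rule linear_on_kets_sum[OF linear_bra]) (auto simp: raise_ket_pow_in_span)
  also have "\<dots> = (\<Sum>n=1..d. c n * (raise_bra c ^^ k) bra0 (d - n) (boson (int n) (ket la)))"
  proof (rule sum.cong)
    fix n assume "n \<in> {1..d}"
    then have n: "int n \<noteq> 0" by auto
    have "bra la (boson (- int n) (?w n)) = (raise_bra c ^^ k) bra0 (d - n) (boson (int n) (ket la))"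
      by (rule bra_boson_adjoint[OF n raise_ket_pow_in_span linear_raise_bra_pow]) (rule Suc.IH[symmetric])
    then show "bra la (scale (c n) (boson (- int n) (?w n))) = c n * (raise_bra c ^^ k) bra0 (d - n) (boson (int n) (ket la))"
      using n by (simp add: bra_scale raise_ket_pow_in_span)
  qed simp
  finally show ?case by (simp add: raise_bra_def[of c "(raise_bra c ^^ k) bra0"])
qed

theorem bra_exp_ket: "bra la (exp_ket c d) = exp_bra c d (ket la)"
proof -
  have "bra la (exp_ket c d) = (\<Sum>k\<le>d. bra la (scale (inverse (fact k)) ((raise_ket c ^^ k) ket0 d)))"
    unfolding exp_ket_def ket0_def[symmetric]
    by (rule linear_on_kets_sum[OF linear_bra]) (simp add: raise_ket_pow_in_span)
  then show ?thesis by (simp add: bra_scale raise_ket_pow_in_span bra_raise_ket_pow exp_bra_alt)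
qed

lemma exp_ket_in_span: "exp_ket c d \<in> kets_span"
  unfolding exp_ket_def ket0_def[symmetric]
  by (rule kets_span_sum) (simp add: raise_ket_pow_in_span)

lemma infsum_single_degree: "(\<Sum>\<^sub>\<infinity>d. if d = m then f d else 0) = (f m :: complex)" for m :: nat
proof -
  have "(\<Sum>\<^sub>\<infinity>d. if d = m then f d else 0) = (\<Sum>\<^sub>\<infinity>d\<in>{m}. if d = m then f d else 0)"
    by (rule infsum_cong_neutral) auto
  then show ?thesis by simp
qed

text \<open>The exponents l - la_l are those of \<open>q_vars t la\<close> raised by 1/2. The
  variables are thus \<open>t * q_vars t la l\<close>, and homogeneity gives
  \<open>t ^ psize \<mu>\<close>; the sign comes from \<open>ket\<close> against
  \<open>wedge\<close>.\<close>

lemma S_bra_ket_eq: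
  assumes t: "t \<noteq> 0" "norm t < 1"
  shows "S_bra_ket (t\<^sup>2) la \<mu> = norm_bra la (t\<^sup>2) * ((- t) ^ psize \<mu> * schur \<mu> (q_vars t la))"
proof -
  let ?x = "\<lambda>l. t * q_vars t la l"
  define c where "c = (\<lambda>n. (1 / of_nat n) * (\<Sum>\<^sub>\<infinity>l\<in>{1..}. t\<^sup>2 powi ((- int (part la l) + int l) * int n)))"
  have p: "of_nat n * c n = power_sum ?x n" if n: "1 \<le> n" for n
  proof -
    have "t\<^sup>2 powi ((- int (part la l) + int l) * int n) = ?x l ^ n" for l
    proof -
      have "t\<^sup>2 powi (- int (part la l) + int l) = t powi (1 + (2 * (int l - int (part la l)) - 1))"
        unfolding power2_powi by (rule arg_cong[where f = "\<lambda>k. t powi k"]) simp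
      also have "\<dots> = ?x l" using t by (subst power_int_add) (auto simp: q_vars_def)
      finally show ?thesis by (simp only: power_int_mult power_int_of_nat)
    qed
    then show ?thesis using n by (simp add: c_def power_sum_def)
  qed
  have sm: "summable (\<lambda>i. norm (?x (Suc i)))"
    using summable_mult[OF q_vars_summable[OF t], of "norm t"] by (simp add: norm_mult)
  have s: "jt (plen \<mu>) (\<lambda>n. of_nat n * c n) (beta \<mu>) = t ^ psize \<mu> * schur \<mu> (q_vars t la)"
    using jt_cong_psum[OF p] schur_eq_jt[OF sm order_refl] by (simp add: schur_scale)
  have "S_bra_ket (t\<^sup>2) la \<mu> = (\<Sum>\<^sub>\<infinity>d. if d = psize \<mu>
      then norm_bra la (t\<^sup>2) * ((-1) ^ psize \<mu> * (t ^ psize \<mu> * schur \<mu> (q_vars t la))) else 0)"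
    unfolding S_bra_ket_def S_bra_def c_def[symmetric] exp_bra_ket[OF order_refl] s
    by (rule infsum_cong) simp
  also have "\<dots> = norm_bra la (t\<^sup>2) * ((-1) ^ psize \<mu> * (t ^ psize \<mu> * schur \<mu> (q_vars t la)))"
    by (rule infsum_single_degree)
  finally show ?thesis by (simp add: power_minus[of t])
qed

text \<open>Here the exponents are lowered by 1/2. The minus sign in the exponential negates the
  power sums, and the dual Jacobi-Trudi formula turns the ket of the conjugate into the Schur
  function of \<open>\<mu>\<close> itself.\<close>

lemma bra_S_ket_eq:
  assumes t: "t \<noteq> 0" "norm t < 1"
  shows "bra_S_ket (t\<^sup>2) (conj_part \<mu>) (conj_part la)
    = norm_ket (conj_part la) (t\<^sup>2) * (inverse t ^ psize \<mu> * schur \<mu> (q_vars t la))"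
proof -
  let ?x = "\<lambda>l. inverse t * q_vars t la l"
  define c where "c = (\<lambda>n. - (1 / of_nat n) * (\<Sum>\<^sub>\<infinity>l\<in>{1..}. t\<^sup>2 powi ((- int (part la l) + int l - 1) * int n)))"
  have p: "of_nat n * c n = - power_sum ?x n" if n: "1 \<le> n" for n
  proof -
    have "t\<^sup>2 powi ((- int (part la l) + int l - 1) * int n) = ?x l ^ n" for l
    proof -
      have "t\<^sup>2 powi (- int (part la l) + int l - 1) = t powi (- 1 + (2 * (int l - int (part la l)) - 1))"
        unfolding power2_powi by (rule arg_cong[where f = "\<lambda>k. t powi k"]) simp
      also have "\<dots> = ?x l" using t by (subst power_int_add) (auto simp: q_vars_def)
      finally show ?thesis by (simp only: power_int_mult power_int_of_nat)
    qed
    then show ?thesis using n by (simp add: c_def power_sum_def)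
  qed
  have sm: "summable (\<lambda>i. norm (?x (Suc i)))"
    using summable_mult[OF q_vars_summable[OF t], of "norm (inverse t)"] by (simp only: norm_mult)
  let ?K = "plen (conj_part \<mu>)"
  have s: "(-1) ^ psize \<mu> * jt ?K (\<lambda>n. of_nat n * c n) (beta (conj_part \<mu>)) = inverse t ^ psize \<mu> * schur \<mu> (q_vars t la)"
    using jt_cong_psum[OF p, where K = ?K and \<alpha> = "beta (conj_part \<mu>)"] schur_eq_jt_conj[OF sm, of \<mu> ?K] schur_scale[of \<mu> "inverse t"]
    by (simp add: plen_conj)
  have "bra_S_ket (t\<^sup>2) (conj_part \<mu>) (conj_part la)
    = (\<Sum>\<^sub>\<infinity>d. norm_ket (conj_part la) (t\<^sup>2) * exp_bra c d (ket (conj_part \<mu>)))"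
    unfolding bra_S_ket_def S_ket_def conj_conj c_def[symmetric]
    by (simp add: bra_scale exp_ket_in_span bra_exp_ket)
  also have "\<dots> = (\<Sum>\<^sub>\<infinity>d. if d = psize \<mu>
      then norm_ket (conj_part la) (t\<^sup>2) * (inverse t ^ psize \<mu> * schur \<mu> (q_vars t la)) else 0)"
    unfolding exp_bra_ket[OF order_refl] psize_conj s by (rule infsum_cong) simp
  also have "\<dots> = norm_ket (conj_part la) (t\<^sup>2) * (inverse t ^ psize \<mu> * schur \<mu> (q_vars t la))"
    by (rule infsum_single_degree)
  finally show ?thesis .
qed

end

theorem proposition4p2:
  fixes scale :: "complex \<Rightarrow> 'v::ab_group_add \<Rightarrow> 'v"
    and psi psid :: "rat \<Rightarrow> 'v \<Rightarrow> 'v"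
    and vac :: 'v
    and q t :: complex
    and la \<mu> :: partition
  assumes "fermion_fock scale psi psid vac"
    and "0 < norm q" and "norm q < 1"
    and "t\<^sup>2 = q"
  shows "hopf_link t la \<mu> =
           t powi kappa la * t powi kappa \<mu> * (- inverse t) ^ (psize la + psize \<mu>) *
           inverse (norm_ket empty_part q) * fermion_fock.S_bra_ket scale psi psid vac q la \<mu> \<and>
         hopf_link t la \<mu> =
           t powi kappa la * t powi kappa \<mu> * t ^ (psize la + psize \<mu>) *
           inverse (norm_ket empty_part q) *
           fermion_fock.bra_S_ket scale psi psid vac q (conj_part \<mu>) (conj_part la)"
proof -
  interpret fermion_fock scale psi psid vac by (rule assms(1))
  have t: "t \<noteq> 0" "norm t < 1"
    using assms(2-4) by (auto simp: norm_power power_less_one_iff)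
  \<comment> \<open>The form of the Hopf link that both inner products supply: the first factor
    comes from the normalization of the S-dual vector, the second from the matrix element.\<close>
  define W where "W = schur la (q_vars t empty_part) * schur \<mu> (q_vars t la)"
  let ?n = "norm_ket empty_part q"
  have n: "?n \<noteq> 0" using norm_factors(1)[OF t] assms(4) by simp
  have W: "hopf_link t la \<mu> = t powi kappa la * t powi kappa \<mu> * W"
    unfolding hopf_link_eq schur_q_vars_symmetric[OF t, of \<mu> la] W_def ..
  have bra: "S_bra_ket q la \<mu> = (- t) ^ (psize la + psize \<mu>) * ?n * W"
    using S_bra_ket_eq[OF t, of la \<mu>] norm_factors(2)[OF t, of la] assms(4)
    by (simp add: W_def power_add mult_ac)
  have ket: "bra_S_ket q (conj_part \<mu>) (conj_part la) = inverse t ^ (psize la + psize \<mu>) * ?n * W"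
    using bra_S_ket_eq[OF t, of \<mu> la] norm_factors(3)[OF t, of la] assms(4)
    by (simp add: W_def power_add mult_ac)
  have 1: "(- inverse t) ^ k * (- t) ^ k = 1" and 2: "t ^ k * inverse t ^ k = 1" for k
    using t by (simp_all add: power_mult_distrib[symmetric])
  have ni: "inverse ?n * ?n = 1" using n by simp
  have "t powi kappa la * t powi kappa \<mu> * (- inverse t) ^ (psize la + psize \<mu>) * inverse ?n * S_bra_ket q la \<mu>
      = t powi kappa la * t powi kappa \<mu> * W
        * ((- inverse t) ^ (psize la + psize \<mu>) * (- t) ^ (psize la + psize \<mu>)) * (inverse ?n * ?n)"
    unfolding bra by (simp only: mult_ac)
  then have bra_W: "t powi kappa la * t powi kappa \<mu> * (- inverse t) ^ (psize la + psize \<mu>) * inverse ?n * S_bra_ket q la \<mu>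
      = t powi kappa la * t powi kappa \<mu> * W" unfolding 1 ni mult_1_right .
  have "t powi kappa la * t powi kappa \<mu> * t ^ (psize la + psize \<mu>) * inverse ?n * bra_S_ket q (conj_part \<mu>) (conj_part la)
      = t powi kappa la * t powi kappa \<mu> * W
        * (t ^ (psize la + psize \<mu>) * inverse t ^ (psize la + psize \<mu>)) * (inverse ?n * ?n)"
    unfolding ket by (simp only: mult_ac)
  then have ket_W: "t powi kappa la * t powi kappa \<mu> * t ^ (psize la + psize \<mu>) * inverse ?n * bra_S_ket q (conj_part \<mu>) (conj_part la)
      = t powi kappa la * t powi kappa \<mu> * W" unfolding 2 ni mult_1_right .
  show ?thesis unfolding W bra_W ket_W by (rule conjI[OF refl refl])
qed

end
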